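(* Let $d\ge 2$ be fixed. For all norms $\|\cdot\|$ on $\mathbb{R}^d$ besides a meagre set, we have $D_{\|\cdot\|}(n)=(1-o(1))n$, where the $o(1)$-term tends to zero as $n\to\infty$; that is, $\lim_{n\to\infty} D_{\|\cdot\|}(n)/n=1$. In particular, for every such norm and every $\varepsilon>0$ there is $n_0$ such that for all $n\ge n_0$, any $n$ distinct points in $\mathbb{R}^d$ determine at least $(1-\varepsilon)n$ distinct distances according to $\|\cdot\|$.
   Context: A $d$-norm is a norm on $\mathbb{R}^d$. For a $d$-norm $\|\cdot\|$, $D_{\|\cdot\|}(n)$ denotes the minimum, over all sets of $n$ distinct points in $\mathbb{R}^d$, of the number of distinct values $\|\mathbf{p}-\mathbf{q}\|$ where $\mathbf{p}\ne\mathbf{q}$ range over the points of the set. Let $\mathcal{B}_d$ be the set of all closed, bounded, $\mathbf{0}$-symmetric convex bodies in $\mathbb{R}^d$ containing $\mathbf{0}$ in the interior. The map sending a norm $\|\cdot\|$ to its unit ball $\{\mathbf{x}\in\mathbb{R}^d: \|\mathbf{x}\|\le 1\}$ is a bijection between $d$-norms and $\mathcal{B}_d$. The set $\mathcal{B}_d$ is endowed with the Hausdorff metric $d_H(A,B)=\max\{\sup_{\mathbf{a}\in A}\inf_{\mathbf{b}\in B}\|\mathbf{a}-\mathbf{b}\|_2,\ \sup_{\mathbf{b}\in B}\inf_{\mathbf{a}\in A}\|\mathbf{a}-\mathbf{b}\|_2\}$, where $\|\cdot\|_2$ is the Euclidean norm. A set in a metric space is nowhere dense if every non-empty open set contains a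 non-empty open subset disjoint from it; a meagre set is a countable union of nowhere dense sets. A property holds for all $d$-norms besides a meagre set if the set of unit balls of the $d$-norms failing the property is a meagre set in $(\mathcal{B}_d,d_H)$. *)

theory Defs
  imports "HOL-Analysis.Analysis"
begin

section \<open>Norms and distinct distances\<close>

definition is_norm :: "('a::real_vector \<Rightarrow> real) \<Rightarrow> bool" where
  "is_norm N \<longleftrightarrow>
     (\<forall>x. 0 \<le> N x) \<and>
     (\<forall>x. N x = 0 \<longleftrightarrow> x = 0) \<and>
     (\<forall>c x. N (c *\<^sub>R x) = \<bar>c\<bar> * N x) \<and>
     (\<forall>x y. N (x + y) \<le> N x + N y)"

definition unit_ball :: "('a \<Rightarrow> real) \<Rightarrow> 'a set" where
  "unit_ball N = {x. N x \<le> 1}"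

definition distances :: "('a::ab_group_add \<Rightarrow> real) \<Rightarrow> 'a set \<Rightarrow> real set" where
  "distances N S = {N (p - q) | p q. p \<in> S \<and> q \<in> S \<and> p \<noteq> q}"

text \<open>The conjunct \<open>finite S\<close> only matters for \<open>n = 0\<close>, since infinite sets have cardinality \<open>0\<close>.\<close>

definition min_distances :: "('a::ab_group_add \<Rightarrow> real) \<Rightarrow> nat \<Rightarrow> nat" where
  "min_distances N n =
     (LEAST k. \<exists>S. finite S \<and> card S = n \<and> card (distances N S) = k)"


section \<open>The metric space of symmetric convex bodies\<close>

definition sym_bodies :: "'a::euclidean_space set set" where
  "sym_bodies =
     {K. closed K \<and> bounded K \<and> convex K \<and> (\<forall>x\<in>K. - x \<in> K) \<and> 0 \<in> interior K}"

text \<open>The distances are Euclidean when \<open>'a\<close> is a Euclidean space. The value \<open>0\<close> on empty or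
  unbounded sets is a convention; it makes the function total and nonnegative, as the locale
  \<open>Metric_space\<close> requires, and is irrelevant on \<^const>\<open>sym_bodies\<close>.\<close>

definition hausdorff_dist :: "'a::metric_space set \<Rightarrow> 'a set \<Rightarrow> real" where
  "hausdorff_dist A B =
     (if A \<noteq> {} \<and> B \<noteq> {} \<and> bounded A \<and> bounded B
      then max (SUP a\<in>A. INF b\<in>B. dist a b) (SUP b\<in>B. INF a\<in>A. dist a b)
      else 0)"

lemma hausdorff_dist_eq_infdist:
  assumes "A \<noteq> {}" "B \<noteq> {}" "bounded A" "bounded B"
  shows "hausdorff_dist A B = max (SUP a\<in>A. infdist a B) (SUP b\<in>B. infdist b A)"
  using assms by (simp add: hausdorff_dist_def infdist_def dist_commute)

lemma bdd_above_infdist: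
  assumes "A \<noteq> {}" "B \<noteq> {}" "bounded A" "bounded B"
  shows "bdd_above ((\<lambda>a. infdist a B) ` A)"
proof -
  from assms(2) obtain b where b: "b \<in> B" by blast
  from assms(3) obtain e where e: "\<forall>a\<in>A. dist b a \<le> e"
    using bounded_any_center by blast
  show ?thesis
    using e infdist_le[OF b] by (intro bdd_aboveI2[where M = e]) (metis dist_commute order_trans)
qed

lemma hausdorff_dist_le_iff:
  assumes "A \<noteq> {}" "B \<noteq> {}" "bounded A" "bounded B"
  shows "hausdorff_dist A B \<le> r \<longleftrightarrow>
    (\<forall>a\<in>A. infdist a B \<le> r) \<and> (\<forall>b\<in>B. infdist b A \<le> r)"
  using assms bdd_above_infdist[of A B] bdd_above_infdist[of B A]
  by (simp add: hausdorff_dist_eq_infdist cSUP_le_iff)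

lemma hausdorff_dist_commute: "hausdorff_dist A B = hausdorff_dist B A"
  by (auto simp: hausdorff_dist_def dist_commute max.commute)

lemma hausdorff_dist_nonneg: "0 \<le> hausdorff_dist A B"
proof (cases "A \<noteq> {} \<and> B \<noteq> {} \<and> bounded A \<and> bounded B")
  case True
  then obtain a where "a \<in> A" by blast
  have "0 \<le> infdist a B" by (rule infdist_nonneg)
  also have "\<dots> \<le> hausdorff_dist A B"
    using hausdorff_dist_le_iff[of A B "hausdorff_dist A B"] True \<open>a \<in> A\<close> by simp
  finally show ?thesis .
qed (auto simp: hausdorff_dist_def)

lemma infdist_triangle_hausdorff:
  assumes "B \<noteq> {}" "C \<noteq> {}" "bounded B" "bounded C"
  shows "infdist a C \<le> infdist a B + hausdorff_dist B C"
proof -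
  have "infdist a C - hausdorff_dist B C \<le> dist a b" if "b \<in> B" for b
  proof -
    have "infdist b C \<le> hausdorff_dist B C"
      using hausdorff_dist_le_iff[of B C "hausdorff_dist B C"] assms that by simp
    then show ?thesis using infdist_triangle[of a C b] by linarith
  qed
  then have "infdist a C - hausdorff_dist B C \<le> infdist a B"
    using assms(1) by (simp add: infdist_def cINF_greatest)
  then show ?thesis by simp
qed

lemma Metric_space_sym_bodies: "Metric_space sym_bodies hausdorff_dist"
proof
  have ne: "K \<noteq> {}" "bounded K" "closed K" if "K \<in> sym_bodies" for K :: "'a set"
    using that interior_subset by (auto simp: sym_bodies_def)
  fix A B C :: "'a set"
  show "0 \<le> hausdorff_dist A B" by (rule hausdorff_dist_nonneg)
  show "hausdorff_dist A B = hausdorff_dist B A" by (rule hausdorff_dist_commute)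
  assume A: "A \<in> sym_bodies" and B: "B \<in> sym_bodies"
  have "hausdorff_dist A B = 0 \<longleftrightarrow> hausdorff_dist A B \<le> 0"
    using hausdorff_dist_nonneg[of A B] by linarith
  also have "\<dots> \<longleftrightarrow> (\<forall>a\<in>A. infdist a B = 0) \<and> (\<forall>b\<in>B. infdist b A = 0)"
    using ne[OF A] ne[OF B] by (simp add: hausdorff_dist_le_iff infdist_nonneg order_antisym_conv)
  also have "\<dots> \<longleftrightarrow> A = B"
    using in_closed_iff_infdist_zero[OF ne(3,1)[OF A]] in_closed_iff_infdist_zero[OF ne(3,1)[OF B]]
    by blast
  finally show "hausdorff_dist A B = 0 \<longleftrightarrow> A = B" .
  assume C: "C \<in> sym_bodies"
  let ?r = "hausdorff_dist A B + hausdorff_dist B C"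
  have "infdist a C \<le> ?r" if "a \<in> A" for a
    using infdist_triangle_hausdorff[of B C a] hausdorff_dist_le_iff[of A B "hausdorff_dist A B"]
      ne[OF A] ne[OF B] ne[OF C] that by fastforce
  moreover have "infdist c A \<le> ?r" if "c \<in> C" for c
    using infdist_triangle_hausdorff[of B A c] hausdorff_dist_le_iff[of C B "hausdorff_dist C B"]
      ne[OF A] ne[OF B] ne[OF C] that
    by (fastforce simp: hausdorff_dist_commute[of B A] hausdorff_dist_commute[of C B])
  ultimately show "hausdorff_dist A C \<le> ?r"
    using ne[OF A] ne[OF C] by (simp add: hausdorff_dist_le_iff)
qed

definition sym_body_topology :: "'a::euclidean_space set topology" where
  "sym_body_topology = Metric_space.mtopology sym_bodies hausdorff_dist"


section \<open>Meagre sets\<close>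

definition nowhere_dense_in :: "'a topology \<Rightarrow> 'a set \<Rightarrow> bool" where
  "nowhere_dense_in X S \<longleftrightarrow> S \<subseteq> topspace X \<and>
     (\<forall>U. openin X U \<and> U \<noteq> {} \<longrightarrow> (\<exists>V. openin X V \<and> V \<noteq> {} \<and> V \<subseteq> U \<and> V \<inter> S = {}))"

definition meagre_in :: "'a topology \<Rightarrow> 'a set \<Rightarrow> bool" where
  "meagre_in X S \<longleftrightarrow>
     (\<exists>F :: nat \<Rightarrow> 'a set. (\<forall>i. nowhere_dense_in X (F i)) \<and> S = (\<Union>i. F i))"

definition for_norms_besides_meagre ::
    "(('a::euclidean_space \<Rightarrow> real) \<Rightarrow> bool) \<Rightarrow> bool" where
  "for_norms_besides_meagre P \<longleftrightarrow>
     meagre_in sym_body_topology {unit_ball N | N. is_norm N \<and> \<not> P N}"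

end

theory Submission
  imports Defs
begin

text \<open>
  Fix a norm and \<open>n\<close> points that determine \<open>m\<close> distances. The proof plays two counts of the
  directions of the differences of these points against each other.

  The count from above is a dimension count. Suppose that vectors \<open>v\<^sub>1, \<dots>, v\<^sub>k\<close> depend on \<open>a\<close> real
  parameters, that they are pairwise non-parallel, and that their prescribed lengths depend on the same
  parameters. The lengths of \<open>k\<close> vectors in different directions can be moved independently of each
  other by perturbing the norm, so if \<open>k > a\<close> then a norm in general position has no values of the
  parameters for which all lengths are right. This is \<open>perturb_avoids_config\<close>. The perturbation adds
  small bumps to the norm in the directions of a finite net; if every choice of heights on a
  grid were bad, then two choices would come from nearly the same parameters, although the parameters
  and the vectors determine the heights. Since only countably many parametrisations by integer
  polynomials exist, a norm outside a meagre set, called \<open>typical\<close> below, avoids all of them.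

  For a set \<open>S\<close> of points, the parameters are the \<open>m\<close> distances and the coordinates of a basis of the
  differences over the ring generated by the distances. If the basis has \<open>l\<close> elements, the
  parameters number \<open>m + d l\<close>, so this bounds the number of directions
  (\<open>typical_span_bound\<close>). The differences of two basis vectors already have pairwise different
  directions, because the ratio of two parallel differences is, up to sign, a ratio of distances. So there
  are at least about \<open>l\<^sup>2 / 4\<close> directions, and \<open>l\<close> is of order at most \<open>\<surd>n\<close> if \<open>m \<le> n\<close>. Hence the
  differences have at most \<open>m + O(\<surd>n)\<close> directions (\<open>typical_noncollinear_bound\<close>).

  The count from below is Ungar's theorem: \<open>2k\<close> points of the plane that are not collinear have at least
  \<open>2k\<close> directions (\<open>ungar\<close>). A generic projection to the plane extends it to higher dimensions
  (\<open>many_directions\<close>). So \<open>m \<ge> n - O(\<surd>n)\<close>, unless almost all points are collinear; but collinear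
  points have at least as many distances from an end point as there are other points. In the other
  direction, \<open>n\<close> points in arithmetic progression determine only \<open>n - 1\<close> distances.
\<close>


section \<open>Norms and their unit balls\<close>

lemma is_normD:
  assumes "is_norm N"
  shows "0 \<le> N x" "N x = 0 \<longleftrightarrow> x = 0" "N (c *\<^sub>R x) = \<bar>c\<bar> * N x" "N (x + y) \<le> N x + N y"
  using assms by (auto simp: is_norm_def)

lemma is_norm_minus: "is_norm N \<Longrightarrow> N (- x) = N x"
  using is_normD(3)[of N "-1" x] by simp

lemma is_norm_diff_le: assumes "is_norm N" shows "\<bar>N x - N y\<bar> \<le> N (x - y)"
  using is_normD(4)[OF assms, of "x - y" y] is_normD(4)[OF assms, of "y - x" x]
    is_norm_minus[OF assms, of "x - y"] by simp

lemma is_norm_upper: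
  fixes N :: "'a::euclidean_space \<Rightarrow> real"
  assumes N: "is_norm N"
  obtains A where "A > 0" "\<And>x. N x \<le> A * norm x"
proof
  let ?A = "(\<Sum>b\<in>Basis. N b) + 1"
  have nn: "0 \<le> (\<Sum>b\<in>Basis. N b)" using is_normD(1)[OF N] by (simp add: sum_nonneg)
  then show "?A > 0" by simp
  have sum_le: "N (\<Sum>b\<in>S. f b) \<le> (\<Sum>b\<in>S. N (f b))" if "finite S" for S and f :: "'a \<Rightarrow> 'a"
    using that
  proof (induction S rule: finite_induct)
    case empty then show ?case using is_normD(2)[OF N, of 0] by simp
  next
    case (insert b S)
    then show ?case using is_normD(4)[OF N, of "f b" "\<Sum>b\<in>S. f b"] by simp
  qed
  fix x :: 'a
  have "N x = N (\<Sum>b\<in>Basis. (x \<bullet> b) *\<^sub>R b)" by (simp add: euclidean_representation)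
  also have "\<dots> \<le> (\<Sum>b\<in>Basis. N ((x \<bullet> b) *\<^sub>R b))" by (rule sum_le) simp
  also have "\<dots> = (\<Sum>b\<in>Basis. \<bar>x \<bullet> b\<bar> * N b)" by (simp add: is_normD(3)[OF N])
  also have "\<dots> \<le> (\<Sum>b\<in>Basis. norm x * N b)"
    by (intro sum_mono mult_right_mono is_normD(1)[OF N] Basis_le_norm)
  also have "\<dots> = (\<Sum>b\<in>Basis. N b) * norm x" by (simp add: sum_distrib_left mult.commute)
  also have "\<dots> \<le> ?A * norm x" by (simp add: mult_right_mono)
  finally show "N x \<le> ?A * norm x" .
qed

lemma is_norm_continuous:
  fixes N :: "'a::euclidean_space \<Rightarrow> real"
  assumes N: "is_norm N" shows "continuous_on S N"
proof -
  obtain A where A: "A > 0" "\<And>x. N x \<le> A * norm x" using is_norm_upper[OF N] by blast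
  have "A-lipschitz_on S N"
    using A is_norm_diff_le[OF N] by (intro lipschitz_onI) (auto simp: dist_norm, meson order_trans)
  then show ?thesis by (rule lipschitz_on_continuous_on)
qed

lemma is_norm_lower:
  fixes N :: "'a::euclidean_space \<Rightarrow> real"
  assumes N: "is_norm N"
  obtains B where "B > 0" "\<And>x. B * norm x \<le> N x"
proof -
  have ne: "sphere (0::'a) 1 \<noteq> {}" by simp
  obtain u where u: "u \<in> sphere 0 1" "\<And>y. y \<in> sphere 0 1 \<Longrightarrow> N u \<le> N y"
    using continuous_attains_inf[OF compact_sphere ne is_norm_continuous[OF N]] by blast
  have "u \<noteq> 0" using u(1) by auto
  then have "N u > 0" using is_normD(1,2)[OF N, of u] by linarith
  moreover have "N u * norm x \<le> N x" for x
  proof (cases "x = 0")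
    case False
    then have "N u \<le> N ((1 / norm x) *\<^sub>R x)" by (intro u(2)) simp
    then show ?thesis using False by (simp add: is_normD(3)[OF N] field_simps)
  qed (simp add: is_normD(1)[OF N])
  ultimately show ?thesis using that by blast
qed

lemma unit_ball_sym_body:
  fixes N :: "'a::euclidean_space \<Rightarrow> real"
  assumes N: "is_norm N" shows "unit_ball N \<in> sym_bodies"
proof -
  obtain A where A: "A > 0" "\<And>x. N x \<le> A * norm x" using is_norm_upper[OF N] by blast
  obtain B where B: "B > 0" "\<And>x. B * norm x \<le> N x" using is_norm_lower[OF N] by blast
  have "closed (unit_ball N)"
    unfolding unit_ball_def by (rule closed_Collect_le) (auto intro: is_norm_continuous[OF N])
  moreover have "unit_ball N \<subseteq> cball 0 (1 / B)"
  proof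
    fix x assume "x \<in> unit_ball N"
    then have "B * norm x \<le> 1" using B(2)[of x] by (simp add: unit_ball_def)
    then show "x \<in> cball 0 (1 / B)" using B(1) by (simp add: field_simps)
  qed
  then have "bounded (unit_ball N)" using bounded_cball bounded_subset by blast
  moreover have "convex (unit_ball N)"
  proof (rule convexI)
    fix x y u v assume *: "x \<in> unit_ball N" "y \<in> unit_ball N" "0 \<le> (u::real)" "0 \<le> (v::real)" "u + v = 1"
    have "N (u *\<^sub>R x + v *\<^sub>R y) \<le> u * N x + v * N y"
      using is_normD(4)[OF N, of "u *\<^sub>R x" "v *\<^sub>R y"] * by (simp add: is_normD(3)[OF N])
    also have "\<dots> \<le> 1" using * by (intro convex_bound_le) (auto simp: unit_ball_def)
    finally show "u *\<^sub>R x + v *\<^sub>R y \<in> unit_ball N" by (simp add: unit_ball_def)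
  qed
  moreover have "\<forall>x\<in>unit_ball N. - x \<in> unit_ball N" by (simp add: unit_ball_def is_norm_minus[OF N])
  moreover have "ball 0 (1 / A) \<subseteq> unit_ball N"
  proof
    fix x :: 'a assume "x \<in> ball 0 (1 / A)"
    then have "A * norm x \<le> 1" using A(1) by (simp add: field_simps)
    then show "x \<in> unit_ball N" using A(2)[of x] by (simp add: unit_ball_def)
  qed
  then have "0 \<in> interior (unit_ball N)" using A(1) by (intro interiorI[of "ball 0 (1 / A)"]) auto
  ultimately show ?thesis by (simp add: sym_bodies_def)
qed

text \<open>
  The norm is the gauge of the body, the least factor by which the body must be scaled to contain a
  given vector. The infimum is attained because the body is closed, so that for \<open>t > 0\<close> the
  condition \<open>N x \<le> t\<close> says that \<open>x / t\<close> lies in the body, and every norm axiom can be read off from this.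
\<close>

lemma sym_body_is_unit_ball:
  fixes K :: "'a::euclidean_space set"
  assumes K: "K \<in> sym_bodies"
  obtains N where "is_norm N" "unit_ball N = K"
proof -
  have K': "closed K" "bounded K" "convex K" "\<And>x. x \<in> K \<Longrightarrow> - x \<in> K" "0 \<in> interior K"
    using K by (auto simp: sym_bodies_def)
  obtain r where r: "r > 0" "cball 0 r \<subseteq> K" using K'(5) by (auto simp: mem_interior_cball)
  obtain R where R: "R > 0" "\<And>x. x \<in> K \<Longrightarrow> norm x \<le> R" using K'(2) by (meson bounded_pos)
  have K0: "0 \<in> K" using r by auto
  have mono: "(1 / t) *\<^sub>R x \<in> K" if "(1 / s) *\<^sub>R x \<in> K" "0 < s" "s \<le> t" for x s t
  proof -
    have "(s / t) *\<^sub>R ((1 / s) *\<^sub>R x) + (1 - s / t) *\<^sub>R 0 \<in> K"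
      using that K0 K'(3) by (intro convexD) auto
    then show ?thesis using that by simp
  qed
  define T where "T x = {t. 0 < t \<and> (1 / t) *\<^sub>R x \<in> K}" for x
  define N where "N x = Inf (T x)" for x
  have bdd: "bdd_below (T x)" for x by (auto simp: T_def intro: bdd_belowI[of _ 0])
  have ne: "T x \<noteq> {}" for x
  proof -
    have pos: "norm x / r + 1 > 0" using r by (smt (verit) divide_nonneg_pos norm_ge_zero)
    moreover have "norm x \<le> r * (norm x / r + 1)" using r by (simp add: distrib_left)
    then have "(1 / (norm x / r + 1)) *\<^sub>R x \<in> cball 0 r"
      using pos by (simp add: pos_divide_le_eq)
    ultimately have "norm x / r + 1 \<in> T x" using r by (auto simp: T_def)
    then show ?thesis by auto
  qed
  have nonneg: "N x \<ge> 0" for x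
    unfolding N_def by (rule cInf_greatest[OF ne]) (auto simp: T_def)
  have iff: "N x \<le> t \<longleftrightarrow> (1 / t) *\<^sub>R x \<in> K" if t: "t > 0" for x t
  proof
    assume "(1 / t) *\<^sub>R x \<in> K"
    then show "N x \<le> t" unfolding N_def using t by (intro cInf_lower bdd) (auto simp: T_def)
  next
    assume le: "N x \<le> t"
    have mem: "(1 / s) *\<^sub>R x \<in> K" if "s > t" for s
    proof -
      have "Inf (T x) < s" using le that by (simp add: N_def)
      then obtain s' where "s' \<in> T x" "s' < s" using cInf_less_iff[OF ne bdd] by blast
      then show ?thesis using mono[of s' x s] by (auto simp: T_def)
    qed
    have "(\<lambda>n. (1 / (t + inverse (real (Suc n)))) *\<^sub>R x) \<longlonglongrightarrow> (1 / (t + 0)) *\<^sub>R x"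
      using t by (intro tendsto_intros LIMSEQ_inverse_real_of_nat) auto
    then show "(1 / t) *\<^sub>R x \<in> K"
      using closed_sequentially[OF K'(1), of "\<lambda>n. (1 / (t + inverse (real (Suc n)))) *\<^sub>R x"] mem by simp
  qed
  have eqI: "a = b" if "a \<ge> 0" "b \<ge> 0" "\<And>t. t > 0 \<Longrightarrow> a \<le> t \<longleftrightarrow> b \<le> t" for a b :: real
    using that by (meson dense_ge dual_order.strict_trans2 order_antisym order_less_imp_le)
  have "is_norm N"
    unfolding is_norm_def
  proof (intro conjI allI)
    fix x show "0 \<le> N x" by (rule nonneg)
  next
    fix x show "N x = 0 \<longleftrightarrow> x = 0"
    proof
      assume "x = 0"
      then have "N x \<le> t" if "t > 0" for t using iff[OF that] K0 by simp
      then show "N x = 0" using nonneg[of x] by (meson dense_ge order_antisym)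
    next
      assume "N x = 0"
      then have "(1 / t) *\<^sub>R x \<in> K" if "t > 0" for t using iff[OF that, of x] that by simp
      then have "norm x \<le> R * t" if "t > 0" for t using R(2)[of "(1 / t) *\<^sub>R x"] that by (simp add: field_simps)
      then have "norm x \<le> e" if "e > 0" for e
        using R(1) that by (metis divide_pos_pos nonzero_mult_div_cancel_left order_less_irrefl times_divide_eq_right)
      then show "x = 0" by (metis dense_ge norm_le_zero_iff)
    qed
  next
    fix c x
    show "N (c *\<^sub>R x) = \<bar>c\<bar> * N x"
    proof (cases "c = 0")
      case True
      have "N 0 \<le> t" if "t > 0" for t using iff[OF that] K0 by simp
      then show ?thesis using True nonneg[of 0] by (simp add: dense_ge order_antisym)
    next
      case False
      show ?thesis
      proof (rule eqI)
        fix t :: real assume t: "t > 0"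
        have "N (c *\<^sub>R x) \<le> t \<longleftrightarrow> (c / t) *\<^sub>R x \<in> K" using iff[OF t] by simp
        also have "\<dots> \<longleftrightarrow> (\<bar>c\<bar> / t) *\<^sub>R x \<in> K"
          using K'(4)[of "(c / t) *\<^sub>R x"] K'(4)[of "- (c / t) *\<^sub>R x"] by (auto simp: abs_if)
        also have "\<dots> \<longleftrightarrow> N x \<le> t / \<bar>c\<bar>" using iff[of "t / \<bar>c\<bar>" x] t False by simp
        also have "\<dots> \<longleftrightarrow> \<bar>c\<bar> * N x \<le> t" using False by (simp add: field_simps)
        finally show "N (c *\<^sub>R x) \<le> t \<longleftrightarrow> \<bar>c\<bar> * N x \<le> t" .
      qed (use nonneg in auto)
    qed
  next
    fix x y
    have le: "N (x + y) \<le> s + t" if "s > N x" "t > N y" for s t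
    proof -
      have st: "s > 0" "t > 0" using that nonneg[of x] nonneg[of y] by linarith+
      then have "(1 / s) *\<^sub>R x \<in> K" "(1 / t) *\<^sub>R y \<in> K" 
        using iff[OF st(1), of x] iff[OF st(2), of y] that by (simp_all only: less_imp_le)
      then have "(s / (s + t)) *\<^sub>R ((1 / s) *\<^sub>R x) + (t / (s + t)) *\<^sub>R ((1 / t) *\<^sub>R y) \<in> K"
        using st K'(3) by (intro convexD) (auto simp: add_divide_distrib[symmetric])
      then have "(1 / (s + t)) *\<^sub>R (x + y) \<in> K" using st by (simp add: scaleR_add_right)
      then show ?thesis using iff[of "s + t"] st by simp
    qed
    show "N (x + y) \<le> N x + N y"
    proof (rule field_le_epsilon)
      fix e :: real assume "e > 0"
      then show "N (x + y) \<le> N x + N y + e" using le[of "N x + e / 2" "N y + e / 2"] by simp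
    qed
  qed
  moreover have "unit_ball N = K" using iff[of 1] by (auto simp: unit_ball_def)
  ultimately show ?thesis using that by blast
qed

lemma is_norm_le_if_unit_ball:
  assumes N: "is_norm N" and M: "is_norm M" and le: "\<And>x. N x \<le> 1 \<Longrightarrow> M x \<le> c"
  shows "M x \<le> c * N x"
proof (cases "x = 0")
  case True then show ?thesis using is_normD(2)[OF M, of x] is_normD(2)[OF N, of x] by simp
next
  case False
  then have pos: "N x > 0" using is_normD(1,2)[OF N, of x] by linarith
  then have "M ((1 / N x) *\<^sub>R x) \<le> c" by (intro le) (simp add: is_normD(3)[OF N])
  then show ?thesis using pos by (simp add: is_normD(3)[OF M] field_simps)
qed

lemma hausdorff_dist_unit_balls_le:
  fixes N M :: "'a::euclidean_space \<Rightarrow> real"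
  assumes N: "is_norm N" and M: "is_norm M" and B: "B > 0" "\<And>x. B * norm x \<le> N x"
    and le: "\<And>x. N x \<le> M x" "\<And>x. M x \<le> (1 + \<theta>) * N x" and \<theta>: "\<theta> \<ge> 0"
  shows "hausdorff_dist (unit_ball N) (unit_ball M) \<le> \<theta> / B"
proof -
  have body: "K \<noteq> {}" "bounded K" if "K \<in> sym_bodies" for K :: "'a set"
    using that interior_subset by (auto simp: sym_bodies_def)
  note bN = body[OF unit_ball_sym_body[OF N]] and bM = body[OF unit_ball_sym_body[OF M]]
  have 1: "infdist x (unit_ball N) \<le> \<theta> / B" if "x \<in> unit_ball M" for x
  proof -
    have "x \<in> unit_ball N" using that le(1)[of x] by (simp add: unit_ball_def)
    then show ?thesis using \<theta> B by (simp add: infdist_zero)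
  qed
  have 2: "infdist x (unit_ball M) \<le> \<theta> / B" if "x \<in> unit_ball N" for x
  proof -
    define y where "y = (1 / (1 + \<theta>)) *\<^sub>R x"
    have Nx: "N x \<le> 1" using that by (simp add: unit_ball_def)
    have "M y = M x / (1 + \<theta>)" using \<theta> by (simp add: y_def is_normD(3)[OF M])
    also have "\<dots> \<le> N x" using le(2)[of x] \<theta> by (simp add: field_simps)
    finally have "y \<in> unit_ball M" using Nx by (simp add: unit_ball_def)
    then have "infdist x (unit_ball M) \<le> dist x y" by (rule infdist_le)
    also have "x - y = (\<theta> / (1 + \<theta>)) *\<^sub>R x"
      using \<theta> by (simp add: y_def field_simps flip: scaleR_left_diff_distrib) 
        (simp add: scaleR_left_diff_distrib[symmetric] scaleR_add_left[symmetric] field_simps)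
    then have "dist x y = \<theta> / (1 + \<theta>) * norm x" using \<theta> by (simp add: dist_norm)
    also have "\<dots> \<le> \<theta> * norm x" using \<theta> by (intro mult_right_mono) (auto simp: field_simps)
    also have "\<dots> \<le> \<theta> * (1 / B)" using B(2)[of x] Nx B(1) \<theta> by (intro mult_left_mono) (auto simp: field_simps)
    finally show ?thesis by simp
  qed
  show ?thesis using hausdorff_dist_le_iff[OF bN(1) bM(1) bN(2) bM(2)] 1 2 by blast
qed

text \<open>
  A point of one unit ball is within \<open>\<eta>\<close> of a point of the other, and the error has \<open>M\<close>-length at most
  \<open>A * \<eta>\<close>. For the bound on \<open>M\<close> this is the triangle inequality. In the bound on \<open>N\<close> the error has to be
  measured by \<open>N\<close>, for which no constant is given: its supremum \<open>S\<close> over the unit ball of \<open>M\<close>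
  satisfies \<open>S \<le> 1 + S * (A * \<eta>)\<close>, and it is finite, so \<open>S\<close> is at most \<open>1 / (1 - A * \<eta>)\<close>.
\<close>

lemma norms_close_if_unit_balls_close:
  fixes N M :: "'a::euclidean_space \<Rightarrow> real"
  assumes N: "is_norm N" and M: "is_norm M" and A: "A > 0" "\<And>x. M x \<le> A * norm x"
    and d: "hausdorff_dist (unit_ball N) (unit_ball M) \<le> \<eta>" and \<theta>: "A * \<eta> < 1"
  shows "M x \<le> (1 + A * \<eta>) * N x" "(1 - A * \<eta>) * N x \<le> M x"
proof -
  have body: "K \<noteq> {}" "bounded K" "closed K" if "K \<in> sym_bodies" for K :: "'a set"
    using that interior_subset by (auto simp: sym_bodies_def)
  note bN = body[OF unit_ball_sym_body[OF N]] and bM = body[OF unit_ball_sym_body[OF M]]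
  note iff = hausdorff_dist_le_iff[OF bN(1) bM(1) bN(2) bM(2), of \<eta>]
  have close: "\<exists>y. M' y \<le> 1 \<and> M (x - y) \<le> A * \<eta>"
    if near: "infdist x (unit_ball M') \<le> \<eta>" "unit_ball M' \<noteq> {}" "closed (unit_ball M')" for x M'
  proof -
    obtain y where y: "y \<in> unit_ball M'" "infdist x (unit_ball M') = dist x y"
      using infdist_attains_inf[OF near(3,2)] by blast
    have "M (x - y) \<le> A * norm (x - y)" by (rule A(2))
    also have "\<dots> \<le> A * \<eta>" using near(1) y A(1) by (simp add: dist_norm)
    finally show ?thesis using y by (auto simp: unit_ball_def)
  qed
  show "M x \<le> (1 + A * \<eta>) * N x" for x
  proof (rule is_norm_le_if_unit_ball[OF N M])
    fix x assume "N x \<le> 1"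
    then have "infdist x (unit_ball M) \<le> \<eta>" using iff d by (simp add: unit_ball_def)
    then obtain y where y: "M y \<le> 1" "M (x - y) \<le> A * \<eta>" using close bM by blast
    then show "M x \<le> 1 + A * \<eta>" using is_normD(4)[OF M, of "x - y" y] by simp
  qed
  have "\<eta> \<ge> 0" using d hausdorff_dist_nonneg[of "unit_ball N" "unit_ball M"] by linarith
  define S where "S = (SUP x\<in>unit_ball M. N x)"
  have bdd: "bdd_above (N ` unit_ball M)"
  proof -
    obtain C where C: "C > 0" "\<And>x. N x \<le> C * norm x" using is_norm_upper[OF N] by blast
    obtain R where R: "R > 0" "\<And>x. x \<in> unit_ball M \<Longrightarrow> norm x \<le> R" using bM(2) by (meson bounded_pos)
    show ?thesis
      by (rule bdd_aboveI2[of _ _ "C * R"]) (use C R in \<open>meson mult_left_mono order_trans less_imp_le\<close>)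
  qed
  have NS: "N x \<le> S" if "M x \<le> 1" for x
    unfolding S_def using that bdd by (intro cSUP_upper) (auto simp: unit_ball_def)
  have NSM: "N x \<le> S * M x" for x by (rule is_norm_le_if_unit_ball[OF M N NS])
  have "0 \<in> unit_ball M" using is_normD(2)[OF M, of 0] by (simp add: unit_ball_def)
  then have S0: "S \<ge> 0" using NS[of 0] is_normD(1)[OF N, of 0] by (simp add: unit_ball_def)
  have "S \<le> 1 + S * (A * \<eta>)"
    unfolding S_def
  proof (rule cSUP_least[OF bM(1)], fold S_def)
    fix x assume "x \<in> unit_ball M"
    then have "infdist x (unit_ball N) \<le> \<eta>" using iff d by blast
    then obtain y where y: "N y \<le> 1" "M (x - y) \<le> A * \<eta>" using close bN by blast
    have "N x \<le> N (x - y) + N y" using is_normD(4)[OF N, of "x - y" y] by simp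
    also have "N (x - y) \<le> S * (A * \<eta>)" using NSM[of "x - y"] y(2) S0 by (meson mult_left_mono order_trans)
    finally show "N x \<le> 1 + S * (A * \<eta>)" using y by simp
  qed
  then have "(1 - A * \<eta>) * S \<le> 1" by (simp add: algebra_simps)
  fix x
  have "(1 - A * \<eta>) * N x \<le> (1 - A * \<eta>) * (S * M x)" using \<theta> NSM by (intro mult_left_mono) auto
  also have "\<dots> = ((1 - A * \<eta>) * S) * M x" by simp
  also have "\<dots> \<le> 1 * M x" using \<open>(1 - A * \<eta>) * S \<le> 1\<close> is_normD(1)[OF M] by (intro mult_right_mono) auto
  finally show "(1 - A * \<eta>) * N x \<le> M x" by simp
qed

interpretation bodies: Metric_space sym_bodies hausdorff_dist
  by (rule Metric_space_sym_bodies)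

text \<open>
  The Hausdorff metric enters the proof only through this criterion: a property of norms is
  nowhere dense if a small perturbation of any norm makes it fail robustly, that is, for all norms
  sufficiently close to the perturbed one on the unit sphere.
\<close>

lemma nowhere_dense_unit_ballsI:
  fixes Q :: "('a::euclidean_space \<Rightarrow> real) \<Rightarrow> bool"
  assumes perturb: "\<And>N \<epsilon>. is_norm N \<Longrightarrow> \<epsilon> > 0 \<Longrightarrow> \<exists>M \<tau>. is_norm M \<and> \<tau> > 0 \<and>
      (\<forall>x. N x \<le> M x \<and> M x \<le> N x + \<epsilon> * norm x) \<and>
      (\<forall>L. is_norm L \<longrightarrow> (\<forall>x. \<bar>L x - M x\<bar> \<le> \<tau> * norm x) \<longrightarrow> \<not> Q L)"
  shows "nowhere_dense_in sym_body_topology {unit_ball N | N. is_norm N \<and> Q N}"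
  unfolding nowhere_dense_in_def
proof (intro conjI allI impI)
  show "{unit_ball N | N. is_norm N \<and> Q N} \<subseteq> topspace sym_body_topology"
    using unit_ball_sym_body by (auto simp: sym_body_topology_def)
next
  fix U :: "'a set set" assume U: "openin sym_body_topology U \<and> U \<noteq> {}"
  then obtain K where K: "K \<in> U" by auto
  have op: "openin bodies.mtopology U" using U by (simp add: sym_body_topology_def)
  then have K': "K \<in> sym_bodies" using K by (metis bodies.openin_mtopology subsetD)
  obtain r where r: "r > 0" "bodies.mball K r \<subseteq> U" using op K by (metis bodies.openin_mtopology)
  obtain N where N: "is_norm N" "unit_ball N = K" using sym_body_is_unit_ball[OF K'] by blast
  obtain B where B: "B > 0" "\<And>x. B * norm x \<le> N x" using is_norm_lower[OF N(1)] by blast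
  define \<epsilon> where "\<epsilon> = r * B * B / 2"
  have "\<epsilon> > 0" using r B by (simp add: \<epsilon>_def)
  then obtain M \<tau> where M: "is_norm M" "\<tau> > 0" "\<And>x. N x \<le> M x" "\<And>x. M x \<le> N x + \<epsilon> * norm x"
    "\<And>L. is_norm L \<Longrightarrow> (\<forall>x. \<bar>L x - M x\<bar> \<le> \<tau> * norm x) \<Longrightarrow> \<not> Q L"
    using perturb[OF N(1)] by meson
  have "M x \<le> (1 + \<epsilon> / B) * N x" for x
  proof -
    have "M x \<le> N x + \<epsilon> / B * (B * norm x)" using M(4)[of x] B(1) by simp
    also have "\<dots> \<le> N x + \<epsilon> / B * N x" using B \<open>\<epsilon> > 0\<close> by (intro add_left_mono mult_left_mono) auto
    finally show ?thesis by (simp add: algebra_simps)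
  qed
  then have "hausdorff_dist (unit_ball N) (unit_ball M) \<le> (\<epsilon> / B) / B"
    using \<open>\<epsilon> > 0\<close> B(1) by (intro hausdorff_dist_unit_balls_le[OF N(1) M(1) B M(3)]) auto
  also have "\<dots> < r" using r B by (simp add: \<epsilon>_def)
  finally have inU: "unit_ball M \<in> U"
    using r(2) N(2) K' unit_ball_sym_body[OF M(1)] by (auto simp: bodies.in_mball)
  obtain A where A: "A > 0" "\<And>x. M x \<le> A * norm x" using is_norm_upper[OF M(1)] by blast
  define \<theta> where "\<theta> = min (1 / 2) (\<tau> / (2 * A))"
  have \<theta>: "\<theta> > 0" "\<theta> \<le> 1 / 2" "2 * A * \<theta> \<le> \<tau>" 
    using M(2) A(1) by (auto simp: \<theta>_def min_def field_simps)
  define V where "V = U \<inter> bodies.mball (unit_ball M) (\<theta> / A)"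
  have "V \<inter> {unit_ball N | N. is_norm N \<and> Q N} = {}"
  proof (rule ccontr)
    assume "V \<inter> {unit_ball N | N. is_norm N \<and> Q N} \<noteq> {}"
    then obtain L where L: "is_norm L" "Q L" "unit_ball L \<in> V" by auto
    have "hausdorff_dist (unit_ball L) (unit_ball M) \<le> \<theta> / A"
      using L(3) by (auto simp: V_def bodies.in_mball hausdorff_dist_commute)
    moreover have "A * (\<theta> / A) = \<theta>" using A by simp
    ultimately have c: "M x \<le> (1 + \<theta>) * L x" "(1 - \<theta>) * L x \<le> M x" for x
      using norms_close_if_unit_balls_close[OF L(1) M(1) A, of "\<theta> / A"] \<theta> by auto
    have "\<bar>L x - M x\<bar> \<le> \<tau> * norm x" for x
    proof -
      have L0: "L x \<ge> 0" by (rule is_normD(1)[OF L(1)])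
      have "(1 / 2) * L x \<le> (1 - \<theta>) * L x" using \<theta> L0 by (intro mult_right_mono) auto
      then have "L x \<le> 2 * M x" using c(2)[of x] by linarith
      moreover have "\<bar>L x - M x\<bar> \<le> \<theta> * L x" using c[of x] by (simp add: algebra_simps abs_le_iff)
      ultimately have "\<bar>L x - M x\<bar> \<le> \<theta> * (2 * (A * norm x))"
        using A(2)[of x] \<theta>(1) by (smt (verit, best) mult_left_mono)
      also have "\<dots> = (2 * A * \<theta>) * norm x" by simp
      also have "\<dots> \<le> \<tau> * norm x" using \<theta> by (intro mult_right_mono) auto
      finally show ?thesis .
    qed
    then show False using M(5)[OF L(1)] L(2) by blast
  qed
  moreover have "openin sym_body_topology V"
    using op unfolding V_def sym_body_topology_def by (intro openin_Int bodies.openin_mball)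
  moreover have "V \<noteq> {}" using inU unit_ball_sym_body[OF M(1)] \<theta> A unfolding V_def
    by (auto intro!: exI[of _ "unit_ball M"])
  ultimately show "\<exists>V. openin sym_body_topology V \<and> V \<noteq> {} \<and> V \<subseteq> U \<and>
      V \<inter> {unit_ball N | N. is_norm N \<and> Q N} = {}"
    unfolding V_def by blast
qed

section \<open>Perturbing a norm\<close>

text \<open>
  The positive part makes this function vanish outside a narrow double cone around \<open>z\<close>. It is the
  difference of the norm \<open>max (norm x) ((1 + \<delta>) * \<bar>z \<bullet> x\<bar>)\<close> and the Euclidean norm; therefore bumps may
  be added to a norm once a sufficient multiple of the Euclidean norm has been added.
\<close>

definition bump :: "real \<Rightarrow> 'a::real_inner \<Rightarrow> 'a \<Rightarrow> real" where
  "bump \<delta> z x = max 0 ((1 + \<delta>) * \<bar>z \<bullet> x\<bar> - norm x)"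

lemma bump_nonneg: "0 \<le> bump \<delta> z x"
  by (simp add: bump_def)

lemma bump_le:
  assumes "norm z = 1" "0 \<le> \<delta>" shows "bump \<delta> z x \<le> \<delta> * norm x"
proof -
  have "\<bar>z \<bullet> x\<bar> \<le> norm x" using Cauchy_Schwarz_ineq2[of z x] assms by simp
  then have "(1 + \<delta>) * \<bar>z \<bullet> x\<bar> \<le> (1 + \<delta>) * norm x" using assms by (intro mult_left_mono) auto
  then show ?thesis using assms by (simp add: bump_def algebra_simps)
qed

lemma is_norm_add_bumps:
  fixes N :: "'a::real_inner \<Rightarrow> real"
  assumes N: "is_norm N" and Z: "finite Z" "\<And>z. z \<in> Z \<Longrightarrow> 0 \<le> s z" "sum s Z \<le> c" and \<delta>: "0 \<le> \<delta>"
  shows "is_norm (\<lambda>x. N x + c * norm x + (\<Sum>z\<in>Z. s z * bump \<delta> z x))" (is "is_norm ?M")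
proof -
  have eq: "?M x = N x + (c - sum s Z) * norm x + (\<Sum>z\<in>Z. s z * max (norm x) ((1 + \<delta>) * \<bar>z \<bullet> x\<bar>))" for x
  proof -
    have "(\<Sum>z\<in>Z. s z * max (norm x) ((1 + \<delta>) * \<bar>z \<bullet> x\<bar>)) = (\<Sum>z\<in>Z. s z * norm x + s z * bump \<delta> z x)"
      by (intro sum.cong refl) (auto simp: bump_def max_def algebra_simps)
    then show ?thesis by (simp add: sum.distrib sum_distrib_right[symmetric] left_diff_distrib)
  qed
  have c: "0 \<le> c" using Z by (meson order_trans sum_nonneg)
  have bn: "0 \<le> (\<Sum>z\<in>Z. s z * bump \<delta> z x)" for x
    using Z by (intro sum_nonneg mult_nonneg_nonneg bump_nonneg) auto
  show ?thesis
    unfolding is_norm_def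
  proof (intro conjI allI)
    fix x
    show nn: "0 \<le> ?M x" using is_normD(1)[OF N, of x] bn[of x] c by simp
    show "?M x = 0 \<longleftrightarrow> x = 0"
    proof
      assume "?M x = 0"
      then have "N x = 0" using is_normD(1)[OF N, of x] bn[of x] c by (smt (verit) mult_nonneg_nonneg norm_ge_zero)
      then show "x = 0" using is_normD(2)[OF N] by simp
    qed (use is_normD(2)[OF N, of x] in \<open>simp add: bump_def\<close>)
  next
    fix b and x :: 'a
    have "bump \<delta> z (b *\<^sub>R x) = \<bar>b\<bar> * bump \<delta> z x" for z
    proof -
      have "(1 + \<delta>) * \<bar>z \<bullet> (b *\<^sub>R x)\<bar> - norm (b *\<^sub>R x) = \<bar>b\<bar> * ((1 + \<delta>) * \<bar>z \<bullet> x\<bar> - norm x)"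
        by (simp add: abs_mult algebra_simps)
      moreover have "max 0 (\<bar>b\<bar> * y) = \<bar>b\<bar> * max 0 y" for y
        by (simp add: max_mult_distrib_left)
      ultimately show ?thesis by (simp only: bump_def)
    qed
    then show "?M (b *\<^sub>R x) = \<bar>b\<bar> * ?M x"
      by (simp add: is_normD(3)[OF N] algebra_simps sum_distrib_left)
  next
    fix x y :: 'a
    have m: "max (norm (x + y)) ((1 + \<delta>) * \<bar>z \<bullet> (x + y)\<bar>)
        \<le> max (norm x) ((1 + \<delta>) * \<bar>z \<bullet> x\<bar>) + max (norm y) ((1 + \<delta>) * \<bar>z \<bullet> y\<bar>)" for z
    proof -
      have "(1 + \<delta>) * \<bar>z \<bullet> (x + y)\<bar> \<le> (1 + \<delta>) * (\<bar>z \<bullet> x\<bar> + \<bar>z \<bullet> y\<bar>)"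
        using \<delta> by (intro mult_left_mono) (auto simp: inner_add_right)
      then have "(1 + \<delta>) * \<bar>z \<bullet> (x + y)\<bar> \<le> (1 + \<delta>) * \<bar>z \<bullet> x\<bar> + (1 + \<delta>) * \<bar>z \<bullet> y\<bar>"
        by (simp only: distrib_left)
      then show ?thesis
        using norm_triangle_ineq[of x y] max.cobounded1[of "norm x" "(1 + \<delta>) * \<bar>z \<bullet> x\<bar>"]
          max.cobounded2[of "(1 + \<delta>) * \<bar>z \<bullet> x\<bar>" "norm x"]
          max.cobounded1[of "norm y" "(1 + \<delta>) * \<bar>z \<bullet> y\<bar>"]
          max.cobounded2[of "(1 + \<delta>) * \<bar>z \<bullet> y\<bar>" "norm y"]
        by (intro max.boundedI) linarith+
    qed
    have "(\<Sum>z\<in>Z. s z * max (norm (x + y)) ((1 + \<delta>) * \<bar>z \<bullet> (x + y)\<bar>))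
      \<le> (\<Sum>z\<in>Z. s z * max (norm x) ((1 + \<delta>) * \<bar>z \<bullet> x\<bar>) + s z * max (norm y) ((1 + \<delta>) * \<bar>z \<bullet> y\<bar>))"
      unfolding distrib_left[symmetric] by (intro sum_mono mult_left_mono m Z)
    moreover have "(c - sum s Z) * norm (x + y) \<le> (c - sum s Z) * (norm x + norm y)"
      using Z by (intro mult_left_mono norm_triangle_ineq) auto
    ultimately show "?M (x + y) \<le> ?M x + ?M y"
      unfolding eq using is_normD(4)[OF N, of x y] by (simp add: sum.distrib distrib_left)
  qed
qed

lemma inner_unit_near:
  fixes u v z :: "'a::real_inner"
  assumes "norm u = 1" "norm v = 1" "norm z = 1" "1 - \<delta> < z \<bullet> u" "1 - \<delta> < z \<bullet> v"
  shows "1 - 4 * \<delta> < u \<bullet> v"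
proof -
  have sq: "(norm (x - y))\<^sup>2 = 2 - 2 * (x \<bullet> y)" if "norm x = 1" "norm y = 1" for x y :: 'a
    using that by (simp add: power2_norm_eq_inner inner_diff inner_commute norm_eq_1)
  have "norm (u - v) \<le> norm (z - u) + norm (z - v)"
    using norm_triangle_ineq4[of "z - v" "z - u"] by (simp add: add.commute)
  then have "(norm (u - v))\<^sup>2 \<le> (norm (z - u) + norm (z - v))\<^sup>2" by (intro power_mono) auto
  also have "\<dots> \<le> 2 * (norm (z - u))\<^sup>2 + 2 * (norm (z - v))\<^sup>2"
    using zero_le_power2[of "norm (z - u) - norm (z - v)"] by (simp add: power2_eq_square algebra_simps)
  finally show ?thesis using sq[of u v] sq[of z u] sq[of z v] assms by simp
qed

text \<open>
  Two vectors under the same bump both make a small angle with the line of \<open>z\<close>, hence with each other.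
\<close>

lemma bump_pos_imp_near:
  fixes x y z :: "'a::real_inner"
  assumes z: "norm z = 1" and \<delta>: "0 < \<delta>" and b: "0 < bump \<delta> z x" "0 < bump \<delta> z y"
  shows "(1 - 4 * \<delta>) * (norm x * norm y) < \<bar>x \<bullet> y\<bar>"
proof -
  define f where "f x = ((if 0 \<le> z \<bullet> x then 1 else -1) / norm x) *\<^sub>R x" for x
  have f: "norm (f x) = 1 \<and> 1 - \<delta> < z \<bullet> f x" if "0 < bump \<delta> z x" for x
  proof -
    have less: "norm x < (1 + \<delta>) * \<bar>z \<bullet> x\<bar>" using that by (simp add: bump_def max_def split: if_splits)
    then have x: "norm x > 0" by (cases "x = 0") auto
    have "1 < (1 + \<delta>) * (\<bar>z \<bullet> x\<bar> / norm x)" using less x by (simp add: field_simps)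
    moreover have "z \<bullet> f x = \<bar>z \<bullet> x\<bar> / norm x" by (auto simp: f_def)
    ultimately have *: "1 < (1 + \<delta>) * (z \<bullet> f x)" by simp
    have "(1 + \<delta>) * (1 - \<delta>) \<le> 1" using \<delta> by (simp add: algebra_simps)
    then have "1 - \<delta> < z \<bullet> f x" using * \<delta> by (smt (verit) mult_left_mono)
    moreover have "norm (f x) = 1" using x by (simp add: f_def)
    ultimately show ?thesis by simp
  qed
  have pos: "norm x > 0" "norm y > 0" using f[OF b(1)] f[OF b(2)] by (auto simp: f_def)
  have "1 - 4 * \<delta> < f x \<bullet> f y" using inner_unit_near f[OF b(1)] f[OF b(2)] z by blast
  also have "\<dots> \<le> \<bar>f x \<bullet> f y\<bar>" by simp
  also have "\<dots> = \<bar>x \<bullet> y\<bar> / (norm x * norm y)" by (simp add: f_def abs_mult)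
  finally show ?thesis using pos by (simp add: pos_less_divide_eq)
qed

lemma bump_net:
  assumes \<delta>: "0 < \<delta>" "\<delta> \<le> 1"
  obtains Z :: "'a::euclidean_space set" where "finite Z" "Z \<noteq> {}" "\<And>z. z \<in> Z \<Longrightarrow> norm z = 1"
    "\<And>x. \<exists>z\<in>Z. \<delta> / 2 * norm x \<le> bump \<delta> z x"
proof -
  define \<kappa> where "\<kappa> = sqrt (\<delta> / 2)"
  have \<kappa>: "\<kappa> > 0" "\<kappa>\<^sup>2 = \<delta> / 2" using \<delta> by (auto simp: \<kappa>_def)
  have "sphere (0::'a) 1 \<subseteq> (\<Union>z\<in>sphere 0 1. ball z \<kappa>)" using \<kappa> by auto
  then have cover: "sphere (0::'a) 1 \<subseteq> (\<Union>z\<in>sphere 0 1. ball z \<kappa>)" .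
  obtain Z where Z: "Z \<subseteq> sphere (0::'a) 1" "finite Z" "sphere 0 1 \<subseteq> (\<Union>z\<in>Z. ball z \<kappa>)"
    by (rule compactE_image[OF compact_sphere _ cover]) (rule open_ball, rule that, assumption+)
  have ne: "Z \<noteq> {}" using Z(3) by auto
  have "\<exists>z\<in>Z. \<delta> / 2 * norm x \<le> bump \<delta> z x" for x
  proof (cases "x = 0")
    case True then show ?thesis using ne bump_nonneg by fastforce
  next
    case False
    define u where "u = (1 / norm x) *\<^sub>R x"
    have u: "norm u = 1" "x = norm x *\<^sub>R u" using False by (auto simp: u_def)
    then obtain z where z: "z \<in> Z" "dist z u < \<kappa>" using Z(3) by (force simp: subset_iff)
    have nz: "norm z = 1" using z Z by auto
    have "(norm (z - u))\<^sup>2 \<le> \<kappa>\<^sup>2" using z(2) by (intro power_mono) (auto simp: dist_norm)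
    moreover have "(norm (z - u))\<^sup>2 = 2 - 2 * (z \<bullet> u)"
      using nz u by (simp add: power2_norm_eq_inner inner_diff inner_commute norm_eq_1)
    ultimately have zu: "1 - \<delta> / 4 \<le> z \<bullet> u" using \<kappa> by simp
    have "\<delta> * \<delta> \<le> \<delta>" using \<delta> by (simp add: mult_left_le)
    moreover have "(1 + \<delta>) * (1 - \<delta> / 4) = 1 + \<delta> * (3 / 4) - \<delta> * \<delta> / 4" by (simp add: field_simps)
    ultimately have "1 + \<delta> / 2 \<le> (1 + \<delta>) * (1 - \<delta> / 4)" by linarith
    also have "\<dots> \<le> (1 + \<delta>) * (z \<bullet> u)" using zu \<delta> by (intro mult_left_mono) auto
    finally have "\<delta> / 2 \<le> (1 + \<delta>) * \<bar>z \<bullet> u\<bar> - 1" using \<delta> by (smt (verit) mult_left_mono)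
    then have "norm x * (\<delta> / 2) \<le> norm x * ((1 + \<delta>) * \<bar>z \<bullet> u\<bar> - 1)" by (intro mult_left_mono) auto
    also have "\<dots> = (1 + \<delta>) * \<bar>z \<bullet> x\<bar> - norm x"
    proof -
      have "z \<bullet> x = norm x * (z \<bullet> u)" by (metis inner_scaleR_right u(2))
      then have "\<bar>z \<bullet> x\<bar> = norm x * \<bar>z \<bullet> u\<bar>" by (simp add: abs_mult)
      then show ?thesis by (simp add: algebra_simps)
    qed
    also have "\<dots> \<le> bump \<delta> z x" by (simp add: bump_def)
    finally have "\<delta> / 2 * norm x \<le> bump \<delta> z x" by (subst mult.commute)
    then show ?thesis using z(1) by blast
  qed
  moreover have "norm z = 1" if "z \<in> Z" for z using subsetD[OF Z(1) that] by simp
  ultimately show ?thesis using that[OF Z(2) ne] by blast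
qed

text \<open>
  The choices \<open>i\<close> number \<open>q ^ card Z\<close>. The data that are compared consist of a bounded number of maps \<open>\<zeta>\<close>, of
  order \<open>q ^ a\<close> cells, and \<open>q ^ (card Z - k)\<close> restrictions to the complement of the \<open>k\<close> selected elements of
  \<open>Z\<close>. As \<open>a < k\<close>, these are fewer than the choices when \<open>q\<close> is large. This is a discrete substitute
  for the fact that a Lipschitz image of a space of lower dimension has measure zero; it allows \<open>a\<close>
  and \<open>k\<close> to be variables, as they need not be dimensions of types.
\<close>

lemma grid_collision:
  fixes \<zeta> :: "('z \<Rightarrow> nat) \<Rightarrow> nat \<Rightarrow> 'z" and cell :: "('z \<Rightarrow> nat) \<Rightarrow> nat \<Rightarrow> int"
  defines "I q Z \<equiv> PiE Z (\<lambda>_. {..<q})"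
  assumes Z: "finite Z" and ak: "a < k" and q: "card Z ^ k * (2 * m + 1) ^ a < q"
    and \<zeta>: "\<And>i. i \<in> I q Z \<Longrightarrow> inj_on (\<zeta> i) {..<k}" "\<And>i w. i \<in> I q Z \<Longrightarrow> w < k \<Longrightarrow> \<zeta> i w \<in> Z"
    and cell: "\<And>i j. i \<in> I q Z \<Longrightarrow> j < a \<Longrightarrow> \<bar>cell i j\<bar> \<le> int (m * q)"
  obtains i i' where "i \<in> I q Z" "i' \<in> I q Z" "i \<noteq> i'" "\<And>w. w < k \<Longrightarrow> \<zeta> i w = \<zeta> i' w"
    "\<And>j. j < a \<Longrightarrow> cell i j = cell i' j" "\<And>z. z \<in> Z \<Longrightarrow> z \<notin> \<zeta> i ` {..<k} \<Longrightarrow> i z = i' z"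
proof -
  define F where "F = {f \<in> PiE {..<k} (\<lambda>_. Z). inj_on f {..<k}}"
  define G where "G = PiE {..<a} (\<lambda>_. {- int (m * q)..int (m * q)})"
  define T where "T = (SIGMA f:F. G \<times> PiE (Z - f ` {..<k}) (\<lambda>_. {..<q}))"
  define \<Phi> where "\<Phi> i = (restrict (\<zeta> i) {..<k}, restrict (cell i) {..<a}, restrict i (Z - \<zeta> i ` {..<k}))" for i
  have q0: "q > 0" using q by simp
  have fI: "finite (I q Z)" unfolding I_def using Z by (intro finite_PiE) auto
  have card_I: "card (I q Z) = q ^ card Z" unfolding I_def using Z by (simp add: card_PiE)
  have kZ: "k \<le> card Z"
  proof -
    have i0: "(\<lambda>z\<in>Z. 0) \<in> I q Z" using q0 by (auto simp: I_def)
    have "card (\<zeta> (\<lambda>z\<in>Z. 0) ` {..<k}) \<le> card Z"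
      using \<zeta>(2)[OF i0] by (intro card_mono Z) auto
    then show ?thesis using card_image[OF \<zeta>(1)[OF i0]] by simp
  qed
  have fF: "finite F" unfolding F_def using Z by (intro finite_subset[OF _ finite_PiE[of "{..<k}" "\<lambda>_. Z"]]) auto
  have fG: "finite G" unfolding G_def by (intro finite_PiE) auto
  have fin_P: "finite (PiE (Z - f ` {..<k}) (\<lambda>_. {..<q}))" for f :: "nat \<Rightarrow> 'z"
    using Z by (intro finite_PiE) auto
  have \<Phi>: "\<Phi> ` I q Z \<subseteq> T"
  proof
    fix t assume "t \<in> \<Phi> ` I q Z"
    then obtain i where i: "i \<in> I q Z" "t = \<Phi> i" by blast
    have "restrict (\<zeta> i) {..<k} ` {..<k} = \<zeta> i ` {..<k}" by auto
    moreover have "restrict (\<zeta> i) {..<k} \<in> F"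
      using \<zeta>[OF i(1)] by (auto simp: F_def inj_on_def)
    moreover have "restrict (cell i) {..<a} \<in> G"
      using cell[OF i(1)] by (force simp: G_def abs_le_iff)
    moreover have "restrict i (Z - \<zeta> i ` {..<k}) \<in> PiE (Z - \<zeta> i ` {..<k}) (\<lambda>_. {..<q})"
      using i(1) by (auto simp: I_def)
    ultimately show "t \<in> T" unfolding T_def i(2) \<Phi>_def by simp
  qed
  have cF: "card F \<le> card Z ^ k"
  proof -
    have "card F \<le> card (PiE {..<k} (\<lambda>_. Z))"
      unfolding F_def using Z by (intro card_mono finite_PiE) auto
    then show ?thesis by (simp add: card_PiE)
  qed
  have "nat (2 * int (m * q) + 1) = 2 * (m * q) + 1" by linarith
  then have cG: "card G = (2 * (m * q) + 1) ^ a"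
    by (simp add: G_def card_PiE)
  have cP: "card (PiE (Z - f ` {..<k}) (\<lambda>_. {..<q})) = q ^ (card Z - k)" if "f \<in> F" for f
  proof -
    have "f ` {..<k} \<subseteq> Z" "card (f ` {..<k}) = k" using that by (auto simp: F_def card_image)
    then have "card (Z - f ` {..<k}) = card Z - k" by (simp add: card_Diff_subset)
    then show ?thesis using Z by (simp add: card_PiE)
  qed
  have "card T = (\<Sum>f\<in>F. card G * q ^ (card Z - k))"
    unfolding T_def using fF fG fin_P cP by (subst card_SigmaI) (auto simp: card_cartesian_product)
  then have "card T = card F * ((2 * (m * q) + 1) ^ a * q ^ (card Z - k))" by (simp add: cG)
  also have "\<dots> \<le> card Z ^ k * (((2 * m + 1) * q) ^ a * q ^ (card Z - k))"
    using q0 cF by (intro mult_le_mono power_mono) (auto simp: algebra_simps)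
  also have "\<dots> = (card Z ^ k * (2 * m + 1) ^ a) * q ^ (a + (card Z - k))"
    by (simp only: power_mult_distrib power_add ac_simps)
  also have "\<dots> < q * q ^ (a + (card Z - k))"
    using q q0 by (intro mult_strict_right_mono) auto
  also have "\<dots> = q ^ Suc (a + (card Z - k))" by simp
  also have "\<dots> \<le> q ^ card Z" using q0 ak kZ by (intro power_increasing) auto
  finally have less: "card T < card (I q Z)" by (simp add: card_I)
  have "finite T" unfolding T_def using fF fG fin_P by (intro finite_SigmaI) auto
  then have "\<not> inj_on \<Phi> (I q Z)"
    using less \<Phi> by (meson card_inj_on_le not_less)
  then obtain i i' where ii: "i \<in> I q Z" "i' \<in> I q Z" "i \<noteq> i'" "\<Phi> i = \<Phi> i'" by (auto simp: inj_on_def)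
  have 1: "\<zeta> i w = \<zeta> i' w" if "w < k" for w
    using ii(4) that unfolding \<Phi>_def by (metis lessThan_iff prod.inject restrict_apply')
  then have im: "\<zeta> i ` {..<k} = \<zeta> i' ` {..<k}" by auto
  have 2: "cell i j = cell i' j" if "j < a" for j
    using ii(4) that unfolding \<Phi>_def by (metis lessThan_iff prod.inject restrict_apply')
  have 3: "i z = i' z" if "z \<in> Z" "z \<notin> \<zeta> i ` {..<k}" for z
  proof -
    have "restrict i (Z - \<zeta> i ` {..<k}) z = restrict i' (Z - \<zeta> i ` {..<k}) z"
      using ii(4) im unfolding \<Phi>_def by simp
    then show ?thesis using that by simp
  qed
  show ?thesis using that[OF ii(1-3) 1 2 3] by blast
qed

text \<open>
  The single number \<open>J\<close> bounds the parameters, keeps the vectors away from \<open>0\<close> and keeps their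
  directions apart. Each realisation by nonzero vectors in pairwise different directions satisfies these conditions for
  some \<open>J\<close>, and for a fixed \<open>J\<close> all estimates are uniform.
\<close>

definition config_realized ::
    "nat \<Rightarrow> nat \<Rightarrow> nat \<Rightarrow> (nat \<Rightarrow> (nat \<Rightarrow> real) \<Rightarrow> 'a::euclidean_space) \<Rightarrow>
     (nat \<Rightarrow> (nat \<Rightarrow> real) \<Rightarrow> real) \<Rightarrow> ('a \<Rightarrow> real) \<Rightarrow> bool" where
  "config_realized a k J V L P \<longleftrightarrow> (\<exists>\<theta>. (\<forall>i<a. \<bar>\<theta> i\<bar> \<le> real J) \<and>
     (\<forall>w<k. P (V w \<theta>) = L w \<theta> \<and> 1 / real J \<le> norm (V w \<theta>)) \<and>
     (\<forall>w<k. \<forall>w'<k. w \<noteq> w' \<longrightarrow>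
        \<bar>V w \<theta> \<bullet> V w' \<theta>\<bar> \<le> (1 - 1 / real J) * (norm (V w \<theta>) * norm (V w' \<theta>))))"

text \<open>
  There are \<open>k\<close> equations for \<open>a < k\<close> parameters. The norm is perturbed by bumps at the elements of a
  finite net \<open>Z\<close>, with heights in an arithmetic progression of \<open>q\<close> terms. If all choices of
  heights allowed a realisation, consider for each choice a realisation and, for each vector \<open>V w\<close>, an
  element of \<open>Z\<close> whose bump is high there. By \<open>grid_collision\<close>, two different choices would have
  nearly the same parameters, the same selected elements and the same heights elsewhere. The bump
  selected for \<open>V w\<close> vanishes at all the other vectors, so the \<open>w\<close>-th equation determines the height
  of that bump from the remaining data, up to less than one step of the progression. So
  the two choices would agree.
\<close>

lemma perturb_avoids_config:
  fixes N :: "'a::euclidean_space \<Rightarrow> real"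
  assumes N: "is_norm N" and \<epsilon>: "\<epsilon> > 0" and ak: "a < k" and J: "J \<ge> 1" and C: "C > 0"
    and bound: "\<And>w \<theta>. w < k \<Longrightarrow> \<forall>i<a. \<bar>\<theta> i\<bar> \<le> real J \<Longrightarrow> norm (V w \<theta>) \<le> C"
    and lipV: "\<And>w \<theta> \<theta>' \<eta>. w < k \<Longrightarrow> \<forall>i<a. \<bar>\<theta> i\<bar> \<le> real J \<Longrightarrow> \<forall>i<a. \<bar>\<theta>' i\<bar> \<le> real J \<Longrightarrow>
      \<forall>i<a. \<bar>\<theta> i - \<theta>' i\<bar> \<le> \<eta> \<Longrightarrow> 0 \<le> \<eta> \<Longrightarrow> norm (V w \<theta> - V w \<theta>') \<le> C * \<eta>"
    and lipL: "\<And>w \<theta> \<theta>' \<eta>. w < k \<Longrightarrow> \<forall>i<a. \<bar>\<theta> i\<bar> \<le> real J \<Longrightarrow> \<forall>i<a. \<bar>\<theta>' i\<bar> \<le> real J \<Longrightarrow>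
      \<forall>i<a. \<bar>\<theta> i - \<theta>' i\<bar> \<le> \<eta> \<Longrightarrow> 0 \<le> \<eta> \<Longrightarrow> \<bar>L w \<theta> - L w \<theta>'\<bar> \<le> C * \<eta>"
  shows "\<exists>M \<tau>. is_norm M \<and> \<tau> > 0 \<and> (\<forall>x. N x \<le> M x \<and> M x \<le> N x + \<epsilon> * norm x) \<and>
      (\<forall>P. is_norm P \<longrightarrow> (\<forall>x. \<bar>P x - M x\<bar> \<le> \<tau> * norm x) \<longrightarrow> \<not> config_realized a k J V L P)"
proof -
  \<comment> \<open>This width makes vectors under the same bump closer in direction than the separation allows.\<close>
  define \<delta> where "\<delta> = 1 / (4 * real J)"
  have \<delta>: "0 < \<delta>" "\<delta> \<le> 1" "4 * \<delta> = 1 / real J" using J by (auto simp: \<delta>_def field_simps)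
  obtain Z :: "'a set" where Z: "finite Z" "Z \<noteq> {}" "\<And>z. z \<in> Z \<Longrightarrow> norm z = 1"
    "\<And>x. \<exists>z\<in>Z. \<delta> / 2 * norm x \<le> bump \<delta> z x"
    using bump_net[OF \<delta>(1,2)] by blast
  obtain A where A: "A > 0" "\<And>x. N x \<le> A * norm x" using is_norm_upper[OF N] by blast
  define r where "r = card Z"
  have r: "r > 0" using Z by (simp add: r_def card_gt_0_iff)
  define c where "c = \<epsilon> / 2"
  \<comment> \<open>With heights at most this, the total height is at most the multiple of the Euclidean norm that is added.\<close>
  define \<rho> where "\<rho> = c / real r"
  define \<gamma> where "\<gamma> = \<delta> / (2 * real J)"
  have pos: "c > 0" "\<rho> > 0" "\<gamma> > 0" using \<epsilon> r \<delta> J by (auto simp: c_def \<rho>_def \<gamma>_def)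
  \<comment> \<open>The two sources of error, the tolerance around the perturbed norm and the cell size, get half of the budget each.\<close>
  define \<tau>0 where "\<tau>0 = \<gamma> * \<rho> / (4 * C)"
  have \<tau>0: "\<tau>0 > 0" "2 * (\<tau>0 * C) = \<gamma> * \<rho> / 2" using pos C by (auto simp: \<tau>0_def)
  obtain M0 where M0: "C * (1 + A + \<epsilon>) / (\<gamma> * \<rho> / 2) < real M0"
    using reals_Archimedean2 by blast
  have M0pos: "real M0 > 0"
    using M0 C A \<epsilon> pos by (smt (verit) divide_pos_pos mult_pos_pos)
  have M0': "C * (1 + A + \<epsilon>) / real M0 < \<gamma> * \<rho> / 2"
    using M0 M0pos pos by (simp add: field_simps)
  define q where "q = r ^ k * (2 * (J * M0) + 1) ^ a + 1"
  define h where "h = \<rho> / real q"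
  define \<tau> where "\<tau> = \<tau>0 / real q"
  have q0: "q > 0" by (simp add: q_def)
  have h: "h > 0" and \<tau>: "\<tau> > 0" using pos q0 \<tau>0 by (auto simp: h_def \<tau>_def)
  define I where "I = PiE Z (\<lambda>_. {..<q})"
  define M where "M i x = N x + c * norm x + (\<Sum>z\<in>Z. (h * real (i z)) * bump \<delta> z x)" for i :: "'a \<Rightarrow> nat" and x
  have hi: "0 \<le> h * real (i z)" "h * real (i z) \<le> \<rho>" if "i \<in> I" "z \<in> Z" for i z
  proof -
    have "i z < q" using that by (auto simp: I_def)
    then have "h * real (i z) \<le> h * real q" using h by (intro mult_left_mono) auto
    then show "h * real (i z) \<le> \<rho>" using q0 by (simp add: h_def)
  qed (use h in auto)
  have sum_h: "(\<Sum>z\<in>Z. h * real (i z)) \<le> c" if "i \<in> I" for i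
  proof -
    have "(\<Sum>z\<in>Z. h * real (i z)) \<le> (\<Sum>z\<in>Z. \<rho>)" using hi that by (intro sum_mono) auto
    then show ?thesis using r by (simp add: \<rho>_def r_def)
  qed
  have normM: "is_norm (M i)" if "i \<in> I" for i
    unfolding M_def using is_norm_add_bumps[OF N Z(1), of "\<lambda>z. h * real (i z)"] hi sum_h that \<delta> by auto
  have M_ge: "N x \<le> M i x" if "i \<in> I" for i x
    unfolding M_def using pos hi that by (simp add: sum_nonneg bump_nonneg)
  have M_le: "M i x \<le> N x + \<epsilon> * norm x" if "i \<in> I" for i x
  proof -
    have "(\<Sum>z\<in>Z. (h * real (i z)) * bump \<delta> z x) \<le> (\<Sum>z\<in>Z. (h * real (i z)) * norm x)"
    proof (intro sum_mono mult_left_mono hi that)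
      fix z assume "z \<in> Z"
      then have "bump \<delta> z x \<le> \<delta> * norm x" using Z(3) \<delta> by (intro bump_le) auto
      also have "\<dots> \<le> 1 * norm x" using \<delta> by (intro mult_right_mono) auto
      finally show "bump \<delta> z x \<le> norm x" by simp
    qed auto
    also have "\<dots> = (\<Sum>z\<in>Z. h * real (i z)) * norm x" by (simp add: sum_distrib_right)
    also have "\<dots> \<le> c * norm x" using sum_h[OF that] by (intro mult_right_mono) auto
    finally show ?thesis by (simp add: M_def c_def algebra_simps)
  qed
  show ?thesis
  proof (rule ccontr)
    assume contra: "\<not> ?thesis"
    define core where "core P \<theta> \<longleftrightarrow> (\<forall>i<a. \<bar>\<theta> i\<bar> \<le> real J) \<and>
     (\<forall>w<k. P (V w \<theta>) = L w \<theta> \<and> 1 / real J \<le> norm (V w \<theta>)) \<and>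
     (\<forall>w<k. \<forall>w'<k. w \<noteq> w' \<longrightarrow>
        \<bar>V w \<theta> \<bullet> V w' \<theta>\<bar> \<le> (1 - 1 / real J) * (norm (V w \<theta>) * norm (V w' \<theta>)))" for P \<theta>
    have realized: "config_realized a k J V L P \<longleftrightarrow> (\<exists>\<theta>. core P \<theta>)" for P
      by (simp only: config_realized_def core_def)
    have "\<exists>P \<theta>. (\<forall>x. \<bar>P x - M i x\<bar> \<le> \<tau> * norm x) \<and> core P \<theta>" if "i \<in> I" for i
      using contra normM[OF that] M_ge[OF that] M_le[OF that] \<tau> unfolding realized by blast
    then obtain P \<theta> where R: "\<And>i. i \<in> I \<Longrightarrow> (\<forall>x. \<bar>P i x - M i x\<bar> \<le> \<tau> * norm x) \<and> core (P i) (\<theta> i)"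
      by metis
    note core = R[THEN conjunct2, unfolded core_def]
    have \<theta>P: "\<And>i x. i \<in> I \<Longrightarrow> \<bar>P i x - M i x\<bar> \<le> \<tau> * norm x"
      using R by blast
    have box: "\<And>i. i \<in> I \<Longrightarrow> \<forall>j<a. \<bar>\<theta> i j\<bar> \<le> real J"
      and eqn: "\<And>i w. i \<in> I \<Longrightarrow> w < k \<Longrightarrow> P i (V w (\<theta> i)) = L w (\<theta> i)"
      and large: "\<And>i w. i \<in> I \<Longrightarrow> w < k \<Longrightarrow> 1 / real J \<le> norm (V w (\<theta> i))"
      and sep: "\<And>i w w'. i \<in> I \<Longrightarrow> w < k \<Longrightarrow> w' < k \<Longrightarrow> w \<noteq> w' \<Longrightarrow>
        \<bar>V w (\<theta> i) \<bullet> V w' (\<theta> i)\<bar> \<le> (1 - 1 / real J) * (norm (V w (\<theta> i)) * norm (V w' (\<theta> i)))"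
      using core by blast+
    have near: "\<bar>M i (V w (\<theta> i)) - L w (\<theta> i)\<bar> \<le> \<tau> * C" if "i \<in> I" "w < k" for i w
    proof -
      have "\<bar>P i (V w (\<theta> i)) - M i (V w (\<theta> i))\<bar> \<le> \<tau> * norm (V w (\<theta> i))" by (rule \<theta>P[OF that(1)])
      also have "\<dots> \<le> \<tau> * C" using bound[OF that(2) box[OF that(1)]] \<tau> by (intro mult_left_mono) auto
      finally show ?thesis using eqn[OF that] by simp
    qed
    obtain \<xi> where \<xi>: "\<And>x. \<xi> x \<in> Z" "\<And>x. \<delta> / 2 * norm x \<le> bump \<delta> (\<xi> x) x" using Z(4) by metis
    define \<zeta> where "\<zeta> i w = \<xi> (V w (\<theta> i))" for i w
    have \<zeta>Z: "\<zeta> i w \<in> Z" for i w by (simp add: \<zeta>_def \<xi>)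
    have peak: "\<gamma> \<le> bump \<delta> (\<zeta> i w) (V w (\<theta> i))" if "i \<in> I" "w < k" for i w
    proof -
      have "\<gamma> = \<delta> / 2 * (1 / real J)" by (simp add: \<gamma>_def)
      also have "\<dots> \<le> \<delta> / 2 * norm (V w (\<theta> i))" using large[OF that] \<delta> by (intro mult_left_mono) auto
      also have "\<dots> \<le> bump \<delta> (\<zeta> i w) (V w (\<theta> i))" unfolding \<zeta>_def by (rule \<xi>)
      finally show ?thesis .
    qed
    have zero: "bump \<delta> (\<zeta> i w') (V w (\<theta> i)) = 0" if "i \<in> I" "w < k" "w' < k" "w \<noteq> w'" for i w w'
    proof (rule ccontr)
      assume "\<not> ?thesis"
      then have "0 < bump \<delta> (\<zeta> i w') (V w (\<theta> i))" using bump_nonneg[of \<delta> "\<zeta> i w'" "V w (\<theta> i)"] by linarith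
      moreover have "0 < bump \<delta> (\<zeta> i w') (V w' (\<theta> i))" using peak[OF that(1,3)] pos by linarith
      ultimately have "(1 - 4 * \<delta>) * (norm (V w (\<theta> i)) * norm (V w' (\<theta> i))) < \<bar>V w (\<theta> i) \<bullet> V w' (\<theta> i)\<bar>"
        using bump_pos_imp_near Z(3)[OF \<zeta>Z] \<delta>(1) by blast
      then show False using sep[OF that] \<delta>(3) by simp
    qed
    have inj: "inj_on (\<zeta> i) {..<k}" if "i \<in> I" for i
    proof (rule inj_onI, rule ccontr)
      fix w w' assume *: "w \<in> {..<k}" "w' \<in> {..<k}" "\<zeta> i w = \<zeta> i w'" "w \<noteq> w'"
      then show False using zero[OF that, of w w'] peak[OF that, of w] pos by simp
    qed
    \<comment> \<open>The cells have side length inversely proportional to \<open>M0 * q\<close>, small compared to a step of the heights.\<close>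
    define cell where "cell i j = \<lfloor>\<theta> i j * real (M0 * q)\<rfloor>" for i j
    have cell: "\<bar>cell i j\<bar> \<le> int (J * M0 * q)" if "i \<in> I" "j < a" for i j
    proof -
      have "\<bar>\<theta> i j\<bar> * real (M0 * q) \<le> real J * real (M0 * q)"
        using box[OF that(1)] that(2) by (intro mult_right_mono) auto
      then have "\<bar>\<theta> i j * real (M0 * q)\<bar> \<le> real_of_int (int (J * M0 * q))" by (simp add: abs_mult mult.assoc)
      then have "\<theta> i j * real (M0 * q) \<le> real_of_int (int (J * M0 * q))"
        "- real_of_int (int (J * M0 * q)) \<le> \<theta> i j * real (M0 * q)" by (simp_all only: abs_le_iff) linarith
      then show ?thesis unfolding cell_def abs_le_iff by (metis floor_le_iff floor_mono floor_of_int le_floor_iff minus_le_iff of_int_minus)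
    qed
    have qbig: "card Z ^ k * (2 * (J * M0) + 1) ^ a < q" by (simp add: q_def r_def)
    obtain i i' where i: "i \<in> I" "i' \<in> I" "i \<noteq> i'" and same\<zeta>: "\<And>w. w < k \<Longrightarrow> \<zeta> i w = \<zeta> i' w"
      and same_cell: "\<And>j. j < a \<Longrightarrow> cell i j = cell i' j"
      and same_off: "\<And>z. z \<in> Z \<Longrightarrow> z \<notin> \<zeta> i ` {..<k} \<Longrightarrow> i z = i' z"
      using grid_collision[OF Z(1) ak qbig, of \<zeta> cell, folded I_def, OF inj \<zeta>Z cell] by metis
    define \<eta> where "\<eta> = 1 / real (M0 * q)"
    have \<eta>: "0 \<le> \<eta>" by (simp add: \<eta>_def)
    have close: "\<forall>j<a. \<bar>\<theta> i j - \<theta> i' j\<bar> \<le> \<eta>"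
    proof (intro allI impI)
      fix j assume "j < a"
      then have "\<lfloor>\<theta> i j * real (M0 * q)\<rfloor> = \<lfloor>\<theta> i' j * real (M0 * q)\<rfloor>" using same_cell by (simp add: cell_def)
      then have "\<bar>\<theta> i j * real (M0 * q) - \<theta> i' j * real (M0 * q)\<bar> \<le> 1" by linarith
      then have "\<bar>\<theta> i j - \<theta> i' j\<bar> * real (M0 * q) \<le> 1" by (simp add: abs_mult flip: left_diff_distrib)
      moreover have "real (M0 * q) > 0" using M0pos q0 by simp
      ultimately show "\<bar>\<theta> i j - \<theta> i' j\<bar> \<le> \<eta>" by (simp add: \<eta>_def pos_le_divide_eq)
    qed
    have "i (\<zeta> i w) = i' (\<zeta> i w)" if w: "w < k" for w
    proof -
      define v v' where "v = V w (\<theta> i)" and "v' = V w (\<theta> i')"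
      \<comment> \<open>Only the bump selected for this vector contributes to the difference of the two norms.\<close>
      have "M i v - M i' v = (\<Sum>z\<in>Z. (h * real (i z)) * bump \<delta> z v - (h * real (i' z)) * bump \<delta> z v)"
        by (simp add: M_def sum_subtractf)
      also have "\<dots> = (\<Sum>z\<in>Z. h * (real (i z) - real (i' z)) * bump \<delta> z v)"
        by (simp only: left_diff_distrib right_diff_distrib)
      also have "\<dots> = h * (real (i (\<zeta> i w)) - real (i' (\<zeta> i w))) * bump \<delta> (\<zeta> i w) v"
      proof -
        have off: "h * (real (i z) - real (i' z)) * bump \<delta> z v = 0" if z: "z \<in> Z - {\<zeta> i w}" for z
        proof (cases "z \<in> \<zeta> i ` {..<k}")
          case True
          then obtain w' where "w' < k" "z = \<zeta> i w'" by auto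
          then have "bump \<delta> z v = 0" using zero[OF i(1) w, of w'] z by (auto simp: v_def)
          then show ?thesis by simp
        next
          case False then show ?thesis using same_off z by simp
        qed
        show ?thesis
          by (subst sum.remove[OF Z(1) \<zeta>Z[of i w]], subst sum.neutral) (use off in auto)
      qed
      finally have "\<bar>M i v - M i' v\<bar> = h * \<bar>real (i (\<zeta> i w)) - real (i' (\<zeta> i w))\<bar> * bump \<delta> (\<zeta> i w) v"
        using h bump_nonneg[of \<delta> "\<zeta> i w" v] by (simp add: abs_mult)
      moreover have "h * \<bar>real (i (\<zeta> i w)) - real (i' (\<zeta> i w))\<bar> * \<gamma> \<le> \<dots>"
        using peak[OF i(1) w] h unfolding v_def by (intro mult_left_mono) auto
      moreover have "\<bar>M i v - M i' v\<bar> \<le> \<tau> * C + C * \<eta> + \<tau> * C + (A + \<epsilon>) * (C * \<eta>)"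
      proof -
        have "\<bar>M i' v - M i' v'\<bar> \<le> M i' (v - v')" by (rule is_norm_diff_le[OF normM[OF i(2)]])
        also have "\<dots> \<le> (A + \<epsilon>) * norm (v - v')"
          using M_le[OF i(2), of "v - v'"] A(2)[of "v - v'"] by (simp add: algebra_simps)
        also have "\<dots> \<le> (A + \<epsilon>) * (C * \<eta>)"
          unfolding v_def v'_def using lipV[OF w box[OF i(1)] box[OF i(2)] close \<eta>] A(1) \<epsilon>
          by (intro mult_left_mono) auto
        finally have "\<bar>M i' v - M i' v'\<bar> \<le> (A + \<epsilon>) * (C * \<eta>)" .
        moreover have "\<bar>L w (\<theta> i) - L w (\<theta> i')\<bar> \<le> C * \<eta>"
          by (rule lipL[OF w box[OF i(1)] box[OF i(2)] close \<eta>])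
        ultimately show ?thesis using near[OF i(1) w] near[OF i(2) w] unfolding v_def v'_def by linarith
      qed
      moreover have "\<tau> * C + C * \<eta> + \<tau> * C + (A + \<epsilon>) * (C * \<eta>) = (2 * (\<tau>0 * C) + C * (1 + A + \<epsilon>) / real M0) / real q"
        using q0 M0pos by (simp add: \<tau>_def \<eta>_def field_simps)
      moreover have "\<dots> < (\<gamma> * \<rho>) / real q"
      proof (rule divide_strict_right_mono)
        show "2 * (\<tau>0 * C) + C * (1 + A + \<epsilon>) / real M0 < \<gamma> * \<rho>" using M0' \<tau>0(2) by linarith
      qed (use q0 in simp)
      moreover have "(\<gamma> * \<rho>) / real q = h * 1 * \<gamma>" by (simp add: h_def)
      ultimately have "h * \<bar>real (i (\<zeta> i w)) - real (i' (\<zeta> i w))\<bar> * \<gamma> < h * 1 * \<gamma>" by linarith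
      then have "\<bar>real (i (\<zeta> i w)) - real (i' (\<zeta> i w))\<bar> < 1" using h pos by simp
      then show ?thesis by linarith
    qed
    then have "i z = i' z" if "z \<in> Z" for z using same_off[OF that] by auto
    then have "i = i'" using i unfolding I_def by (intro PiE_ext) auto
    then show False using i by simp
  qed
qed

section \<open>Typical norms\<close>

text \<open>
  Expressions rather than functions, so that countability is immediate.
\<close>

datatype pexp = Const int | Var nat | Add pexp pexp | Mul pexp pexp

instance pexp :: countable
  by countable_datatype

primrec peval :: "pexp \<Rightarrow> (nat \<Rightarrow> real) \<Rightarrow> real" where
  "peval (Const c) \<theta> = of_int c"
| "peval (Var i) \<theta> = \<theta> i"
| "peval (Add e f) \<theta> = peval e \<theta> + peval f \<theta>"
| "peval (Mul e f) \<theta> = peval e \<theta> * peval f \<theta>"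

text \<open>
  Truncation confines every expression to the first \<open>a\<close> parameters, so that bounds on these
  suffice for estimates.
\<close>

definition trunc :: "nat \<Rightarrow> (nat \<Rightarrow> real) \<Rightarrow> nat \<Rightarrow> real" where
  "trunc a \<theta> i = (if i < a then \<theta> i else 0)"

lemma peval_lipschitz:
  assumes "0 \<le> (J::real)"
  shows "\<exists>C\<ge>0. \<forall>\<theta> \<theta>' \<eta>. (\<forall>i. \<bar>\<theta> i\<bar> \<le> J) \<longrightarrow> (\<forall>i. \<bar>\<theta>' i\<bar> \<le> J) \<longrightarrow> (\<forall>i. \<bar>\<theta> i - \<theta>' i\<bar> \<le> \<eta>) \<longrightarrow>
    \<bar>peval e \<theta>\<bar> \<le> C \<and> \<bar>peval e \<theta> - peval e \<theta>'\<bar> \<le> C * \<eta>"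
proof (induction e)
  case (Const c)
  show ?case
  proof (intro exI[of _ "\<bar>real_of_int c\<bar>"] conjI allI impI)
    fix \<theta> \<theta>' :: "nat \<Rightarrow> real" and \<eta> :: real assume "\<forall>i. \<bar>\<theta> i - \<theta>' i\<bar> \<le> \<eta>"
    then have "0 \<le> \<eta>" by (meson abs_ge_zero order_trans)
    then show "\<bar>peval (Const c) \<theta> - peval (Const c) \<theta>'\<bar> \<le> \<bar>real_of_int c\<bar> * \<eta>" by simp
  qed auto
next
  case (Var i)
  show ?case
  proof (intro exI[of _ "J + 1"] conjI allI impI)
    fix \<theta> \<theta>' :: "nat \<Rightarrow> real" and \<eta> :: real assume *: "\<forall>i. \<bar>\<theta> i\<bar> \<le> J" "\<forall>i. \<bar>\<theta> i - \<theta>' i\<bar> \<le> \<eta>"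
    show "\<bar>peval (Var i) \<theta>\<bar> \<le> J + 1" using *(1) by (simp add: add_increasing2)
    have "0 \<le> \<eta>" using *(2) by (meson abs_ge_zero order_trans)
    then have "0 \<le> J * \<eta>" using assms by simp
    moreover have "\<bar>\<theta> i - \<theta>' i\<bar> \<le> \<eta>" using * by blast
    ultimately show "\<bar>peval (Var i) \<theta> - peval (Var i) \<theta>'\<bar> \<le> (J + 1) * \<eta>" by (simp add: distrib_right)
  qed (use assms in auto)
next
  case (Add e f)
  obtain C where C1: "C \<ge> 0"
    "\<forall>\<theta> \<theta>' \<eta>. (\<forall>i. \<bar>\<theta> i\<bar> \<le> J) \<longrightarrow> (\<forall>i. \<bar>\<theta>' i\<bar> \<le> J) \<longrightarrow> (\<forall>i. \<bar>\<theta> i - \<theta>' i\<bar> \<le> \<eta>) \<longrightarrow>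
    \<bar>peval e \<theta>\<bar> \<le> C \<and> \<bar>peval e \<theta> - peval e \<theta>'\<bar> \<le> C * \<eta>"
    using Add.IH(1) by (elim exE conjE)
  obtain D where D1: "D \<ge> 0"
    "\<forall>\<theta> \<theta>' \<eta>. (\<forall>i. \<bar>\<theta> i\<bar> \<le> J) \<longrightarrow> (\<forall>i. \<bar>\<theta>' i\<bar> \<le> J) \<longrightarrow> (\<forall>i. \<bar>\<theta> i - \<theta>' i\<bar> \<le> \<eta>) \<longrightarrow>
    \<bar>peval f \<theta>\<bar> \<le> D \<and> \<bar>peval f \<theta> - peval f \<theta>'\<bar> \<le> D * \<eta>"
    using Add.IH(2) by (elim exE conjE)
  note C = C1(1) D1(1) C1(2) D1(2)
  show ?case
  proof (intro exI[of _ "C + D"] conjI allI impI)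
    fix \<theta> \<theta>' :: "nat \<Rightarrow> real" and \<eta> :: real
    assume *: "\<forall>i. \<bar>\<theta> i\<bar> \<le> J" "\<forall>i. \<bar>\<theta>' i\<bar> \<le> J" "\<forall>i. \<bar>\<theta> i - \<theta>' i\<bar> \<le> \<eta>"
    have 1: "\<bar>peval e \<theta>\<bar> \<le> C \<and> \<bar>peval e \<theta> - peval e \<theta>'\<bar> \<le> C * \<eta>" using C(3) * by blast
    have 2: "\<bar>peval f \<theta>\<bar> \<le> D \<and> \<bar>peval f \<theta> - peval f \<theta>'\<bar> \<le> D * \<eta>" using C(4) * by blast
    show "\<bar>peval (Add e f) \<theta>\<bar> \<le> C + D" using 1 2 unfolding peval.simps by linarith
    show "\<bar>peval (Add e f) \<theta> - peval (Add e f) \<theta>'\<bar> \<le> (C + D) * \<eta>"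
      using 1 2 unfolding peval.simps distrib_right by linarith
  qed (use C in auto)
next
  case (Mul e f)
  obtain C where C1: "C \<ge> 0"
    "\<forall>\<theta> \<theta>' \<eta>. (\<forall>i. \<bar>\<theta> i\<bar> \<le> J) \<longrightarrow> (\<forall>i. \<bar>\<theta>' i\<bar> \<le> J) \<longrightarrow> (\<forall>i. \<bar>\<theta> i - \<theta>' i\<bar> \<le> \<eta>) \<longrightarrow>
    \<bar>peval e \<theta>\<bar> \<le> C \<and> \<bar>peval e \<theta> - peval e \<theta>'\<bar> \<le> C * \<eta>"
    using Mul.IH(1) by (elim exE conjE)
  obtain D where D1: "D \<ge> 0"
    "\<forall>\<theta> \<theta>' \<eta>. (\<forall>i. \<bar>\<theta> i\<bar> \<le> J) \<longrightarrow> (\<forall>i. \<bar>\<theta>' i\<bar> \<le> J) \<longrightarrow> (\<forall>i. \<bar>\<theta> i - \<theta>' i\<bar> \<le> \<eta>) \<longrightarrow>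
    \<bar>peval f \<theta>\<bar> \<le> D \<and> \<bar>peval f \<theta> - peval f \<theta>'\<bar> \<le> D * \<eta>"
    using Mul.IH(2) by (elim exE conjE)
  note C = C1(1) D1(1) C1(2) D1(2)
  show ?case
  proof (intro exI[of _ "2 * (C * D)"] conjI allI impI)
    fix \<theta> \<theta>' :: "nat \<Rightarrow> real" and \<eta> :: real
    assume *: "\<forall>i. \<bar>\<theta> i\<bar> \<le> J" "\<forall>i. \<bar>\<theta>' i\<bar> \<le> J" "\<forall>i. \<bar>\<theta> i - \<theta>' i\<bar> \<le> \<eta>"
    have **: "\<forall>i. \<bar>\<theta>' i - \<theta> i\<bar> \<le> \<eta>" using *(3) by (simp add: abs_minus_commute)
    have 1: "\<bar>peval e \<theta>\<bar> \<le> C" "\<bar>peval e \<theta> - peval e \<theta>'\<bar> \<le> C * \<eta>" using C(3) * by blast+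
    have 2: "\<bar>peval f \<theta>\<bar> \<le> D" "\<bar>peval f \<theta> - peval f \<theta>'\<bar> \<le> D * \<eta>" using C(4) * by blast+
    have 3: "\<bar>peval f \<theta>'\<bar> \<le> D" using C(4) * ** by blast
    have "\<bar>peval e \<theta>\<bar> * \<bar>peval f \<theta>\<bar> \<le> C * D" using 1 2 C by (intro mult_mono) auto
    then show "\<bar>peval (Mul e f) \<theta>\<bar> \<le> 2 * (C * D)"
      using mult_nonneg_nonneg[OF C(1,2)] by (simp add: abs_mult)
    have "peval (Mul e f) \<theta> - peval (Mul e f) \<theta>'
      = peval e \<theta> * (peval f \<theta> - peval f \<theta>') + (peval e \<theta> - peval e \<theta>') * peval f \<theta>'"
      by (simp add: algebra_simps)
    also have "\<bar>\<dots>\<bar> \<le> \<bar>peval e \<theta>\<bar> * \<bar>peval f \<theta> - peval f \<theta>'\<bar> + \<bar>peval e \<theta> - peval e \<theta>'\<bar> * \<bar>peval f \<theta>'\<bar>"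
      by (metis abs_mult abs_triangle_ineq)
    also have "\<dots> \<le> C * (D * \<eta>) + (C * \<eta>) * D"
    proof (intro add_mono mult_mono)
      show "0 \<le> C * \<eta>" using 1(2) abs_ge_zero order_trans by blast
    qed (use 1 2 3 C in auto)
    also have "\<dots> = 2 * (C * D) * \<eta>" by simp
    finally show "\<bar>peval (Mul e f) \<theta> - peval (Mul e f) \<theta>'\<bar> \<le> 2 * (C * D) * \<eta>" .
  qed (use C in auto)
qed

type_synonym 'n config = "(('n \<Rightarrow> pexp) \<times> pexp) list"

definition cvec :: "nat \<Rightarrow> 'n::finite config \<Rightarrow> nat \<Rightarrow> (nat \<Rightarrow> real) \<Rightarrow> real ^ 'n" where
  "cvec a cfg w \<theta> = (\<chi> i. peval (fst (cfg ! w) i) (trunc a \<theta>))"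

definition clen :: "nat \<Rightarrow> 'n::finite config \<Rightarrow> nat \<Rightarrow> (nat \<Rightarrow> real) \<Rightarrow> real" where
  "clen a cfg w \<theta> = peval (snd (cfg ! w)) (trunc a \<theta>)"

definition degenerate :: "nat \<Rightarrow> 'n::finite config \<Rightarrow> nat \<Rightarrow> (real ^ 'n \<Rightarrow> real) \<Rightarrow> bool" where
  "degenerate a cfg J N \<longleftrightarrow> a < length cfg \<and> 1 \<le> J \<and>
     config_realized a (length cfg) J (cvec a cfg) (clen a cfg) N"

lemma nowhere_dense_degenerate:
  fixes cfg :: "'n::finite config"
  shows "nowhere_dense_in sym_body_topology {unit_ball N | N. is_norm N \<and> degenerate a cfg J N}"
proof (rule nowhere_dense_unit_ballsI)
  fix N :: "real ^ 'n \<Rightarrow> real" and \<epsilon> :: real assume N: "is_norm N" and \<epsilon>: "\<epsilon> > 0"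
  show "\<exists>M \<tau>. is_norm M \<and> \<tau> > 0 \<and> (\<forall>x. N x \<le> M x \<and> M x \<le> N x + \<epsilon> * norm x) \<and>
      (\<forall>L. is_norm L \<longrightarrow> (\<forall>x. \<bar>L x - M x\<bar> \<le> \<tau> * norm x) \<longrightarrow> \<not> degenerate a cfg J L)"
  proof (cases "a < length cfg \<and> 1 \<le> J")
    case False
    then have "\<not> degenerate a cfg J L" for L by (simp only: degenerate_def) blast
    then show ?thesis using N \<epsilon> by (intro exI[of _ N] exI[of _ 1]) simp
  next
    case True
    obtain C where C: "\<And>e. 0 \<le> C e" "\<And>e \<theta> \<theta>' \<eta>. (\<forall>i. \<bar>\<theta> i\<bar> \<le> real J) \<Longrightarrow> (\<forall>i. \<bar>\<theta>' i\<bar> \<le> real J) \<Longrightarrow>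
      (\<forall>i. \<bar>\<theta> i - \<theta>' i\<bar> \<le> \<eta>) \<Longrightarrow> \<bar>peval e \<theta>\<bar> \<le> C e \<and> \<bar>peval e \<theta> - peval e \<theta>'\<bar> \<le> C e * \<eta>"
      using peval_lipschitz[of "real J"] by (metis of_nat_0_le_iff)
    define cw where "cw w = (\<Sum>i\<in>UNIV. C (fst (cfg ! w) i)) + C (snd (cfg ! w))" for w
    define K where "K = 1 + (\<Sum>w<length cfg. cw w)"
    have cw0: "0 \<le> cw w" for w unfolding cw_def by (intro add_nonneg_nonneg sum_nonneg C)
    have K: "K > 0" unfolding K_def using cw0 by (smt (verit) sum_nonneg)
    have cwK: "cw w \<le> K" if "w < length cfg" for w
    proof -
      have "cw w \<le> (\<Sum>w<length cfg. cw w)" using that cw0 by (intro member_le_sum) auto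
      then show ?thesis by (simp add: K_def)
    qed
    have boxt: "\<forall>i. \<bar>trunc a \<theta> i\<bar> \<le> real J" if "\<forall>i<a. \<bar>\<theta> i\<bar> \<le> real J" for \<theta>
      using that by (simp add: trunc_def)
    have ct: "\<forall>i. \<bar>trunc a \<theta> i - trunc a \<theta>' i\<bar> \<le> \<eta>" if "\<forall>i<a. \<bar>\<theta> i - \<theta>' i\<bar> \<le> \<eta>" "0 \<le> \<eta>" for \<theta> \<theta>' \<eta>
      using that by (simp add: trunc_def)
    have "\<exists>M \<tau>. is_norm M \<and> \<tau> > 0 \<and> (\<forall>x. N x \<le> M x \<and> M x \<le> N x + \<epsilon> * norm x) \<and>
      (\<forall>P. is_norm P \<longrightarrow> (\<forall>x. \<bar>P x - M x\<bar> \<le> \<tau> * norm x) \<longrightarrow>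
        \<not> config_realized a (length cfg) J (cvec a cfg) (clen a cfg) P)"
    proof (rule perturb_avoids_config[OF N \<epsilon> _ _ K])
      fix w and \<theta> \<theta>' :: "nat \<Rightarrow> real" and \<eta> :: real
      assume w: "w < length cfg" and b: "\<forall>i<a. \<bar>\<theta> i\<bar> \<le> real J"
      have "norm (cvec a cfg w \<theta>) \<le> (\<Sum>i\<in>UNIV. \<bar>cvec a cfg w \<theta> $ i\<bar>)" by (rule norm_le_l1_cart)
      also have "\<dots> \<le> (\<Sum>i\<in>UNIV. C (fst (cfg ! w) i))"
        using C(2)[OF boxt[OF b] boxt[OF b], of 0] by (intro sum_mono) (simp add: cvec_def)
      also have "\<dots> \<le> K" using cwK[OF w] C(1)[of "snd (cfg ! w)"] by (simp add: cw_def)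
      finally show "norm (cvec a cfg w \<theta>) \<le> K" .
      assume b': "\<forall>i<a. \<bar>\<theta>' i\<bar> \<le> real J" and \<eta>: "\<forall>i<a. \<bar>\<theta> i - \<theta>' i\<bar> \<le> \<eta>" "0 \<le> \<eta>"
      note lip = C(2)[OF boxt[OF b] boxt[OF b'] ct[OF \<eta>], THEN conjunct2]
      have "norm (cvec a cfg w \<theta> - cvec a cfg w \<theta>') \<le> (\<Sum>i\<in>UNIV. \<bar>(cvec a cfg w \<theta> - cvec a cfg w \<theta>') $ i\<bar>)"
        by (rule norm_le_l1_cart)
      also have "\<dots> \<le> (\<Sum>i\<in>UNIV. C (fst (cfg ! w) i) * \<eta>)"
        using lip by (intro sum_mono) (simp add: cvec_def)
      also have "\<dots> = (\<Sum>i\<in>UNIV. C (fst (cfg ! w) i)) * \<eta>" by (simp add: sum_distrib_right)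
      also have "\<dots> \<le> K * \<eta>"
        using cwK[OF w] C(1)[of "snd (cfg ! w)"] \<eta>(2) by (intro mult_right_mono) (auto simp: cw_def)
      finally show "norm (cvec a cfg w \<theta> - cvec a cfg w \<theta>') \<le> K * \<eta>" .
      have "\<bar>clen a cfg w \<theta> - clen a cfg w \<theta>'\<bar> \<le> C (snd (cfg ! w)) * \<eta>" using lip by (simp add: clen_def)
      also have "\<dots> \<le> K * \<eta>"
      proof (intro mult_right_mono \<eta>(2))
        have "0 \<le> (\<Sum>i\<in>UNIV. C (fst (cfg ! w) i))" by (intro sum_nonneg C)
        then show "C (snd (cfg ! w)) \<le> K" using cwK[OF w] by (simp add: cw_def)
      qed
      finally show "\<bar>clen a cfg w \<theta> - clen a cfg w \<theta>'\<bar> \<le> K * \<eta>" .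
    qed (use True in auto)
    then show ?thesis unfolding degenerate_def by blast
  qed
qed

definition typical :: "(real ^ 'n::finite \<Rightarrow> real) \<Rightarrow> bool" where
  "typical N \<longleftrightarrow> (\<forall>a cfg J. \<not> degenerate a cfg J N)"

lemma nowhere_dense_in_subset:
  assumes "nowhere_dense_in X S" "T \<subseteq> S" shows "nowhere_dense_in X T"
  unfolding nowhere_dense_in_def
proof (intro conjI allI impI)
  show "T \<subseteq> topspace X" using assms by (auto simp: nowhere_dense_in_def)
  fix U assume "openin X U \<and> U \<noteq> {}"
  then obtain V where "openin X V" "V \<noteq> {}" "V \<subseteq> U" "V \<inter> S = {}"
    using assms(1) unfolding nowhere_dense_in_def by meson
  then show "\<exists>V. openin X V \<and> V \<noteq> {} \<and> V \<subseteq> U \<and> V \<inter> T = {}" using assms(2) by blast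
qed

text \<open>
  There are countably many polynomial configurations, and each is realised only by norms from
  a nowhere dense set.
\<close>

lemma for_norms_besides_meagreI:
  fixes P :: "(real ^ 'n::finite \<Rightarrow> real) \<Rightarrow> bool"
  assumes "\<And>N. is_norm N \<Longrightarrow> typical N \<Longrightarrow> P N"
  shows "for_norms_besides_meagre P"
proof -
  define S where "S = {unit_ball N | N. is_norm N \<and> \<not> P N}"
  define D where "D t = (case t of (a, cfg, J) \<Rightarrow> {unit_ball N | N. is_norm N \<and> degenerate a cfg J N})"
    for t :: "nat \<times> 'n config \<times> nat"
  define F where "F i = S \<inter> D (from_nat i)" for i
  have nd: "nowhere_dense_in sym_body_topology (D t)" for t
    unfolding D_def using nowhere_dense_degenerate by (cases t) auto
  have "nowhere_dense_in sym_body_topology (F i)" for i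
    using nowhere_dense_in_subset[OF nd] unfolding F_def by blast
  moreover have "S \<subseteq> (\<Union>i. F i)"
  proof
    fix K assume K: "K \<in> S"
    then obtain N where N: "K = unit_ball N" "is_norm N" "\<not> P N" by (auto simp: S_def)
    then obtain a cfg J where "degenerate a cfg J N" using assms unfolding typical_def by blast
    then have "K \<in> D (a, cfg, J)" using N by (auto simp: D_def)
    then have "K \<in> F (to_nat (a, cfg, J))" using K by (simp add: F_def)
    then show "K \<in> (\<Union>i. F i)" by blast
  qed
  then have "S = (\<Union>i. F i)" by (auto simp: F_def)
  ultimately show ?thesis
    unfolding for_norms_besides_meagre_def meagre_in_def S_def[symmetric] by blast
qed

text \<open>
  The uniform bounds in \<open>config_realized\<close> can be dropped: finitely many vectors that are pairwise not
  parallel have strict inequality in the Cauchy-Schwarz inequality, so a large \<open>J\<close> serves for all.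
\<close>

lemma typical_config_bound:
  fixes N :: "real ^ 'n::finite \<Rightarrow> real"
  assumes T: "typical N"
    and nz: "\<And>w. w < length cfg \<Longrightarrow> cvec a cfg w \<theta> \<noteq> 0"
    and nc: "\<And>w w'. w < length cfg \<Longrightarrow> w' < length cfg \<Longrightarrow> w \<noteq> w' \<Longrightarrow>
      \<not> collinear {0, cvec a cfg w \<theta>, cvec a cfg w' \<theta>}"
    and len: "\<And>w. w < length cfg \<Longrightarrow> N (cvec a cfg w \<theta>) = clen a cfg w \<theta>"
  shows "length cfg \<le> a"
proof (rule ccontr)
  assume "\<not> ?thesis"
  then have a: "a < length cfg" by simp
  define v where "v w = cvec a cfg w \<theta>" for w
  define q where "q w w' = \<bar>v w \<bullet> v w'\<bar> / (norm (v w) * norm (v w'))" for w w'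
  have ev: "\<forall>\<^sub>F J in sequentially. x \<le> real J" for x :: real
    using filterlim_real_sequentially unfolding filterlim_at_top by blast
  have ev': "\<forall>\<^sub>F J in sequentially. 1 / real J \<le> y" if "y > 0" for y :: real
    using ev[of "1 / y"] eventually_gt_at_top[of 0]
  proof eventually_elim
    case (elim J) then show ?case using that by (simp add: field_simps)
  qed
  \<comment> \<open>Each of the finitely many conditions holds for all large \<open>J\<close>.\<close>
  have "\<forall>\<^sub>F J in sequentially. \<forall>i\<in>{..<a}. \<bar>\<theta> i\<bar> \<le> real J"
    by (intro eventually_ball_finite) (use ev in auto)
  moreover have "\<forall>\<^sub>F J in sequentially. \<forall>w\<in>{..<length cfg}. 1 / real J \<le> norm (v w)"
    using nz by (intro eventually_ball_finite ballI ev') (auto simp: v_def)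
  moreover have "\<forall>\<^sub>F J in sequentially. \<forall>p\<in>{p \<in> {..<length cfg} \<times> {..<length cfg}. fst p \<noteq> snd p}.
      1 / real J \<le> 1 - q (fst p) (snd p)"
  proof (intro eventually_ball_finite ballI ev')
    fix p assume p: "p \<in> {p \<in> {..<length cfg} \<times> {..<length cfg}. fst p \<noteq> snd p}"
    define x y where "x = v (fst p)" and "y = v (snd p)"
    have "\<not> collinear {0, x, y}" "x \<noteq> 0" "y \<noteq> 0" using p nc nz by (auto simp: x_def y_def v_def)
    then have "\<bar>x \<bullet> y\<bar> < norm x * norm y"
      using norm_cauchy_schwarz_equal[of x y] Cauchy_Schwarz_ineq2[of x y] by linarith
    then show "0 < 1 - q (fst p) (snd p)"
      using \<open>x \<noteq> 0\<close> \<open>y \<noteq> 0\<close> unfolding q_def x_def[symmetric] y_def[symmetric] by (simp add: divide_less_eq)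
  qed auto
  ultimately have "\<forall>\<^sub>F J in sequentially. (\<forall>i\<in>{..<a}. \<bar>\<theta> i\<bar> \<le> real J) \<and>
      (\<forall>w\<in>{..<length cfg}. 1 / real J \<le> norm (v w)) \<and>
      (\<forall>p\<in>{p \<in> {..<length cfg} \<times> {..<length cfg}. fst p \<noteq> snd p}. 1 / real J \<le> 1 - q (fst p) (snd p)) \<and> J \<ge> 1"
    using eventually_ge_at_top[of 1] by eventually_elim blast
  then obtain J where J: "\<And>i. i < a \<Longrightarrow> \<bar>\<theta> i\<bar> \<le> real J" "\<And>w. w < length cfg \<Longrightarrow> 1 / real J \<le> norm (v w)"
    "\<And>w w'. w < length cfg \<Longrightarrow> w' < length cfg \<Longrightarrow> w \<noteq> w' \<Longrightarrow> 1 / real J \<le> 1 - q w w'" "J \<ge> 1"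
    unfolding eventually_sequentially by fastforce
  have "\<bar>v w \<bullet> v w'\<bar> \<le> (1 - 1 / real J) * (norm (v w) * norm (v w'))"
    if "w < length cfg" "w' < length cfg" "w \<noteq> w'" for w w'
  proof -
    have "norm (v w) * norm (v w') > 0" using nz that by (simp add: v_def)
    moreover have "\<bar>v w \<bullet> v w'\<bar> / (norm (v w) * norm (v w')) \<le> 1 - 1 / real J"
      using J(3)[OF that] by (simp add: q_def)
    ultimately show ?thesis by (simp add: pos_divide_le_eq)
  qed
  then have "degenerate a cfg J N"
    unfolding degenerate_def config_realized_def using J a len
    by (intro conjI exI[of _ \<theta>]) (auto simp: v_def)
  then show False using T by (simp add: typical_def)
qed

section \<open>The number of directions of a planar set\<close>

lemma noncritical_between:
  fixes s t :: real
  assumes "finite A" "s < t"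
  obtains m where "s < m" "m < t" "m \<notin> A"
proof -
  have "infinite ({s<..<t} - A)"
    using assms by (simp add: infinite_Ioo)
  then obtain m where "m \<in> {s<..<t} - A"
    by (metis finite.emptyI ex_in_conv)
  then show ?thesis using that by auto
qed

text \<open>
  Ungar's proof sweeps the plane by lines of increasing slope. At slope \<open>m\<close> the points are ordered by
  \<open>sweep m\<close>; this order changes only when \<open>m\<close> passes a slope of the set, and then each maximal set of points on
  a line of this slope, which occupies consecutive ranks, is reversed. Of interest are the slopes
  at which points cross the barrier between the lower \<open>k\<close> and the upper \<open>k\<close> ranks.
\<close>

locale planar_points =
  fixes P :: "'a set" and X Y :: "'a \<Rightarrow> real" and k :: nat
  assumes fin: "finite P" and inj: "inj_on X P" and card_P: "card P = 2 * k"
begin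

definition slope :: "'a \<Rightarrow> 'a \<Rightarrow> real" where
  "slope p q = (Y q - Y p) / (X q - X p)"

definition slopes :: "real set" where
  "slopes = {slope p q | p q. p \<in> P \<and> q \<in> P \<and> p \<noteq> q}"

definition sweep :: "real \<Rightarrow> 'a \<Rightarrow> real" where
  "sweep m p = Y p - m * X p"

definition rank :: "real \<Rightarrow> 'a \<Rightarrow> nat" where
  "rank m p = card {q \<in> P. sweep m q < sweep m p}"

text \<open>
  The \<open>2 j\<close> points of middle rank at slope \<open>m\<close> lie on the line \<open>sweep c = v\<close>, whose slope is \<open>c\<close>.
\<close>

definition mid :: "real \<Rightarrow> nat \<Rightarrow> real \<Rightarrow> real \<Rightarrow> bool" where
  "mid m j c v \<longleftrightarrow> (\<forall>p\<in>P. k \<le> rank m p + j \<and> rank m p < k + j \<longrightarrow> sweep c p = v)"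

text \<open>
  A deep line reaches at least \<open>d\<close> ranks to both sides of the barrier. The definition treats both sides
  alike, so that it survives a reversal of the order.
\<close>

definition deep :: "nat \<Rightarrow> real \<Rightarrow> real \<Rightarrow> bool" where
  "deep d c v \<longleftrightarrow> card {p \<in> P. sweep c p < v} + d \<le> k \<and> card {p \<in> P. v < sweep c p} + d \<le> k"

lemma finite_slopes: "finite slopes"
proof -
  have "slopes \<subseteq> (\<lambda>(p, q). slope p q) ` (P \<times> P)" by (auto simp: slopes_def)
  then show ?thesis using fin by (meson finite_SigmaI finite_imageI finite_subset)
qed

lemma sweep_eq_iff:
  assumes "p \<in> P" "q \<in> P" "p \<noteq> q"
  shows "sweep m p = sweep m q \<longleftrightarrow> m = slope p q"
proof -
  have "X q - X p \<noteq> 0" using assms inj by (auto simp: inj_on_def)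
  then show ?thesis by (auto simp: sweep_def slope_def field_simps)
qed

lemma inj_on_sweep:
  assumes "m \<notin> slopes" shows "inj_on (sweep m) P"
proof (rule inj_onI, rule ccontr)
  fix p q assume "p \<in> P" "q \<in> P" "sweep m p = sweep m q" "p \<noteq> q"
  then show False using assms sweep_eq_iff[of p q m] by (auto simp: slopes_def)
qed

lemma sweep_less_stable:
  assumes p: "p \<in> P" and q: "q \<in> P" and less: "sweep m p < sweep m q"
    and no: "\<And>t. t \<in> slopes \<Longrightarrow> \<not> (m < t \<and> t \<le> m') \<and> \<not> (m' \<le> t \<and> t < m)"
  shows "sweep m' p < sweep m' q"
proof (rule ccontr)
  assume *: "\<not> sweep m' p < sweep m' q"
  define A B where "A = Y q - Y p" and "B = X q - X p"
  have pq: "p \<noteq> q" using less by auto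
  have B: "B \<noteq> 0" using p q pq inj by (auto simp: inj_on_def B_def)
  have 1: "A - m * B > 0" and 2: "A - m' * B \<le> 0"
    using less * by (auto simp: sweep_def A_def B_def algebra_simps)
  have s: "A / B \<in> slopes" using p q pq by (auto simp: slopes_def slope_def A_def B_def)
  show False
  proof (cases "B > 0")
    case True
    then have "m < A / B" "A / B \<le> m'" using 1 2 by (auto simp: field_simps)
    then show False using no[OF s] by auto
  next
    case False
    then have "A / B < m" "m' \<le> A / B" using 1 2 B by (auto simp: field_simps)
    then show False using no[OF s] by auto
  qed
qed

lemma rank_less_iff:
  assumes "p \<in> P" "q \<in> P"
  shows "rank m p < rank m q \<longleftrightarrow> sweep m p < sweep m q"
proof -
  have *: "rank m p < rank m q" if "p \<in> P" "sweep m p < sweep m q" for p q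
    unfolding rank_def using that fin by (intro psubset_card_mono) auto
  have "rank m q \<le> rank m p" if "sweep m q \<le> sweep m p"
    unfolding rank_def using that fin by (intro card_mono) auto
  then show ?thesis using * assms by fastforce
qed

lemma rank_bij:
  assumes "m \<notin> slopes"
  shows "bij_betw (rank m) P {0..<2 * k}"
proof -
  have inj: "inj_on (rank m) P"
  proof (rule inj_onI)
    fix p q assume pq: "p \<in> P" "q \<in> P" "rank m p = rank m q"
    then have "sweep m p = sweep m q"
      using rank_less_iff[of p q m] rank_less_iff[of q p m] by force
    then show "p = q" using inj_on_sweep[OF assms] pq by (auto simp: inj_on_def)
  qed
  have "rank m p < 2 * k" if "p \<in> P" for p
    unfolding rank_def card_P[symmetric] using that fin by (intro psubset_card_mono) auto
  then have "rank m ` P \<subseteq> {0..<2 * k}" by auto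
  moreover have "card (rank m ` P) = card {0..<2 * k}"
    using inj card_P by (simp add: card_image)
  ultimately have "rank m ` P = {0..<2 * k}" by (simp add: card_subset_eq)
  then show ?thesis using inj by (simp add: bij_betw_def)
qed

lemma rank_stable:
  assumes "m \<notin> slopes" "m' \<notin> slopes" "slopes \<inter> {min m m'..max m m'} = {}" "p \<in> P"
  shows "rank m p = rank m' p"
proof -
  have "sweep m q < sweep m p \<longleftrightarrow> sweep m' q < sweep m' p" if "q \<in> P" for q
    using sweep_less_stable[of q p m m'] sweep_less_stable[of q p m' m] that assms
    by (fastforce simp: min_def max_def split: if_splits)
  then show ?thesis unfolding rank_def by (metis (lifting) Collect_cong)
qed

lemma rank_on_class:
  assumes p: "p \<in> P" and m: "m \<notin> slopes" and s: "s \<in> slopes"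
    and no: "slopes \<inter> {min m s..max m s} = {s}"
  defines "E \<equiv> {q \<in> P. sweep s q = sweep s p}"
  defines "a \<equiv> card {q \<in> P. sweep s q < sweep s p}"
  shows "rank m ` E = {a..<a + card E}"
proof -
  have st: "sweep m q < sweep m r" if "q \<in> P" "r \<in> P" "sweep s q < sweep s r" for q r
  proof (rule sweep_less_stable[OF that])
    fix t assume t: "t \<in> slopes"
    have "t \<in> {min m s..max m s} \<Longrightarrow> t = s" using no t by blast
    then show "\<not> (s < t \<and> t \<le> m) \<and> \<not> (m \<le> t \<and> t < s)" by auto
  qed
  have E: "finite E" "E \<subseteq> P" using fin by (auto simp: E_def)
  have "rank m q \<in> {a..<a + card E}" if q: "q \<in> E" for q
  proof -
    have "{r \<in> P. sweep s r < sweep s p} \<subseteq> {r \<in> P. sweep m r < sweep m q}"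
      using st q by (auto simp: E_def)
    then have 1: "a \<le> rank m q" unfolding a_def rank_def using fin by (intro card_mono) auto
    have "{r \<in> P. sweep m r < sweep m q} \<subset> {r \<in> P. sweep s r < sweep s p} \<union> E"
      using st q by (fastforce simp: E_def)
    then have "rank m q < card ({r \<in> P. sweep s r < sweep s p} \<union> E)"
      unfolding rank_def using fin E by (intro psubset_card_mono) auto
    also have "\<dots> \<le> a + card E" unfolding a_def by (rule card_Un_le)
    finally show ?thesis using 1 by simp
  qed
  then have "rank m ` E \<subseteq> {a..<a + card E}" by auto
  moreover have "card (rank m ` E) = card {a..<a + card E}"
    using card_image[of "rank m" E] rank_bij[OF m] E(2) by (auto simp: bij_betw_def inj_on_subset)
  ultimately show ?thesis by (simp add: card_subset_eq)
qed

lemma mid_mono: "mid m j c v \<Longrightarrow> i \<le> j \<Longrightarrow> mid m i c v"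
  by (simp add: mid_def)

text \<open>
  A line of another slope \<open>s\<close> meets the line \<open>sweep c = v\<close> in at most one point. So a set of at
  least two points that is reversed at \<open>s\<close> cannot occupy two of the middle \<open>2 j\<close> ranks, and the ranks
  strictly inside that range are untouched: the range shrinks by at most one on either side.
\<close>

lemma mid_step:
  assumes m: "m \<notin> slopes" "m' \<notin> slopes" and s: "s \<in> slopes"
    and no: "slopes \<inter> {min m m'..max m m'} = {s}" and sc: "s \<noteq> c"
    and mid: "mid m j c v"
  shows "mid m' (j - 1) c v"
  unfolding mid_def
proof (intro ballI impI)
  fix p assume p: "p \<in> P" and r: "k \<le> rank m' p + (j - 1) \<and> rank m' p < k + (j - 1)"
  define E where "E = {q \<in> P. sweep s q = sweep s p}"
  define a where "a = card {q \<in> P. sweep s q < sweep s p}"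
  have sm: "min m m' \<le> s" "s \<le> max m m'" using no by auto
  have sub: "slopes \<inter> {min m s..max m s} = {s}" "slopes \<inter> {min m' s..max m' s} = {s}"
  proof -
    have "min m m' \<le> min m s" "max m s \<le> max m m'" "min m m' \<le> min m' s" "max m' s \<le> max m m'"
      using sm by auto
    then have "slopes \<inter> {min m s..max m s} \<subseteq> {s}" "slopes \<inter> {min m' s..max m' s} \<subseteq> {s}"
      unfolding no[symmetric] by auto
    then show "slopes \<inter> {min m s..max m s} = {s}" "slopes \<inter> {min m' s..max m' s} = {s}"
      using s by auto
  qed
  have im: "rank m ` E = {a..<a + card E}" "rank m' ` E = {a..<a + card E}"
    unfolding E_def a_def using rank_on_class[OF p _ s] m sub by blast+
  have pE: "p \<in> E" using p by (simp add: E_def)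
  have fE: "finite E" using fin by (simp add: E_def)
  show "sweep c p = v"
  proof (cases "card E = 1")
    case True
    then have "E = {p}" using pE by (auto simp: card_1_singleton_iff)
    then have "rank m p = rank m' p" using im True by auto
    then show ?thesis using mid r p unfolding mid_def by auto
  next
    case False
    then have "card E \<ge> 2" using pE fE by (metis One_nat_def Suc_1 Suc_leI card_gt_0_iff empty_iff le_neq_implies_less)
    moreover have pi: "rank m' p \<in> {a..<a + card E}" using im pE by blast
    ultimately obtain r' where r': "r' \<in> {a..<a + card E}" "r' \<noteq> rank m' p"
      "r' = rank m' p + 1 \<or> r' + 1 = rank m' p"
    proof (cases "rank m' p + 1 < a + card E")
      case True then show ?thesis using that[of "rank m' p + 1"] pi by auto
    next
      case False
      then have "rank m' p + 1 = a + card E" using pi by auto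
      then have "rank m' p \<ge> a + 1" using \<open>card E \<ge> 2\<close> by linarith
      then have "rank m' p - 1 \<in> {a..<a + card E}" "rank m' p - 1 \<noteq> rank m' p"
        "rank m' p - 1 + 1 = rank m' p" using pi by auto
      then show ?thesis using that by blast
    qed
    obtain q q' where q: "q \<in> E" "rank m q = rank m' p" "q' \<in> E" "rank m q' = r'"
      using im(1) pi r'(1) by (metis (no_types, lifting) imageE)
    have "q \<noteq> q'" using q r' by auto
    have "q \<in> P" "q' \<in> P" using q by (auto simp: E_def)
    have "sweep c q = v" "sweep c q' = v"
      using mid \<open>q \<in> P\<close> \<open>q' \<in> P\<close> q r r' unfolding mid_def by auto
    moreover have "sweep s q = sweep s q'" using q by (auto simp: E_def)
    ultimately have "s = c" using sweep_eq_iff[OF \<open>q \<in> P\<close> \<open>q' \<in> P\<close> \<open>q \<noteq> q'\<close>] by metis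
    then show ?thesis using sc by simp
  qed
qed

text \<open>
  Reduces statements about two non-critical slopes in either order, which compose along intermediate
  ones, to pairs that are separated by at most one slope of the set.
\<close>

lemma noncritical_induct [consumes 2, case_names none one split]:
  assumes m: "m \<notin> slopes" "m' \<notin> slopes"
    and none: "\<And>m m'. m \<notin> slopes \<Longrightarrow> m' \<notin> slopes \<Longrightarrow> slopes \<inter> {min m m'..max m m'} = {} \<Longrightarrow> Q m m'"
    and one: "\<And>m m' s. m \<notin> slopes \<Longrightarrow> m' \<notin> slopes \<Longrightarrow> slopes \<inter> {min m m'..max m m'} = {s} \<Longrightarrow> Q m m'"
    and split: "\<And>m n m'. n \<notin> slopes \<Longrightarrow> min m m' < n \<Longrightarrow> n < max m m' \<Longrightarrow> Q m n \<Longrightarrow> Q n m' \<Longrightarrow> Q m m'"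
  shows "Q m m'"
  using m
proof (induction "card (slopes \<inter> {min m m'..max m m'})" arbitrary: m m' rule: less_induct)
  case less
  define S where "S m m' = slopes \<inter> {min m m'..max m m'}" for m m'
  have fS: "finite (S m m')" for m m' using finite_slopes by (simp add: S_def)
  consider "S m m' = {}" | s where "S m m' = {s}" | s t where "s \<in> S m m'" "t \<in> S m m'" "s < t"
    by (metis insertI1 insert_absorb is_singletonI' is_singleton_def linorder_less_linear)
  then show ?case
  proof cases
    case 1 then show ?thesis using none less.prems by (simp add: S_def)
  next
    case 2 then show ?thesis using one less.prems by (simp add: S_def)
  next
    case (3 s t)
    obtain n where n: "s < n" "n < t" "n \<notin> slopes"
      using noncritical_between[OF finite_slopes \<open>s < t\<close>] by blast
    have st: "min m m' \<le> s" "t \<le> max m m'" "s \<in> slopes" "t \<in> slopes" using 3 by (auto simp: S_def)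
    have *: "min m m' < n" "n < max m m'" using st n by auto
    have "S m n \<subset> S m m' \<and> S n m' \<subset> S m m'"
    proof (cases "m \<le> m'")
      case True
      then have "S m n \<subseteq> S m m'" "S n m' \<subseteq> S m m'" "t \<notin> S m n" "s \<notin> S n m'"
        using st n by (auto simp: S_def)
      then show ?thesis using 3 by blast
    next
      case False
      then have "S m n \<subseteq> S m m'" "S n m' \<subseteq> S m m'" "s \<notin> S m n" "t \<notin> S n m'"
        using st n by (auto simp: S_def)
      then show ?thesis using 3 by blast
    qed
    then have "card (S m n) < card (S m m')" "card (S n m') < card (S m m')"
      using fS by (auto intro: psubset_card_mono)
    then show ?thesis
      using split[of n m m'] less.hyps[of m n] less.hyps[of n m'] less.prems n * by (simp add: S_def)
  qed
qed

lemma mid_persists: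
  assumes m: "m \<notin> slopes" "m' \<notin> slopes" and c: "c \<notin> {min m m'..max m m'}" and mid: "mid m j c v"
  shows "mid m' (j - card (slopes \<inter> {min m m'..max m m'})) c v"
  using m c mid
proof (induction arbitrary: j rule: noncritical_induct)
  case (none m m')
  then show ?case using rank_stable[OF none(1,2,3)] by (simp add: mid_def)
next
  case (one m m' s)
  then have "s \<in> {min m m'..max m m'}" "s \<in> slopes" by blast+
  then show ?case using mid_step[of m m' s c j v] one by auto
next
  case (split m n m')
  define S where "S m m' = slopes \<inter> {min m m'..max m m'}" for m m'
  have "S m m' = S m n \<union> S n m'" "S m n \<inter> S n m' = {}"
    using split(1-3) unfolding S_def by (cases "m \<le> m'"; fastforce simp: min_def max_def)+
  then have card: "card (S m m') = card (S m n) + card (S n m')"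
    using finite_slopes by (metis S_def card_Un_disjoint finite_Int)
  have "c \<notin> {min m n..max m n}" "c \<notin> {min n m'..max n m'}"
    using split(2,3) split(6) by (cases "m \<le> m'"; fastforce simp: min_def max_def)+
  then have "mid m' (j - card (S m n) - card (S n m')) c v"
    using split(4,5)[unfolded S_def[symmetric]] split(7) by blast
  then show ?case using card by (simp add: S_def)
qed

lemma deep_imp_mid:
  assumes m: "m \<notin> slopes" and no: "slopes \<inter> {min m c..max m c} \<subseteq> {c}" and deep: "deep d c v"
  shows "mid m d c v"
  unfolding mid_def
proof (intro ballI impI)
  fix p assume p: "p \<in> P" and r: "k \<le> rank m p + d \<and> rank m p < k + d"
  have st: "sweep m q < sweep m r" if "q \<in> P" "r \<in> P" "sweep c q < sweep c r" for q r
  proof (rule sweep_less_stable[OF that])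
    fix t assume t: "t \<in> slopes"
    have "t \<in> {min m c..max m c} \<Longrightarrow> t = c" using no t by blast
    then show "\<not> (c < t \<and> t \<le> m) \<and> \<not> (m \<le> t \<and> t < c)" by auto
  qed
  show "sweep c p = v"
  proof (rule ccontr)
    assume "sweep c p \<noteq> v"
    then consider "sweep c p < v" | "v < sweep c p" by linarith
    then show False
    proof cases
      case 1
      have "{q \<in> P. sweep m q < sweep m p} \<subset> {q \<in> P. sweep c q < v}"
        using st p 1 by (fastforce)
      then have "rank m p < card {q \<in> P. sweep c q < v}"
        unfolding rank_def using fin by (intro psubset_card_mono) auto
      then show False using deep r by (simp add: deep_def)
    next
      case 2
      have "P - {q \<in> P. v < sweep c q} \<subseteq> {q \<in> P. sweep m q < sweep m p}"
        using st p 2 by fastforce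
      then have "card (P - {q \<in> P. v < sweep c q}) \<le> rank m p"
        unfolding rank_def using fin by (intro card_mono) auto
      moreover have "card (P - {q \<in> P. v < sweep c q}) = 2 * k - card {q \<in> P. v < sweep c q}"
        using fin card_P by (subst card_Diff_subset) auto
      ultimately show False using deep r unfolding deep_def by linarith
    qed
  qed
qed

lemma noncritical_at:
  assumes "c < c'" and "i \<le> card (slopes \<inter> {c<..<c'})"
  obtains m where "c < m" "m < c'" "m \<notin> slopes" "card (slopes \<inter> {c<..<m}) = i"
proof -
  have "\<exists>m. c < m \<and> m < c' \<and> m \<notin> slopes \<and> card (slopes \<inter> {c<..<m}) = i"
    using assms(2)
  proof (induction i)
    case 0
    define b where "b = Min (insert c' (slopes \<inter> {c<..<c'}))"
    have b: "b \<in> insert c' (slopes \<inter> {c<..<c'})" "\<And>s. s \<in> slopes \<inter> {c<..<c'} \<Longrightarrow> b \<le> s"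
      unfolding b_def by (rule Min_in, simp_all add: finite_slopes)
    then have "c < b" "b \<le> c'" using assms(1) by auto
    then obtain m where m: "c < m" "m < b" "m \<notin> slopes"
      using noncritical_between[OF finite_slopes] by blast
    then have "slopes \<inter> {c<..<m} = {}" using b(2) \<open>b \<le> c'\<close> by fastforce
    then show ?case using m \<open>b \<le> c'\<close> by (intro exI[of _ m]) simp
  next
    case (Suc i)
    then obtain m where m: "c < m" "m < c'" "m \<notin> slopes" "card (slopes \<inter> {c<..<m}) = i" by auto
    have ne: "slopes \<inter> {m<..<c'} \<noteq> {}"
    proof
      assume "slopes \<inter> {m<..<c'} = {}"
      then have "s < m" if "s \<in> slopes" "s < c'" for s
        using that m(3) by (metis Int_iff empty_iff greaterThanLessThan_iff linorder_neqE_linordered_idom)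
      then have "slopes \<inter> {c<..<c'} \<subseteq> slopes \<inter> {c<..<m}" by auto
      then have "card (slopes \<inter> {c<..<c'}) \<le> i" using m finite_slopes by (metis card_mono finite_Int)
      then show False using Suc.prems by simp
    qed
    define a where "a = Min (slopes \<inter> {m<..<c'})"
    have a: "a \<in> slopes \<inter> {m<..<c'}" "\<And>s. s \<in> slopes \<inter> {m<..<c'} \<Longrightarrow> a \<le> s"
      unfolding a_def using ne finite_slopes by (rule_tac Min_in, simp_all)
    define b where "b = Min (insert c' (slopes \<inter> {a<..<c'}))"
    have b: "b \<in> insert c' (slopes \<inter> {a<..<c'})" "\<And>s. s \<in> slopes \<inter> {a<..<c'} \<Longrightarrow> b \<le> s"
      unfolding b_def by (rule Min_in, simp_all add: finite_slopes)
    then have "a < b" "b \<le> c'" using a by auto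
    then obtain m' where m': "a < m'" "m' < b" "m' \<notin> slopes"
      using noncritical_between[OF finite_slopes] by blast
    have "slopes \<inter> {c<..<m'} = insert a (slopes \<inter> {c<..<m})"
    proof (intro set_eqI iffI)
      fix s assume s: "s \<in> slopes \<inter> {c<..<m'}"
      show "s \<in> insert a (slopes \<inter> {c<..<m})"
      proof (cases "s < m")
        case False
        then have "s > m" using s m by (metis IntD1 linorder_neqE_linordered_idom)
        then have "s \<in> slopes \<inter> {m<..<c'}" using s m' \<open>b \<le> c'\<close> by auto
        then have "a \<le> s" by (rule a(2))
        moreover have "\<not> a < s" using b(2)[of s] s m' \<open>b \<le> c'\<close> by auto
        ultimately show ?thesis by simp
      qed (use s in auto)
    qed (use a m m' in auto)
    moreover have "a \<notin> slopes \<inter> {c<..<m}" using a by auto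
    ultimately have "card (slopes \<inter> {c<..<m'}) = Suc i" using m finite_slopes by simp
    then show ?case using m' \<open>b \<le> c'\<close> a m by (intro exI[of _ m']) auto
  qed
  then show ?thesis using that by blast
qed

text \<open>
  After the slope \<open>c\<close> at least the middle \<open>2 (d - t)\<close> points are on the first line when \<open>t\<close> slopes have
  been passed, and the same holds for the second line when sweeping backwards from \<open>c'\<close>. With too few
  slopes in between, there is a moment at which the two middle points are on both lines.
\<close>

lemma slopes_between_deep_lines:
  assumes cc: "c < c'" and deep: "deep d c v" "deep d' c' v'" and d: "d \<ge> 1" "d' \<ge> 1"
  shows "d + d' \<le> card (slopes \<inter> {c<..<c'}) + 1"
proof (rule ccontr)
  assume *: "\<not> ?thesis"
  define t where "t = card (slopes \<inter> {c<..<c'})"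
  have t: "t + 2 \<le> d + d'" using * by (simp add: t_def)
  \<comment> \<open>At this many slopes after \<open>c\<close>, both lines still contain the two middle points.\<close>
  define i where "i = min t (d - 1)"
  have "i \<le> t" by (simp add: i_def)
  then obtain m where m: "c < m" "m < c'" "m \<notin> slopes" "card (slopes \<inter> {c<..<m}) = i"
    using noncritical_at[OF cc] unfolding t_def by blast
  have "slopes \<inter> {c<..<c'} = (slopes \<inter> {c<..<m}) \<union> (slopes \<inter> {m<..<c'})"
    using m by (auto simp: not_less order_less_le)
  moreover have "(slopes \<inter> {c<..<m}) \<inter> (slopes \<inter> {m<..<c'}) = {}" by auto
  ultimately have "card (slopes \<inter> {c<..<m}) + card (slopes \<inter> {m<..<c'}) = t"
    unfolding t_def using card_Un_disjoint[of "slopes \<inter> {c<..<m}" "slopes \<inter> {m<..<c'}"] finite_slopes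
    by auto
  then have cards: "card (slopes \<inter> {c<..<m}) \<le> d - 1" "card (slopes \<inter> {m<..<c'}) \<le> d' - 1"
    using m(4) t d by (auto simp: i_def min_def split: if_splits)
  have mid1: "mid m 1 c v"
  proof -
    obtain m0 where m0: "c < m0" "m0 < m" "m0 \<notin> slopes" "card (slopes \<inter> {c<..<m0}) = 0"
      using noncritical_at[OF m(1), of 0] by blast
    then have "slopes \<inter> {c<..<m0} = {}" using finite_slopes by simp
    then have "slopes \<inter> {min m0 c..max m0 c} \<subseteq> {c}"
      using m0 by (auto simp: min_def max_def order_le_less)
    then have "mid m0 d c v" using deep_imp_mid m0 deep by blast
    then have "mid m (d - card (slopes \<inter> {min m0 m..max m0 m})) c v"
      using mid_persists[of m0 m c d v] m0 m by auto
    moreover have "card (slopes \<inter> {min m0 m..max m0 m}) \<le> card (slopes \<inter> {c<..<m})"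
      using m m0 finite_slopes by (intro card_mono) (auto simp: min_def max_def order_le_less)
    then have "1 \<le> d - card (slopes \<inter> {min m0 m..max m0 m})" using cards d by linarith
    ultimately show ?thesis by (rule mid_mono)
  qed
  have mid2: "mid m 1 c' v'"
  proof -
    have "card (slopes \<inter> {m<..<c'}) \<le> card (slopes \<inter> {m<..<c'})" by simp
    then obtain m0 where m0: "m < m0" "m0 < c'" "m0 \<notin> slopes"
      "card (slopes \<inter> {m<..<m0}) = card (slopes \<inter> {m<..<c'})"
      using noncritical_at[OF m(2)] by blast
    have "slopes \<inter> {m<..<m0} = slopes \<inter> {m<..<c'}"
      using m0 finite_slopes by (intro card_subset_eq) auto
    then have "slopes \<inter> {min m0 c'..max m0 c'} \<subseteq> {c'}"
    proof -
      have "s = c'" if s: "s \<in> slopes" "m0 \<le> s" "s \<le> c'" for s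
      proof (rule ccontr)
        assume "s \<noteq> c'"
        then have "s \<in> slopes \<inter> {m<..<c'}" using s m0 by auto
        then have "s < m0" unfolding \<open>slopes \<inter> {m<..<m0} = slopes \<inter> {m<..<c'}\<close>[symmetric] by simp
        then show False using s by simp
      qed
      then show ?thesis using m0 by auto
    qed
    then have "mid m0 d' c' v'" using deep_imp_mid m0 deep by blast
    then have "mid m (d' - card (slopes \<inter> {min m0 m..max m0 m})) c' v'"
      using mid_persists[of m0 m c' d' v'] m0 m by auto
    moreover have "card (slopes \<inter> {min m0 m..max m0 m}) \<le> card (slopes \<inter> {m<..<c'})"
      using m m0 finite_slopes by (intro card_mono) (auto simp: min_def max_def order_le_less)
    then have "1 \<le> d' - card (slopes \<inter> {min m0 m..max m0 m})" using cards d by linarith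
    ultimately show ?thesis by (rule mid_mono)
  qed
  have "k \<ge> 1" using deep d by (auto simp: deep_def)
  then have "k - 1 \<in> rank m ` P" "k \<in> rank m ` P"
    using rank_bij[OF m(3)] by (auto simp: bij_betw_def)
  then obtain p q where pq: "p \<in> P" "q \<in> P" "rank m p = k - 1" "rank m q = k" by auto
  then have "p \<noteq> q" using \<open>k \<ge> 1\<close> by auto
  have "sweep c p = sweep c q" "sweep c' p = sweep c' q"
    using mid1 mid2 pq \<open>k \<ge> 1\<close> by (auto simp: mid_def)
  then show False using sweep_eq_iff[OF pq(1,2) \<open>p \<noteq> q\<close>] cc by force
qed

text \<open>
  The value is \<open>0\<close> exactly if no line of this slope reaches both sides of the barrier; such slopes involve no crossing of the barrier.
\<close>

definition depth :: "real \<Rightarrow> nat" where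
  "depth c = Max {d. d = 0 \<or> (\<exists>v. deep d c v)}"

lemma depth_set: "finite {d. d = 0 \<or> (\<exists>v. deep d c v)}"
  by (rule finite_subset[of _ "{..k}"]) (auto simp: deep_def)

lemma deep_depth: "depth c \<ge> 1 \<Longrightarrow> \<exists>v. deep (depth c) c v"
  using Max_in[OF depth_set[of c]] unfolding depth_def by force

lemma depth_ge: "deep d c v \<Longrightarrow> d \<le> depth c"
  unfolding depth_def using depth_set by (intro Max_ge) auto

definition lower :: "real \<Rightarrow> 'a set" where
  "lower m = {p \<in> P. rank m p < k}"

lemma lower_card: assumes "m \<notin> slopes" shows "card (lower m) = k" 
proof -
  have "bij_betw (rank m) (lower m) {0..<k}"
    unfolding bij_betw_def
  proof
    show "inj_on (rank m) (lower m)"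
      using rank_bij[OF assms] by (auto simp: bij_betw_def lower_def intro: inj_on_subset)
    have "rank m ` P = {0..<2 * k}" using rank_bij[OF assms] by (simp add: bij_betw_def)
    then show "rank m ` lower m = {0..<k}" unfolding lower_def by (auto simp: set_eq_iff image_iff) (metis mult_2 trans_less_add1)+
  qed
  then show ?thesis using bij_betw_same_card by fastforce
qed

lemma lower_closed: "p \<in> lower m \<Longrightarrow> q \<in> P \<Longrightarrow> sweep m q < sweep m p \<Longrightarrow> q \<in> lower m"
  using rank_less_iff[of q p m] by (auto simp: lower_def)

text \<open>
  Points that cross the barrier upwards and points that cross it downwards at \<open>s\<close> exchange their
  order, so they all lie on one line. As many points cross in each direction, and every point
  below this line stays in the lower half, every point above it in the upper half.
\<close>

lemma crossing_le_depth:
  assumes m: "m \<notin> slopes" "m' \<notin> slopes" and s: "slopes \<inter> {min m m'..max m m'} = {s}"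
  shows "card (lower m' - lower m) \<le> depth s"
proof (cases "card (lower m' - lower m) = 0")
  case False
  define d where "d = card (lower m' - lower m)"
  have fl: "finite (lower m)" for m using fin by (simp add: lower_def)
  have sub: "lower m \<subseteq> P" for m by (auto simp: lower_def)
  have d': "card (lower m - lower m') = d"
  proof -
    have "card (lower m - lower m') + card (lower m \<inter> lower m') = k"
      using card_Int_Diff[OF fl, of m "lower m'"] lower_card[OF m(1)] by simp
    moreover have "d + card (lower m \<inter> lower m') = k"
      using card_Int_Diff[OF fl, of m' "lower m"] lower_card[OF m(2)] by (simp add: d_def Int_commute)
    ultimately show ?thesis by simp
  qed
  have Int: "card (lower m \<inter> lower m') + d = k"
    using card_Int_Diff[OF fl, of m "lower m'"] lower_card[OF m(1)] d' by simp
  have "lower m' - lower m \<noteq> {}" "lower m - lower m' \<noteq> {}"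
    using False d' d_def by (metis card.empty)+
  then obtain p r where p: "p \<in> lower m'" "p \<notin> lower m" and r: "r \<in> lower m" "r \<notin> lower m'"
    by blast
  have pr: "p \<in> P" "r \<in> P" using p r sub by auto
  have st: "sweep n q < sweep n r" if "q \<in> P" "r \<in> P" "sweep s q < sweep s r" "n = m \<or> n = m'" for q r n
  proof (rule sweep_less_stable[OF that(1-3)])
    fix t assume t: "t \<in> slopes"
    have sm: "s \<in> {min m m'..max m m'}" using s by blast
    have "t \<in> {min m m'..max m m'} \<Longrightarrow> t = s" using s t by blast
    then show "\<not> (s < t \<and> t \<le> n) \<and> \<not> (n \<le> t \<and> t < s)"
      using sm that(4) by (auto simp: min_def max_def split: if_splits)
  qed
  define v where "v = sweep s p"
  have eq: "sweep s r = v"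
  proof -
    have "\<not> sweep m p < sweep m r" "\<not> sweep m' r < sweep m' p"
      using lower_closed p r pr by blast+
    then show ?thesis using st[OF pr] st[OF pr(2,1)] unfolding v_def by (metis linorder_neqE_linordered_idom)
  qed
  have "{q \<in> P. sweep s q < v} \<subseteq> lower m \<inter> lower m'"
    using st p r pr eq lower_closed unfolding v_def by fastforce
  then have "card {q \<in> P. sweep s q < v} + d \<le> k"
    using Int card_mono[of "lower m \<inter> lower m'"] fl by (metis add_le_mono1 finite_Int)
  moreover have "{q \<in> P. v < sweep s q} \<subseteq> P - (lower m \<union> lower m')"
    using st p r pr eq lower_closed unfolding v_def by fastforce
  then have "card {q \<in> P. v < sweep s q} \<le> card (P - (lower m \<union> lower m'))"
    using fin by (intro card_mono) auto
  moreover have "card (P - (lower m \<union> lower m')) = 2 * k - (k + d)"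
  proof -
    have "card (lower m \<union> lower m') = k + d"
      using card_Un_disjoint[of "lower m" "lower m' - lower m"] fl lower_card[OF m(1)]
      by (simp add: d_def)
    then show ?thesis using card_Diff_subset[of "lower m \<union> lower m'" P] sub fl card_P by simp
  qed
  ultimately have "deep d s v" using Int by (simp add: deep_def)
  then show ?thesis using depth_ge d_def by blast
qed simp

lemma lower_diff_le_sum_depth:
  assumes m: "m \<notin> slopes" "m' \<notin> slopes"
  shows "card (lower m' - lower m) \<le> (\<Sum>c\<in>slopes \<inter> {min m m'..max m m'}. depth c)"
  using m
proof (induction rule: noncritical_induct)
  case (none m m')
  then have "lower m = lower m'" using rank_stable[OF none] by (auto simp: lower_def)
  then show ?case by simp
next
  case (one m m' s)
  then show ?case using crossing_le_depth[OF one] by simp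
next
  case (split m n m')
  define S where "S m m' = slopes \<inter> {min m m'..max m m'}" for m m'
  have "S m m' = S m n \<union> S n m'" "S m n \<inter> S n m' = {}"
    using split(1-3) unfolding S_def by (cases "m \<le> m'"; fastforce simp: min_def max_def)+
  then have sum: "sum depth (S m m') = sum depth (S m n) + sum depth (S n m')"
    using finite_slopes by (metis S_def sum.union_disjoint finite_Int)
  have "lower m' - lower m \<subseteq> (lower m' - lower n) \<union> (lower n - lower m)" by auto
  then have "card (lower m' - lower m) \<le> card ((lower m' - lower n) \<union> (lower n - lower m))"
    using fin by (intro card_mono) (auto simp: lower_def)
  also have "\<dots> \<le> card (lower m' - lower n) + card (lower n - lower m)" by (rule card_Un_le)
  finally show ?case using split(4,5) sum unfolding S_def by simp
qed

text \<open>
  Over the whole sweep the order is reversed, so all \<open>k\<close> points of the lower half must cross the barrier.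
\<close>

lemma sum_depth_ge: "k \<le> (\<Sum>c\<in>slopes. depth c)"
proof -
  define B where "B = Max (insert 0 (abs ` slopes)) + 1"
  have B: "\<bar>s\<bar> < B" if "s \<in> slopes" for s
  proof -
    have "\<bar>s\<bar> \<le> Max (insert 0 (abs ` slopes))" using that finite_slopes by (intro Max_ge) auto
    then show ?thesis by (simp add: B_def)
  qed
  have "B > 0" unfolding B_def using finite_slopes by (smt (verit) Max_ge finite_imageI finite_insert insertI1)
  have nB: "B \<notin> slopes" "- B \<notin> slopes" using B by force+
  have rev: "sweep B q < sweep B p" if "p \<in> P" "q \<in> P" "sweep (- B) p < sweep (- B) q" for p q
  proof (rule ccontr)
    assume *: "\<not> sweep B q < sweep B p"
    have pq: "p \<noteq> q" using that by auto
    then have ne: "X q - X p \<noteq> 0" using that inj by (auto simp: inj_on_def)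
    have "slope p q \<in> slopes" using that pq by (auto simp: slopes_def)
    from B[OF this] have "\<bar>(Y q - Y p) / (X q - X p)\<bar> < B" by (simp add: slope_def)
    then have "\<bar>Y q - Y p\<bar> < B * \<bar>X q - X p\<bar>" using ne by (simp add: abs_divide field_simps)
    then show False using * that(3)
      by (cases "X q - X p > 0") (auto simp: sweep_def algebra_simps)
  qed
  have "lower B \<inter> lower (- B) = {}"
  proof (rule ccontr)
    assume "lower B \<inter> lower (- B) \<noteq> {}"
    then obtain p where p: "p \<in> P" "rank B p < k" "rank (- B) p < k" by (auto simp: lower_def)
    have "P - {p} \<subseteq> {q \<in> P. sweep B q < sweep B p} \<union> {q \<in> P. sweep (- B) q < sweep (- B) p}"
      using rev[of p] p inj_on_sweep[OF nB(2)] by (force simp: inj_on_def)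
    then have "card (P - {p}) \<le> card ({q \<in> P. sweep B q < sweep B p} \<union> {q \<in> P. sweep (- B) q < sweep (- B) p})"
      using fin by (intro card_mono) auto
    also have "\<dots> \<le> rank B p + rank (- B) p" unfolding rank_def by (rule card_Un_le)
    finally show False using p card_P fin by simp
  qed
  then have "k = card (lower B - lower (- B))"
    using lower_card[OF nB(1)] by (metis Diff_triv)
  also have "\<dots> \<le> (\<Sum>c\<in>slopes \<inter> {min (- B) B..max (- B) B}. depth c)"
    by (rule lower_diff_le_sum_depth[OF nB(2,1)])
  also have "\<dots> \<le> (\<Sum>c\<in>slopes. depth c)"
    using finite_slopes by (intro sum_mono2) auto
  finally show ?thesis .
qed

end

text \<open>
  Summing the gap estimates over consecutive elements of \<open>C\<close> counts every inner \<open>\<delta> c\<close> twice and the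
  two extreme ones once.
\<close>

lemma sum_le_card_of_gaps:
  fixes C S :: "real set" and \<delta> :: "real \<Rightarrow> nat"
  assumes "finite C" "C \<noteq> {}" "finite S" "C \<subseteq> S"
    and gap: "\<And>c c'. c \<in> C \<Longrightarrow> c' \<in> C \<Longrightarrow> c < c' \<Longrightarrow> \<delta> c + \<delta> c' \<le> card (S \<inter> {c<..<c'}) + 1"
  shows "2 * sum \<delta> C \<le> card (S \<inter> {Min C..<Max C}) + \<delta> (Min C) + \<delta> (Max C)"
  using assms(1,2,4) gap
proof (induction C rule: finite_linorder_max_induct)
  case (insert x C)
  show ?case
  proof (cases "C = {}")
    case False
    have IH: "2 * sum \<delta> C \<le> card (S \<inter> {Min C..<Max C}) + \<delta> (Min C) + \<delta> (Max C)"
    proof (rule insert.IH[OF False])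
      show "C \<subseteq> S" using insert.prems by blast
      show "\<delta> c + \<delta> c' \<le> card (S \<inter> {c<..<c'}) + 1" if "c \<in> C" "c' \<in> C" "c < c'" for c c'
        using insert.prems(3) that by blast
    qed
    define a c where "a = Min C" and "c = Max C"
    have c: "c \<in> C" "a \<in> C" "c < x" "a \<le> c" using False insert.hyps by (auto simp: c_def a_def)
    have Mx: "Max (insert x C) = x"
      using Max_insert[OF \<open>finite C\<close> False, of x] c(3) unfolding c_def[symmetric] by simp
    have Mn: "Min (insert x C) = a"
      using Min_insert[OF \<open>finite C\<close> False, of x] c(3,4) unfolding a_def[symmetric] by simp
    have "S \<inter> {a..<x} = (S \<inter> {a..<c}) \<union> insert c (S \<inter> {c<..<x})"
      using c insert.prems(2) by auto
    then have "card (S \<inter> {a..<x}) = card (S \<inter> {a..<c}) + card (insert c (S \<inter> {c<..<x}))"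
      using \<open>finite S\<close> by (simp only:) (rule card_Un_disjoint, auto)
    also have "card (insert c (S \<inter> {c<..<x})) = card (S \<inter> {c<..<x}) + 1"
      using \<open>finite S\<close> by simp
    finally have "card (S \<inter> {a..<x}) \<ge> card (S \<inter> {a..<c}) + \<delta> c + \<delta> x"
      using insert.prems(3)[of c x] c by simp
    moreover have "sum \<delta> (insert x C) = \<delta> x + sum \<delta> C" using insert.hyps by auto
    ultimately show ?thesis using IH unfolding Mx Mn a_def[symmetric] c_def[symmetric] by simp
  qed simp
qed simp

context planar_points
begin

text \<open>
  The gaps between consecutive crossing slopes account for all but the gap that leads from the last
  crossing slope through infinity to the first. This gap is of the same kind: a linear map that turns
  some intermediate direction into the vertical one makes it a gap between two finite slopes. If there is
  only one crossing slope, then all points must cross at once and they are collinear.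
\<close>

theorem ungar:
  assumes two: "card slopes \<ge> 2"
  shows "2 * k \<le> card slopes"
proof (cases "k = 0")
  case False
  define C where "C = {c \<in> slopes. depth c \<ge> 1}"
  have finC: "finite C" "C \<subseteq> slopes" using finite_slopes by (auto simp: C_def)
  have sumC: "k \<le> sum depth C"
  proof -
    have "sum depth C = sum depth slopes"
      unfolding C_def using finite_slopes by (intro sum.mono_neutral_left) auto
    then show ?thesis using sum_depth_ge by simp
  qed
  then have "C \<noteq> {}" using False by auto
  have gap: "depth c + depth c' \<le> card (slopes \<inter> {c<..<c'}) + 1" if "c \<in> C" "c' \<in> C" "c < c'" for c c'
  proof -
    have d: "depth c \<ge> 1" "depth c' \<ge> 1" using that by (auto simp: C_def)
    obtain v v' where "deep (depth c) c v" "deep (depth c') c' v'" using deep_depth d by meson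
    then show ?thesis using slopes_between_deep_lines[OF that(3)] d by simp
  qed
  define a b where "a = Min C" and "b = Max C"
  have ab: "a \<in> C" "b \<in> C" "a \<le> b" using finC \<open>C \<noteq> {}\<close> by (auto simp: a_def b_def)
  have main: "2 * sum depth C \<le> card (slopes \<inter> {a..<b}) + depth a + depth b"
    unfolding a_def b_def by (rule sum_le_card_of_gaps[OF finC(1) \<open>C \<noteq> {}\<close> finite_slopes finC(2) gap])
  show ?thesis
  proof (cases "a = b")
    case True
    have "c = a" if "c \<in> C" for c
      using Min_le[OF finC(1) that] Max_ge[OF finC(1) that] True unfolding a_def b_def by simp
    then have "C = {a}" using ab by blast
    then have "k \<le> depth a" using sumC by simp
    obtain v where "deep (depth a) a v" using deep_depth ab by (auto simp: C_def)
    then have "card {p \<in> P. sweep a p < v} = 0" "card {p \<in> P. v < sweep a p} = 0"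
      using \<open>k \<le> depth a\<close> by (auto simp: deep_def)
    then have "\<forall>p\<in>P. sweep a p = v" using fin by (auto simp: not_less intro: antisym)
    then have "slopes \<subseteq> {a}" using sweep_eq_iff[of _ _ a] unfolding slopes_def by auto
    then have "card slopes \<le> 1" using card_mono[of "{a}" slopes] by simp
    then show ?thesis using two by simp
  next
    case False
    then have "a < b" using ab by simp
    then obtain \<mu> where \<mu>: "a < \<mu>" "\<mu> < b" "\<mu> \<notin> slopes"
      using noncritical_between[OF finite_slopes] by blast
    have "inj_on (\<lambda>p. Y p - \<mu> * X p) P"
      using inj_on_sweep[OF \<mu>(3)] unfolding inj_on_def sweep_def .
    then interpret T: planar_points P "\<lambda>p. Y p - \<mu> * X p" "\<lambda>p. - X p" k
      by unfold_locales (auto simp: fin card_P)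
    \<comment> \<open>The action of the coordinate change on slopes; it is increasing on both sides of \<open>\<mu>\<close>.\<close>
    define f where "f s = - 1 / (s - \<mu>)" for s
    have slopes_T: "T.slopes \<subseteq> f ` slopes"
    proof
      fix t assume "t \<in> T.slopes"
      then obtain p q where pq: "p \<in> P" "q \<in> P" "p \<noteq> q" "t = T.slope p q" by (auto simp: T.slopes_def)
      have s: "slope p q \<in> slopes" using pq by (auto simp: slopes_def)
      have ne: "X q - X p \<noteq> 0" using pq inj by (auto simp: inj_on_def)
      have "slope p q - \<mu> = ((Y q - \<mu> * X q) - (Y p - \<mu> * X p)) / (X q - X p)"
        using ne by (simp add: slope_def field_simps)
      then have "f (slope p q) = t" unfolding pq(4) T.slope_def f_def by (simp add: minus_divide_left)
      then show "t \<in> f ` slopes" using s by blast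
    qed
    have sweep_T: "T.sweep (f c) p = sweep c p / (c - \<mu>)" if "c \<noteq> \<mu>" for c p
      using that by (simp add: T.sweep_def sweep_def f_def field_simps)
    have deep_T: "T.deep d (f c) (v / (c - \<mu>))" if "deep d c v" "c \<noteq> \<mu>" for d c v
    proof (cases "c > \<mu>")
      case True
      then have "T.sweep (f c) p < v / (c - \<mu>) \<longleftrightarrow> sweep c p < v"
        "v / (c - \<mu>) < T.sweep (f c) p \<longleftrightarrow> v < sweep c p" for p
        by (auto simp: sweep_T divide_less_cancel)
      then show ?thesis using that by (simp add: T.deep_def deep_def)
    next
      case False
      then have "T.sweep (f c) p < v / (c - \<mu>) \<longleftrightarrow> v < sweep c p"
        "v / (c - \<mu>) < T.sweep (f c) p \<longleftrightarrow> sweep c p < v" for p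
        using that by (auto simp: sweep_T divide_less_cancel)
      then show ?thesis using that by (simp add: T.deep_def deep_def)
    qed
    obtain va vb where v: "deep (depth a) a va" "deep (depth b) b vb"
      using deep_depth ab by (force simp: C_def)
    have "f b < 0" "0 < f a" using \<mu> by (auto simp: f_def field_simps)
    then have "depth b + depth a \<le> card (T.slopes \<inter> {f b<..<f a}) + 1"
      using T.slopes_between_deep_lines[OF _ deep_T[OF v(2)] deep_T[OF v(1)]] \<mu> ab
      by (auto simp: C_def)
    moreover have "T.slopes \<inter> {f b<..<f a} \<subseteq> f ` (slopes - {a..b})"
    proof
      fix t assume t: "t \<in> T.slopes \<inter> {f b<..<f a}"
      then obtain s where s: "s \<in> slopes" "t = f s" using slopes_T by auto
      then have fs: "f b < f s" "f s < f a" using t by auto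
      have "s \<noteq> \<mu>" using s \<mu> by auto
      have "s \<notin> {a..b}"
      proof
        assume "s \<in> {a..b}"
        show False
        proof (cases "s > \<mu>")
          case True
          then have "f s \<le> f b" using \<open>s \<in> {a..b}\<close> \<mu> by (auto simp: f_def field_simps)
          then show False using fs by simp
        next
          case False
          then have "f a \<le> f s" using \<open>s \<in> {a..b}\<close> \<mu> \<open>s \<noteq> \<mu>\<close> by (auto simp: f_def divide_simps)
          then show False using fs by simp
        qed
      qed
      then show "t \<in> f ` (slopes - {a..b})" using s by auto
    qed
    then have "card (T.slopes \<inter> {f b<..<f a}) \<le> card (slopes - {a..b})"
      using finite_slopes by (meson finite_Diff finite_imageI surj_card_le)
    moreover have "card slopes = card (slopes \<inter> {a..<b}) + card (slopes - {a..b}) + 1"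
    proof -
      have "slopes = (slopes \<inter> {a..<b}) \<union> insert b (slopes - {a..b})" using ab finC by auto
      then have "card slopes = card (slopes \<inter> {a..<b}) + card (insert b (slopes - {a..b}))"
        using finite_slopes by (subst card_Un_disjoint[symmetric]) auto
      then show ?thesis using finite_slopes ab by simp
    qed
    ultimately show ?thesis using main sumC by simp
  qed
qed simp

end

section \<open>Directions in higher dimension\<close>

lemma generic_functional:
  fixes T :: "'a::euclidean_space set"
  assumes "finite T" "0 \<notin> T"
  obtains x where "\<And>v. v \<in> T \<Longrightarrow> x \<bullet> v \<noteq> 0"
proof -
  have "negligible {x. v \<bullet> x = 0}" if "v \<in> T" for v
    using that assms by (intro negligible_hyperplane) auto
  then have "negligible (\<Union>v\<in>T. {x. v \<bullet> x = 0})"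
    using assms by (intro negligible_Union) auto
  then have "(\<Union>v\<in>T. {x. v \<bullet> x = 0}) \<noteq> UNIV" using non_negligible_UNIV by metis
  then obtain x where "\<And>v. v \<in> T \<Longrightarrow> v \<bullet> x \<noteq> 0" by auto
  then show ?thesis using that by (metis inner_commute)
qed

text \<open>
  A projection to the plane maps parallel vectors to parallel vectors, so it does not create
  directions. It is chosen such that no difference becomes vertical and some triple stays
  non-collinear.
\<close>

lemma many_directions:
  fixes S :: "'a::euclidean_space set"
  assumes S: "finite S" "card S = 2 * k" "\<not> collinear S"
  obtains W where "W \<subseteq> {p - q | p q. p \<in> S \<and> q \<in> S \<and> p \<noteq> q}" "finite W" "2 * k \<le> card W"
    "\<And>v w. v \<in> W \<Longrightarrow> w \<in> W \<Longrightarrow> v \<noteq> w \<Longrightarrow> \<not> collinear {0, v, w}"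
proof -
  define T where "T = {p - q | p q. p \<in> S \<and> q \<in> S \<and> p \<noteq> q}"
  have "T \<subseteq> (\<lambda>(p, q). p - q) ` (S \<times> S)" by (auto simp: T_def)
  then have "finite T" using S(1) by (meson finite_SigmaI finite_imageI finite_subset)
  moreover have "0 \<notin> T" by (auto simp: T_def)
  ultimately have T: "finite T" "0 \<notin> T" .
  have T_I: "s - t \<in> T" if "s \<in> S" "t \<in> S" "s \<noteq> t" for s t
    unfolding T_def using that by blast
  obtain x where x: "\<And>v. v \<in> T \<Longrightarrow> x \<bullet> v \<noteq> 0" using generic_functional[OF T] by blast
  have "\<exists>p\<in>S. \<exists>q\<in>S. p \<noteq> q"
  proof (rule ccontr)
    assume "\<not> ?thesis"
    then have "x - y = 0 *\<^sub>R 0" if "x \<in> S" "y \<in> S" for x y using that by auto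
    then have "collinear S" unfolding collinear_def by blast
    then show False using S(3) by simp
  qed
  then obtain p q where pq: "p \<in> S" "q \<in> S" "p \<noteq> q" by blast
  have "\<exists>r\<in>S. \<forall>c. r - p \<noteq> c *\<^sub>R (q - p)"
  proof (rule ccontr)
    assume "\<not> ?thesis"
    then obtain c where c: "\<And>r. r \<in> S \<Longrightarrow> r - p = c r *\<^sub>R (q - p)" by metis
    have "r - s = (c r - c s) *\<^sub>R (q - p)" if "r \<in> S" "s \<in> S" for r s
    proof -
      have "r - s = (r - p) - (s - p)" by simp
      then show ?thesis using c[OF that(1)] c[OF that(2)] by (simp only: scaleR_left_diff_distrib)
    qed
    then have "collinear S" unfolding collinear_def by blast
    then show False using S(3) by simp
  qed
  then obtain r where r: "r \<in> S" "\<And>c. r - p \<noteq> c *\<^sub>R (q - p)" by blast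
  have rp: "r \<noteq> p" using r(2)[of 0] by auto
  define a b where "a = x \<bullet> (q - p)" and "b = x \<bullet> (r - p)"
  have ab: "a \<noteq> 0" "b \<noteq> 0" unfolding a_def b_def using pq r rp T_I x by auto
  \<comment> \<open>Chosen so that the images of \<open>p\<close>, \<open>q\<close>, \<open>r\<close> span a triangle of area proportional to \<open>y \<bullet> y\<close>.\<close>
  define y where "y = a *\<^sub>R (r - p) - b *\<^sub>R (q - p)"
  have "y \<noteq> 0"
  proof
    assume "y = 0"
    then have "(1 / a) *\<^sub>R (a *\<^sub>R (r - p)) = (1 / a) *\<^sub>R (b *\<^sub>R (q - p))" by (simp add: y_def)
    then have "r - p = (b / a) *\<^sub>R (q - p)" using ab by simp
    then show False using r(2) by blast
  qed
  then have yy: "y \<bullet> y \<noteq> 0" by simp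
  have injx: "inj_on (\<lambda>p. x \<bullet> p) S"
  proof (rule inj_onI, rule ccontr)
    fix s t assume "s \<in> S" "t \<in> S" "x \<bullet> s = x \<bullet> t" "s \<noteq> t"
    then show False using x[OF T_I, of s t] by (simp add: inner_diff_right)
  qed
  interpret planar_points S "\<lambda>p. x \<bullet> p" "\<lambda>p. y \<bullet> p" k
    using S injx by unfold_locales
  have slope: "slope s t = (y \<bullet> (t - s)) / (x \<bullet> (t - s))" for s t
    by (simp add: slope_def inner_diff_right)
  have "slope p q \<noteq> slope p r"
  proof
    assume "slope p q = slope p r"
    then have "y \<bullet> (q - p) / a = y \<bullet> (r - p) / b" by (simp only: slope a_def b_def)
    then have "a * (y \<bullet> (r - p)) = b * (y \<bullet> (q - p))" using ab by (simp add: field_simps)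
    moreover have "y \<bullet> y = a * (y \<bullet> (r - p)) - b * (y \<bullet> (q - p))"
      by (subst (2) y_def) (simp add: inner_diff_right)
    ultimately show False using yy by simp
  qed
  moreover have "{slope p q, slope p r} \<subseteq> slopes" using pq r rp by (auto simp: slopes_def)
  ultimately have "2 \<le> card slopes" using card_mono[OF finite_slopes, of "{slope p q, slope p r}"] by simp
  then have many: "2 * k \<le> card slopes" by (rule ungar)
  have "\<exists>v\<in>T. s = (y \<bullet> v) / (x \<bullet> v)" if "s \<in> slopes" for s
  proof -
    obtain p q where "p \<in> S" "q \<in> S" "p \<noteq> q" "s = slope p q" using \<open>s \<in> slopes\<close> by (auto simp: slopes_def)
    then have "q - p \<in> T" "s = (y \<bullet> (q - p)) / (x \<bullet> (q - p))" using T_I by (auto simp: slope)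
    then show ?thesis by blast
  qed
  then obtain v where v: "\<And>s. s \<in> slopes \<Longrightarrow> v s \<in> T" "\<And>s. s \<in> slopes \<Longrightarrow> s = (y \<bullet> v s) / (x \<bullet> v s)" by metis
  have "inj_on v slopes" using v(2) by (metis inj_onI)
  then have "card (v ` slopes) = card slopes" by (rule card_image)
  moreover have "\<not> collinear {0, v s, v t}" if "s \<in> slopes" "t \<in> slopes" "v s \<noteq> v t" for s t
  proof
    assume "collinear {0, v s, v t}"
    moreover have "v s \<noteq> 0" "v t \<noteq> 0" using v(1) that T(2) by metis+
    ultimately obtain c where c: "v t = c *\<^sub>R v s" by (auto simp: collinear_lemma)
    then have "c \<noteq> 0" using \<open>v t \<noteq> 0\<close> by auto
    then have "s = t" using v(2)[OF that(1)] v(2)[OF that(2)] c by simp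
    then show False using that by simp
  qed
  ultimately show ?thesis
    using v(1) many finite_slopes unfolding T_def by (intro that[of "v ` slopes"]) auto
qed

section \<open>Rank over the ring generated by the distances\<close>

inductive_set ring_gen :: "real set \<Rightarrow> real set" for \<Lambda> where
  int: "of_int c \<in> ring_gen \<Lambda>"
| gen: "x \<in> \<Lambda> \<Longrightarrow> x \<in> ring_gen \<Lambda>"
| add: "x \<in> ring_gen \<Lambda> \<Longrightarrow> y \<in> ring_gen \<Lambda> \<Longrightarrow> x + y \<in> ring_gen \<Lambda>"
| mult: "x \<in> ring_gen \<Lambda> \<Longrightarrow> y \<in> ring_gen \<Lambda> \<Longrightarrow> x * y \<in> ring_gen \<Lambda>"

lemma ring_gen_0: "0 \<in> ring_gen \<Lambda>" and ring_gen_1: "1 \<in> ring_gen \<Lambda>"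
  using ring_gen.int[of 0 \<Lambda>] ring_gen.int[of 1 \<Lambda>] by auto

lemma ring_gen_minus: "x \<in> ring_gen \<Lambda> \<Longrightarrow> - x \<in> ring_gen \<Lambda>"
  using ring_gen.mult[OF ring_gen.int[of "-1" \<Lambda>], of x] by simp

lemma ring_gen_diff: "x \<in> ring_gen \<Lambda> \<Longrightarrow> y \<in> ring_gen \<Lambda> \<Longrightarrow> x - y \<in> ring_gen \<Lambda>"
  using ring_gen.add[OF _ ring_gen_minus, of x \<Lambda> y] by simp

lemma ring_gen_prod: "(\<And>a. a \<in> A \<Longrightarrow> f a \<in> ring_gen \<Lambda>) \<Longrightarrow> prod f A \<in> ring_gen \<Lambda>"
  by (induction A rule: infinite_finite_induct) (auto simp: ring_gen_1 intro: ring_gen.mult)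

lemma ring_gen_peval:
  assumes "x \<in> ring_gen (lam ` {..<m})"
  shows "\<exists>e. \<forall>\<theta>. (\<forall>i<m. \<theta> i = lam i) \<longrightarrow> peval e \<theta> = x"
  using assms
proof induction
  case (int c) then show ?case by (intro exI[of _ "Const c"]) simp
next
  case (gen x) then show ?case by (metis imageE lessThan_iff peval.simps(2))
next
  case (add x y) then show ?case by (metis peval.simps(3))
next
  case (mult x y) then show ?case by (metis peval.simps(4))
qed

primrec psum :: "(nat \<Rightarrow> pexp) \<Rightarrow> nat \<Rightarrow> pexp" where
  "psum f 0 = Const 0"
| "psum f (Suc l) = Add (psum f l) (f l)"

lemma peval_psum: "peval (psum f l) \<theta> = (\<Sum>j<l. peval (f j) \<theta>)"
  by (induction l) auto

text \<open>
  The parameters are the elements of \<open>\<Lambda>\<close> and the coordinates of the elements of \<open>B\<close>: the coefficients of the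
  vectors in \<open>W\<close> and their lengths are values of integer polynomials at the elements of \<open>\<Lambda>\<close>.
\<close>

lemma typical_span_bound:
  fixes N :: "real ^ 'n::finite \<Rightarrow> real"
  assumes T: "typical N" and fin: "finite \<Lambda>" "finite B" "finite W"
    and span: "\<And>v. v \<in> W \<Longrightarrow> \<exists>c. (\<forall>b\<in>B. c b \<in> ring_gen \<Lambda>) \<and> v = (\<Sum>b\<in>B. c b *\<^sub>R b)"
    and len: "\<And>v. v \<in> W \<Longrightarrow> N v \<in> ring_gen \<Lambda>"
    and nz: "0 \<notin> W" and nc: "\<And>v w. v \<in> W \<Longrightarrow> w \<in> W \<Longrightarrow> v \<noteq> w \<Longrightarrow> \<not> collinear {0, v, w}"
  shows "card W \<le> card \<Lambda> + CARD('n) * card B"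
proof -
  define m l d where "m = card \<Lambda>" and "l = card B" and "d = CARD('n)"
  obtain lam where lam: "bij_betw lam {..<m} \<Lambda>" using fin(1) ex_bij_betw_nat_finite[of \<Lambda>] by (auto simp: m_def lessThan_atLeast0)
  obtain \<beta> where \<beta>: "bij_betw \<beta> {..<l} B" using fin(2) ex_bij_betw_nat_finite[of B] by (auto simp: l_def lessThan_atLeast0)
  obtain \<omega> where \<omega>: "bij_betw \<omega> {..<card W} W" using fin(3) ex_bij_betw_nat_finite[of W] by (auto simp: lessThan_atLeast0)
  obtain h where h: "bij_betw h (UNIV :: 'n set) {..<d}"
    using ex_bij_betw_finite_nat[of "UNIV :: 'n set"] by (auto simp: d_def lessThan_atLeast0)
  define g where "g = inv h"
  have hd: "h i < d" and gh: "g (h i) = i" for i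
    using h by (auto simp: bij_betw_def g_def)
  have d0: "d > 0" by (simp add: d_def)
  have \<Lambda>: "\<Lambda> = lam ` {..<m}" using lam by (simp add: bij_betw_def)
  \<comment> \<open>The first \<open>m\<close> parameters are the elements of \<open>\<Lambda>\<close>; the vectors of the basis follow in blocks of length \<open>d\<close>.\<close>
  define \<theta> where "\<theta> i = (if i < m then lam i else \<beta> ((i - m) div d) $ g ((i - m) mod d))" for i
  define a where "a = m + d * l"
  have \<theta>m: "\<forall>i<m. trunc a \<theta> i = lam i" by (simp add: trunc_def \<theta>_def a_def)
  have \<theta>b: "trunc a \<theta> (m + (j * d + h i)) = \<beta> j $ i" if "j < l" for j i
  proof -
    have "j * d + h i < Suc j * d" using hd[of i] by simp
    also have "\<dots> \<le> l * d" using that by (intro mult_le_mono1) simp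
    finally show ?thesis using hd[of i] by (simp add: trunc_def \<theta>_def a_def gh mult.commute)
  qed
  obtain c where c: "\<And>v b. v \<in> W \<Longrightarrow> b \<in> B \<Longrightarrow> c v b \<in> ring_gen \<Lambda>" "\<And>v. v \<in> W \<Longrightarrow> v = (\<Sum>b\<in>B. c v b *\<^sub>R b)"
    using span by metis
  obtain E where E: "\<And>x. x \<in> ring_gen \<Lambda> \<Longrightarrow> peval (E x) (trunc a \<theta>) = x"
    using ring_gen_peval[of _ lam m] \<theta>m unfolding \<Lambda> by metis
  define V where "V v i = psum (\<lambda>j. Mul (E (c v (\<beta> j))) (Var (m + (j * d + h i)))) l" for v i
  define cfg where "cfg = map (\<lambda>w. (V (\<omega> w), E (N (\<omega> w)))) [0..<card W]"
  have len_cfg: "length cfg = card W" by (simp add: cfg_def)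
  have \<omega>W: "\<omega> w \<in> W" if "w < card W" for w using \<omega> that by (auto simp: bij_betw_def)
  have cvec: "cvec a cfg w \<theta> = \<omega> w" if w: "w < card W" for w
  proof (rule vec_eq_iff[THEN iffD2], rule allI)
    fix i
    have "cvec a cfg w \<theta> $ i = (\<Sum>j<l. c (\<omega> w) (\<beta> j) * \<beta> j $ i)"
    proof -
      have "peval (E (c (\<omega> w) (\<beta> j))) (trunc a \<theta>) = c (\<omega> w) (\<beta> j)" if "j < l" for j
        using E c(1) \<omega>W[OF w] \<beta> that by (auto simp: bij_betw_def)
      then show ?thesis using w \<theta>b by (simp add: cvec_def cfg_def V_def peval_psum)
    qed
    also have "\<dots> = (\<Sum>b\<in>B. c (\<omega> w) b * b $ i)"
      using sum.reindex_bij_betw[OF \<beta>, of "\<lambda>b. c (\<omega> w) b * b $ i"] by simp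
    also have "\<dots> = (\<Sum>b\<in>B. c (\<omega> w) b *\<^sub>R b) $ i" by (simp add: sum_component)
    also have "\<dots> = \<omega> w $ i" using c(2)[OF \<omega>W[OF w]] by simp
    finally show "cvec a cfg w \<theta> $ i = \<omega> w $ i" .
  qed
  have "length cfg \<le> a"
  proof (rule typical_config_bound[OF T, of cfg a \<theta>])
    fix w assume w: "w < length cfg"
    show "cvec a cfg w \<theta> \<noteq> 0" using w cvec nz \<omega>W len_cfg by metis
    show "N (cvec a cfg w \<theta>) = clen a cfg w \<theta>"
      using w cvec[of w] E[OF len[OF \<omega>W]] by (simp add: len_cfg clen_def cfg_def)
    fix w' assume w': "w' < length cfg" "w \<noteq> w'"
    then have "\<omega> w \<noteq> \<omega> w'" using \<omega> w len_cfg by (auto simp: bij_betw_def inj_on_def)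
    then show "\<not> collinear {0, cvec a cfg w \<theta>, cvec a cfg w' \<theta>}"
      using w w' cvec nc \<omega>W len_cfg by metis
  qed
  then show ?thesis by (simp add: len_cfg a_def m_def l_def d_def)
qed

definition ring_independent :: "real set \<Rightarrow> 'a::real_vector set \<Rightarrow> bool" where
  "ring_independent \<Lambda> B \<longleftrightarrow> (\<forall>c. (\<forall>b\<in>B. c b \<in> ring_gen \<Lambda>) \<longrightarrow> (\<Sum>b\<in>B. c b *\<^sub>R b) = 0 \<longrightarrow> (\<forall>b\<in>B. c b = 0))"

text \<open>
  A maximal independent subset spans after multiplication by a common denominator \<open>t\<close>. Staying in the
  ring keeps all coefficients polynomial in \<open>\<Lambda>\<close>, which would fail in the field of fractions.
\<close>

lemma ring_basis_exists:
  fixes D :: "'a::real_vector set"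
  assumes D: "finite D"
  obtains B t where "B \<subseteq> D" "ring_independent \<Lambda> B" "t \<noteq> 0"
    "\<And>v. v \<in> D \<Longrightarrow> \<exists>c. (\<forall>b\<in>B. c b \<in> ring_gen \<Lambda>) \<and> t *\<^sub>R v = (\<Sum>b\<in>B. c b *\<^sub>R b)"
proof -
  define F where "F = {B \<in> Pow D. ring_independent \<Lambda> B}"
  have "finite F" using D by (simp add: F_def)
  moreover have "{} \<in> F" by (simp add: F_def ring_independent_def)
  ultimately obtain B where "B \<in> F" and maxF: "\<forall>A\<in>F. B \<subseteq> A \<longrightarrow> B = A"
    using finite_has_maximal[of F] by blast
  then have B: "B \<subseteq> D" "ring_independent \<Lambda> B" by (auto simp: F_def)
  have max: "B = A" if "A \<subseteq> D" "ring_independent \<Lambda> A" "B \<subseteq> A" for A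
    using maxF that by (simp add: F_def)
  have fB: "finite B" using B D finite_subset by blast
  define Q where "Q v r c \<longleftrightarrow> r \<noteq> 0 \<and> r \<in> ring_gen \<Lambda> \<and> (\<forall>b\<in>B. c b \<in> ring_gen \<Lambda>) \<and>
    r *\<^sub>R v = (\<Sum>b\<in>B. c b *\<^sub>R b)" for v r c
  have "\<exists>r c. Q v r c" if v: "v \<in> D" for v
  proof (cases "v \<in> B")
    case True
    have "(\<Sum>b\<in>B. of_bool (b = v) *\<^sub>R b) = v"
      using True fB by (simp add: of_bool_def if_distrib[of "\<lambda>x. x *\<^sub>R _"] sum.delta cong: if_cong)
    then show ?thesis
      unfolding Q_def by (intro exI[of _ 1] exI[of _ "\<lambda>b. of_bool (b = v)"]) (auto simp: ring_gen_0 ring_gen_1)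
  next
    case False
    then have "\<not> ring_independent \<Lambda> (insert v B)" using max[of "insert v B"] v B by blast
    then obtain c where c: "\<forall>b\<in>insert v B. c b \<in> ring_gen \<Lambda>" "(\<Sum>b\<in>insert v B. c b *\<^sub>R b) = 0"
      "\<not> (\<forall>b\<in>insert v B. c b = 0)" unfolding ring_independent_def by blast
    have sum: "c v *\<^sub>R v + (\<Sum>b\<in>B. c b *\<^sub>R b) = 0" using c(2) False fB by simp
    have "c v \<noteq> 0"
    proof
      assume "c v = 0"
      then have "(\<Sum>b\<in>B. c b *\<^sub>R b) = 0" using sum by simp
      then have "\<forall>b\<in>B. c b = 0" using B(2) c(1) unfolding ring_independent_def by blast
      then show False using c(3) \<open>c v = 0\<close> by blast
    qed
    moreover have "c v *\<^sub>R v = (\<Sum>b\<in>B. (- c b) *\<^sub>R b)"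
      using sum by (simp add: sum_negf eq_neg_iff_add_eq_0)
    ultimately show ?thesis
      using c(1) unfolding Q_def by (intro exI[of _ "c v"] exI[of _ "\<lambda>b. - c b"]) (auto intro: ring_gen_minus)
  qed
  then obtain r c where "\<And>v. v \<in> D \<Longrightarrow> Q v (r v) (c v)" by metis
  then have rc: "\<And>v. v \<in> D \<Longrightarrow> r v \<noteq> 0" "\<And>v. v \<in> D \<Longrightarrow> r v \<in> ring_gen \<Lambda>"
    "\<And>v b. v \<in> D \<Longrightarrow> b \<in> B \<Longrightarrow> c v b \<in> ring_gen \<Lambda>" "\<And>v. v \<in> D \<Longrightarrow> r v *\<^sub>R v = (\<Sum>b\<in>B. c v b *\<^sub>R b)"
    unfolding Q_def by blast+
  define t where "t = (\<Prod>v\<in>D. r v)"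
  have "t \<noteq> 0" using D rc(1) by (simp add: t_def)
  moreover have "\<exists>c. (\<forall>b\<in>B. c b \<in> ring_gen \<Lambda>) \<and> t *\<^sub>R v = (\<Sum>b\<in>B. c b *\<^sub>R b)" if v: "v \<in> D" for v
  proof (intro exI[of _ "\<lambda>b. (\<Prod>u\<in>D - {v}. r u) * c v b"] conjI ballI)
    fix b assume "b \<in> B"
    then show "(\<Prod>u\<in>D - {v}. r u) * c v b \<in> ring_gen \<Lambda>"
      using rc v by (intro ring_gen.mult ring_gen_prod) auto
  next
    have "t = (\<Prod>u\<in>D - {v}. r u) * r v" unfolding t_def using prod.remove[OF D v, of r] by (simp add: mult.commute)
    then have "t *\<^sub>R v = (\<Prod>u\<in>D - {v}. r u) *\<^sub>R (r v *\<^sub>R v)" by simp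
    also have "\<dots> = (\<Sum>b\<in>B. ((\<Prod>u\<in>D - {v}. r u) * c v b) *\<^sub>R b)"
      unfolding rc(4)[OF v] by (simp add: scaleR_sum_right)
    finally show "t *\<^sub>R v = (\<Sum>b\<in>B. ((\<Prod>u\<in>D - {v}. r u) * c v b) *\<^sub>R b)" .
  qed
  ultimately show ?thesis using that B by blast
qed

lemma finite_distances: "finite S \<Longrightarrow> finite (distances N S)"
proof -
  assume "finite S"
  moreover have "distances N S \<subseteq> (\<lambda>(p, q). N (p - q)) ` (S \<times> S)" by (auto simp: distances_def)
  ultimately show ?thesis by (meson finite_SigmaI finite_imageI finite_subset)
qed

lemma of_bool_combination:
  fixes B :: "'a::real_vector set"
  assumes "finite B" "x \<in> B"
  shows "(\<Sum>b\<in>B. (s * of_bool (b = x)) *\<^sub>R b) = s *\<^sub>R x"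
proof -
  have "(\<Sum>b\<in>B. (s * of_bool (b = x)) *\<^sub>R b) = (\<Sum>b\<in>B. if b = x then s *\<^sub>R x else 0)"
    by (intro sum.cong) auto
  then show ?thesis using assms by simp
qed

text \<open>
  The ratio of two parallel vectors is, up to sign, the ratio of their lengths. If both lengths are in the
  ring, then clearing the denominator gives a linear relation between the basis vectors; it is
  not trivial because some basis vector occurs in only one of the two differences.
\<close>

lemma basis_differences_not_collinear:
  fixes B :: "'a::real_vector set"
  assumes N: "is_norm N" and fB: "finite B" and ind: "ring_independent \<Lambda> B"
    and len: "\<And>x y. x \<in> B \<Longrightarrow> y \<in> B \<Longrightarrow> x \<noteq> y \<Longrightarrow> N (x - y) \<in> ring_gen \<Lambda>"
    and mem: "x \<in> B" "y \<in> B" "x' \<in> B" "y' \<in> B"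
    and ne: "x \<noteq> y" "x' \<noteq> y'" "x \<noteq> y'" "x' \<noteq> y" "(x, y) \<noteq> (x', y')"
    and col: "collinear {0, x - y, x' - y'}"
  shows False
proof -
  define s where "s = N (x - y)"
  have s: "s \<noteq> 0" "s \<in> ring_gen \<Lambda>" using ne is_normD(2)[OF N] len mem by (auto simp: s_def)
  obtain t0 where t0: "x' - y' = t0 *\<^sub>R (x - y)" using col ne by (auto simp: collinear_lemma)
  define t where "t = s * t0"
  have "N (x' - y') = \<bar>t0\<bar> * s" by (simp add: t0 is_normD(3)[OF N] s_def)
  moreover have "s \<ge> 0" by (simp add: s_def is_normD(1)[OF N])
  ultimately have "t = N (x' - y') \<or> t = - N (x' - y')" by (auto simp: t_def abs_if)
  then have t: "t \<in> ring_gen \<Lambda>" using len[OF mem(3,4) ne(2)] ring_gen_minus by metis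
  define c where "c b = s * of_bool (b = x') - s * of_bool (b = y') - (t * of_bool (b = x) - t * of_bool (b = y))" for b
  have ob: "of_bool P \<in> ring_gen \<Lambda>" for P by (cases P) (auto simp: ring_gen_0 ring_gen_1)
  have cR: "\<forall>b\<in>B. c b \<in> ring_gen \<Lambda>"
    unfolding c_def by (intro ballI ring_gen_diff ring_gen.mult s(2) t ob)
  have "(\<Sum>b\<in>B. c b *\<^sub>R b) = s *\<^sub>R x' - s *\<^sub>R y' - (t *\<^sub>R x - t *\<^sub>R y)"
    unfolding c_def scaleR_left_diff_distrib sum_subtractf
    by (simp only: of_bool_combination[OF fB] mem)
  also have "\<dots> = s *\<^sub>R (x' - y') - t *\<^sub>R (x - y)" by (simp add: scaleR_right_diff_distrib)
  also have "\<dots> = 0" by (simp add: t0 t_def)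
  finally have zero: "\<forall>b\<in>B. c b = 0" using ind cR unfolding ring_independent_def by blast
  show False
  proof (cases "x' = x")
    case True
    then have "y' \<noteq> y" using ne by auto
    then have "c y' = - s" using ne by (simp add: c_def)
    then show False using zero mem s by auto
  next
    case False
    then have "c x' = s" using ne by (simp add: c_def)
    then show False using zero mem s by auto
  qed
qed

text \<open>
  The basis is split into halves of sizes at least \<open>s\<close>, so that the differences between the halves have
  at least \<open>s\<^sup>2\<close> directions. They are spanned by the basis, and so are, up to the common denominator, all
  differences of points. Both families of directions are bounded by the number of parameters.
\<close>

lemma typical_noncollinear_bound:
  fixes N :: "real ^ 'n::finite \<Rightarrow> real"
  assumes N: "is_norm N" and T: "typical N" and S: "finite S" "card S = 2 * k" "\<not> collinear S"
  defines "m \<equiv> card (distances N S)"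
  shows "\<exists>s. 2 * k \<le> m + CARD('n) * (2 * s + 1) \<and> s * s \<le> m + CARD('n) * (2 * s + 1)"
proof -
  define \<Lambda> where "\<Lambda> = distances N S"
  have f\<Lambda>: "finite \<Lambda>" unfolding \<Lambda>_def by (rule finite_distances[OF S(1)])
  obtain p0 where p0: "p0 \<in> S" using S(3) by (cases "S = {}") auto
  define D where "D = (\<lambda>p. p - p0) ` S"
  have fD: "finite D" using S(1) by (simp add: D_def)
  obtain B t where B: "B \<subseteq> D" "ring_independent \<Lambda> B" "t \<noteq> 0"
    and span: "\<And>v. v \<in> D \<Longrightarrow> \<exists>c. (\<forall>b\<in>B. c b \<in> ring_gen \<Lambda>) \<and> t *\<^sub>R v = (\<Sum>b\<in>B. c b *\<^sub>R b)"
    by (rule ring_basis_exists[OF fD, of \<Lambda>]) (rule that; fast)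
  have fB: "finite B" using B(1) S(1) finite_subset by (auto simp: D_def)
  have lenD: "N (x - y) \<in> ring_gen \<Lambda>" if xy: "x \<in> D" "y \<in> D" "x \<noteq> y" for x y
  proof -
    obtain p q where "p \<in> S" "q \<in> S" "x = p - p0" "y = q - p0" using xy by (auto simp: D_def)
    then have "x - y = p - q" "p \<noteq> q" using xy by auto
    then show ?thesis using \<open>p \<in> S\<close> \<open>q \<in> S\<close> by (auto simp: \<Lambda>_def distances_def intro!: ring_gen.gen)
  qed
  have lenB: "N (x - y) \<in> ring_gen \<Lambda>" if "x \<in> B" "y \<in> B" "x \<noteq> y" for x y
    using lenD that B(1) by blast
  define s where "s = card B div 2"
  have "s \<le> card B" by (simp add: s_def)
  then obtain B1 where B1: "B1 \<subseteq> B" "card B1 = s" by (meson obtain_subset_with_card_n)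
  define B2 where "B2 = B - B1"
  have cB: "card B \<le> 2 * s + 1" by (simp add: s_def)
  have fB1: "finite B1" using B1 fB finite_subset by blast
  have cB2: "s \<le> card B2" unfolding B2_def using card_Diff_subset[OF fB1 B1(1)] B1(2) by (simp add: s_def)
  define W1 where "W1 = (\<lambda>(x, y). x - y) ` (B1 \<times> B2)"
  have nc: False if "(x, y) \<in> B1 \<times> B2" "(x', y') \<in> B1 \<times> B2" "(x, y) \<noteq> (x', y')" "collinear {0, x - y, x' - y'}"
    for x y x' y'
    using that B1(1) lenB
    by (intro basis_differences_not_collinear[OF N fB B(2), of x y x' y']) (auto simp: B2_def)
  have "inj_on (\<lambda>(x, y). x - y) (B1 \<times> B2)"
  proof (rule inj_onI, clarify, rule ccontr)
    fix x y x' y' assume *: "x \<in> B1" "y \<in> B2" "x' \<in> B1" "y' \<in> B2" "x - y = x' - y'" "\<not> (x = x' \<and> y = y')"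
    then show False using nc[of x y x' y'] by auto
  qed
  then have "card W1 = s * card B2" unfolding W1_def using B1(2) by (simp add: card_image card_cartesian_product)
  then have "s * s \<le> card W1" using cB2 by simp
  also have "card W1 \<le> card \<Lambda> + CARD('n) * card B"
  proof (rule typical_span_bound[OF T f\<Lambda> fB])
    show "finite W1" unfolding W1_def using fB fB1 by (auto simp: B2_def)
    show "0 \<notin> W1" by (auto simp: W1_def B2_def)
    fix v assume "v \<in> W1"
    then obtain x y where xy: "x \<in> B1" "y \<in> B2" "v = x - y" by (auto simp: W1_def)
    then have mem: "x \<in> B" "y \<in> B" "x \<noteq> y" using B1 by (auto simp: B2_def)
    have "v = (\<Sum>b\<in>B. (1 * of_bool (b = x) - 1 * of_bool (b = y)) *\<^sub>R b)"
      unfolding scaleR_left_diff_distrib sum_subtractf of_bool_combination[OF fB mem(1)]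
        of_bool_combination[OF fB mem(2)] xy(3) by simp
    moreover have "1 * of_bool (b = x) - 1 * of_bool (b = y) \<in> ring_gen \<Lambda>" for b
      by (intro ring_gen_diff) (simp_all add: ring_gen_0 ring_gen_1)
    ultimately show "\<exists>c. (\<forall>b\<in>B. c b \<in> ring_gen \<Lambda>) \<and> v = (\<Sum>b\<in>B. c b *\<^sub>R b)"
      by (intro exI[of _ "\<lambda>b. 1 * of_bool (b = x) - 1 * of_bool (b = y)"]) blast
    show "N v \<in> ring_gen \<Lambda>" using lenD mem B(1) xy(3) by blast
    fix w assume "w \<in> W1" "v \<noteq> w"
    then obtain x' y' where "x' \<in> B1" "y' \<in> B2" "w = x' - y'" by (auto simp: W1_def)
    then show "\<not> collinear {0, v, w}" using nc[of x y x' y'] xy \<open>v \<noteq> w\<close> by auto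
  qed
  also have "\<dots> \<le> m + CARD('n) * (2 * s + 1)" 
    unfolding m_def \<Lambda>_def using cB by (intro add_left_mono mult_le_mono2)
  finally have bound1: "s * s \<le> m + CARD('n) * (2 * s + 1)" .
  obtain W where W: "W \<subseteq> {p - q | p q. p \<in> S \<and> q \<in> S \<and> p \<noteq> q}" "finite W" "2 * k \<le> card W"
    "\<And>v w. v \<in> W \<Longrightarrow> w \<in> W \<Longrightarrow> v \<noteq> w \<Longrightarrow> \<not> collinear {0, v, w}"
    using many_directions[OF S] by blast
  \<comment> \<open>Dividing the basis by the common denominator makes all coefficients elements of the ring.\<close>
  define C where "C = (\<lambda>b. (1 / t) *\<^sub>R b) ` B"
  have inj: "inj_on (\<lambda>b. (1 / t) *\<^sub>R b) B" using B(3) by (auto simp: inj_on_def)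
  have "card W \<le> card \<Lambda> + CARD('n) * card C"
  proof (rule typical_span_bound[OF T f\<Lambda> _ W(2) _ _ _ W(4)])
    show "finite C" using fB by (simp add: C_def)
    show "0 \<notin> W" using W(1) by auto
    fix v assume "v \<in> W"
    then obtain p q where pq: "p \<in> S" "q \<in> S" "p \<noteq> q" "v = p - q" using W(1) by blast
    then show "N v \<in> ring_gen \<Lambda>" by (auto simp: \<Lambda>_def distances_def intro!: ring_gen.gen)
    obtain c where c: "\<forall>b\<in>B. c b \<in> ring_gen \<Lambda>" "t *\<^sub>R (p - p0) = (\<Sum>b\<in>B. c b *\<^sub>R b)"
      using span[of "p - p0"] pq by (auto simp: D_def)
    obtain c' where c': "\<forall>b\<in>B. c' b \<in> ring_gen \<Lambda>" "t *\<^sub>R (q - p0) = (\<Sum>b\<in>B. c' b *\<^sub>R b)"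
      using span[of "q - p0"] pq by (auto simp: D_def)
    define e where "e x = c (t *\<^sub>R x) - c' (t *\<^sub>R x)" for x
    have "t *\<^sub>R v = t *\<^sub>R (p - p0) - t *\<^sub>R (q - p0)" by (simp add: pq scaleR_right_diff_distrib)
    also have "\<dots> = (\<Sum>b\<in>B. (c b - c' b) *\<^sub>R b)" unfolding c c' by (simp add: sum_subtractf scaleR_left_diff_distrib)
    finally have "(1 / t) *\<^sub>R (t *\<^sub>R v) = (1 / t) *\<^sub>R (\<Sum>b\<in>B. (c b - c' b) *\<^sub>R b)" by simp
    then have "v = (\<Sum>b\<in>B. (c b - c' b) *\<^sub>R ((1 / t) *\<^sub>R b))" using B(3) by (simp add: scaleR_sum_right)
    also have "\<dots> = (\<Sum>x\<in>C. e x *\<^sub>R x)"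
      unfolding C_def sum.reindex[OF inj] using B(3) by (simp add: e_def)
    finally have "v = (\<Sum>x\<in>C. e x *\<^sub>R x)" .
    moreover have "\<forall>x\<in>C. e x \<in> ring_gen \<Lambda>"
      unfolding C_def e_def using c(1) c'(1) B(3) by (auto intro!: ring_gen_diff)
    ultimately show "\<exists>c. (\<forall>b\<in>C. c b \<in> ring_gen \<Lambda>) \<and> v = (\<Sum>b\<in>C. c b *\<^sub>R b)" by blast
  qed
  also have "card C \<le> card B" unfolding C_def using fB by (rule card_image_le)
  then have "card \<Lambda> + CARD('n) * card C \<le> m + CARD('n) * (2 * s + 1)"
    unfolding m_def \<Lambda>_def using cB by (intro add_left_mono mult_le_mono2) linarith
  finally have "2 * k \<le> m + CARD('n) * (2 * s + 1)" using W(3) by linarith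
  then show ?thesis using bound1 by blast
qed

section \<open>Distinct distances\<close>

lemma collinear_distances:
  fixes S :: "'a::real_vector set"
  assumes N: "is_norm N" and S: "finite S" "collinear S"
  shows "card S \<le> card (distances N S) + 1"
proof (cases "S = {}")
  case False
  then obtain p where p: "p \<in> S" by blast
  obtain u where u: "\<And>x y. x \<in> S \<Longrightarrow> y \<in> S \<Longrightarrow> \<exists>c. x - y = c *\<^sub>R u" using S(2) by (auto simp: collinear_def)
  define c where "c x = (SOME t. x - p = t *\<^sub>R u)" for x
  have c: "x - p = c x *\<^sub>R u" if "x \<in> S" for x
    unfolding c_def by (rule someI_ex[OF u[OF that p]])
  have diff: "x - y = (c x - c y) *\<^sub>R u" if "x \<in> S" "y \<in> S" for x y
  proof -
    have "x - y = (x - p) - (y - p)" by simp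
    then show ?thesis using c[OF that(1)] c[OF that(2)] by (simp only: scaleR_left_diff_distrib)
  qed
  obtain q where q: "q \<in> S" "\<And>x. x \<in> S \<Longrightarrow> c q \<le> c x"
    using arg_min_if_finite[OF S(1) False, of c] by (meson not_less)
  have "inj_on (\<lambda>x. N (x - q)) (S - {q})"
  proof (rule inj_onI)
    fix x y assume xy: "x \<in> S - {q}" "y \<in> S - {q}" "N (x - q) = N (y - q)"
    have "x - q \<noteq> 0" using xy by simp
    then have "N u \<noteq> 0" using diff[of x q] xy q is_normD(2)[OF N] by auto
    moreover have "(c x - c q) * N u = (c y - c q) * N u"
      using xy diff[of x q] diff[of y q] q by (simp add: is_normD(3)[OF N])
    ultimately have "c x = c y" by simp
    then show "x = y" using diff[of x y] xy by simp
  qed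
  then have "card (S - {q}) = card ((\<lambda>x. N (x - q)) ` (S - {q}))" by (simp add: card_image)
  also have "\<dots> \<le> card (distances N S)"
    using q by (intro card_mono finite_distances S) (auto simp: distances_def)
  finally show ?thesis using q S(1) by simp
qed simp

lemma distances_mono: "S \<subseteq> T \<Longrightarrow> distances N S \<subseteq> distances N T"
  by (auto simp: distances_def)

text \<open>
  Removing at most one point makes the number of points even. The additional \<open>2\<close> covers this point and the loss
  of one distance in the collinear case.
\<close>

lemma typical_distances_bound:
  fixes N :: "real ^ 'n::finite \<Rightarrow> real"
  assumes N: "is_norm N" and T: "typical N" and S: "finite S" "card S = n"
  defines "m \<equiv> card (distances N S)"
  shows "\<exists>s. n \<le> m + CARD('n) * (2 * s + 1) + 2 \<and> s * s \<le> m + CARD('n) * (2 * s + 1)"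
proof -
  have "2 * (n div 2) \<le> card S" using S by simp
  then obtain S' where S': "S' \<subseteq> S" "card S' = 2 * (n div 2)" by (meson obtain_subset_with_card_n)
  have fS': "finite S'" using S' S finite_subset by blast
  have m': "card (distances N S') \<le> m"
    unfolding m_def by (intro card_mono finite_distances S distances_mono S')
  have n: "n \<le> 2 * (n div 2) + 1" by simp
  show ?thesis
  proof (cases "collinear S'")
    case True
    then have "2 * (n div 2) \<le> m + 1" using collinear_distances[OF N fS' True] S'(2) m' by simp
    then show ?thesis using n by (intro exI[of _ 0]) simp
  next
    case False
    obtain s where "2 * (n div 2) \<le> card (distances N S') + CARD('n) * (2 * s + 1)"
      "s * s \<le> card (distances N S') + CARD('n) * (2 * s + 1)"
      using typical_noncollinear_bound[OF N T fS' S'(2) False] by blast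
    then show ?thesis using n m' by (intro exI[of _ s]) linarith
  qed
qed

text \<open>
  Nothing is to be shown if \<open>m \<ge> n\<close>. Otherwise the second hypothesis forces \<open>s\<close> to be of order at most \<open>\<surd>n\<close>, which makes the error \<open>d * (2 * s + 1)\<close>
  in the first one sublinear.
\<close>

lemma sublinear_error:
  fixes d :: nat and \<epsilon> :: real
  assumes "\<epsilon> > 0"
  obtains n0 where "\<And>n m s :: nat. n \<ge> n0 \<Longrightarrow> n \<le> m + d * (2 * s + 1) + 2 \<Longrightarrow> s * s \<le> m + d * (2 * s + 1)
    \<Longrightarrow> (1 - \<epsilon>) * real n \<le> real m"
proof -
  define D where "D = real d"
  define \<eta> where "\<eta> = \<epsilon> / 4"
  define K where "K = \<eta> * (2 * D + 4 * D\<^sup>2) + D\<^sup>2 / \<eta> + D + 2"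
  obtain n0 where n0: "2 * K / \<epsilon> \<le> real n0" using real_arch_simple by blast
  have \<eta>: "\<eta> > 0" using assms by (simp add: \<eta>_def)
  have "(1 - \<epsilon>) * real n \<le> real m"
    if n: "n \<ge> n0" and 1: "n \<le> m + d * (2 * s + 1) + 2" and 2: "s * s \<le> m + d * (2 * s + 1)" for n m s
  proof (cases "n \<le> m")
    case True
    have "(1 - \<epsilon>) * real n \<le> 1 * real n" using assms by (intro mult_right_mono) auto
    then show ?thesis using True by simp
  next
    case False
    define x where "x = real s"
    have "real n \<le> real (m + d * (2 * s + 1) + 2)" using 1 by (simp only: of_nat_le_iff)
    then have r1: "real n \<le> real m + 2 * (D * x) + D + 2" by (simp add: D_def x_def algebra_simps)
    have "real (s * s) \<le> real (m + d * (2 * s + 1))" using 2 by (simp only: of_nat_le_iff)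
    then have r2: "x\<^sup>2 \<le> real n + 2 * (D * x) + D" using False by (simp add: D_def x_def algebra_simps power2_eq_square)
    \<comment> \<open>Absorbs the linear term into \<open>x\<^sup>2 / 2\<close>, so that \<open>x\<^sup>2\<close> is at most linear in \<open>n\<close>.\<close>
    have "0 \<le> (x - 2 * D)\<^sup>2" by simp
    then have "4 * (D * x) \<le> x\<^sup>2 + 4 * D\<^sup>2" by (simp add: power2_eq_square algebra_simps)
    then have x2: "x\<^sup>2 \<le> 2 * real n + 2 * D + 4 * D\<^sup>2" using r2 by linarith
    \<comment> \<open>The linear term again, now with an arbitrarily small multiple of \<open>x\<^sup>2\<close>.\<close>
    have "0 \<le> \<eta> * (x - D / \<eta>)\<^sup>2" using \<eta> by simp
    also have "\<eta> * (x - D / \<eta>)\<^sup>2 = \<eta> * x\<^sup>2 - 2 * (D * x) + D\<^sup>2 / \<eta>"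
      using \<eta> by (simp add: power2_eq_square field_simps)
    finally have "2 * (D * x) \<le> \<eta> * x\<^sup>2 + D\<^sup>2 / \<eta>" by simp
    also have "\<eta> * x\<^sup>2 \<le> \<eta> * (2 * real n + 2 * D + 4 * D\<^sup>2)" using x2 \<eta> by (intro mult_left_mono) auto
    finally have "2 * (D * x) + D + 2 \<le> 2 * \<eta> * real n + K" by (simp add: K_def algebra_simps)
    then have "real n - \<epsilon> / 2 * real n - K \<le> real m" using r1 by (simp add: \<eta>_def)
    moreover have "K \<le> \<epsilon> / 2 * real n"
    proof -
      have "2 * K / \<epsilon> \<le> real n" using n0 n by linarith
      then show ?thesis using assms by (simp add: field_simps)
    qed
    ultimately show ?thesis by (simp add: algebra_simps)
  qed
  then show ?thesis using that by blast
qed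

lemma few_distances_exist:
  fixes N :: "'a::euclidean_space \<Rightarrow> real"
  assumes N: "is_norm N"
  shows "\<exists>S. finite S \<and> card S = n \<and> card (distances N S) \<le> n"
proof -
  obtain u :: 'a where u: "u \<in> Basis" using nonempty_Basis by blast
  then have u0: "u \<noteq> 0" by auto
  define S where "S = (\<lambda>i. real i *\<^sub>R u) ` {..<n}"
  have "inj_on (\<lambda>i. real i *\<^sub>R u) {..<n}" using u0 by (auto simp: inj_on_def)
  then have "card S = n" by (simp add: S_def card_image)
  moreover have "distances N S \<subseteq> (\<lambda>i. real i * N u) ` {..<n}"
  proof
    fix x assume "x \<in> distances N S"
    then obtain i j where ij: "i < n" "j < n" "x = N (real i *\<^sub>R u - real j *\<^sub>R u)"
      by (auto simp: distances_def S_def)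
    have "x = \<bar>real i - real j\<bar> * N u"
      unfolding ij(3) scaleR_left_diff_distrib[symmetric] by (rule is_normD(3)[OF N])
    also have "\<bar>real i - real j\<bar> = real (max i j - min i j)" by (auto simp: max_def min_def)
    finally have "x = real (max i j - min i j) * N u" .
    moreover have "max i j - min i j < n" using ij by auto
    ultimately show "x \<in> (\<lambda>i. real i * N u) ` {..<n}" by blast
  qed
  then have "card (distances N S) \<le> n" by (metis card_lessThan finite_lessThan surj_card_le)
  moreover have "finite S" by (simp add: S_def)
  ultimately show ?thesis by blast
qed

theorem theorem1p3:
  assumes "CARD('n::finite) \<ge> 2"
  shows "for_norms_besides_meagre (\<lambda>N :: real ^ 'n \<Rightarrow> real.
           (\<lambda>n. real (min_distances N n) / real n) \<longlonglongrightarrow> 1 \<and>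
           (\<forall>\<epsilon>>0. \<exists>n0. \<forall>n\<ge>n0. \<forall>S. finite S \<and> card S = n \<longrightarrow>
              real (card (distances N S)) \<ge> (1 - \<epsilon>) * real n))"
proof (rule for_norms_besides_meagreI)
  fix N :: "real ^ 'n \<Rightarrow> real" assume N: "is_norm N" and T: "typical N"
  have lower: "\<exists>n0. \<forall>n\<ge>n0. \<forall>S. finite S \<and> card S = n \<longrightarrow> real (card (distances N S)) \<ge> (1 - \<epsilon>) * real n"
    if \<epsilon>: "\<epsilon> > 0" for \<epsilon>
  proof -
    obtain n0 where n0: "\<And>n m s :: nat. n \<ge> n0 \<Longrightarrow> n \<le> m + CARD('n) * (2 * s + 1) + 2 \<Longrightarrow>
      s * s \<le> m + CARD('n) * (2 * s + 1) \<Longrightarrow> (1 - \<epsilon>) * real n \<le> real m"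
      using sublinear_error[OF \<epsilon>, of "CARD('n)"] by blast
    have "(1 - \<epsilon>) * real n \<le> real (card (distances N S))" if "n \<ge> n0" "finite S" "card S = n" for n S
      using typical_distances_bound[OF N T that(2,3)] n0[OF that(1)] by blast
    then show ?thesis by blast
  qed
  have attained: "\<exists>S. finite S \<and> card S = n \<and> card (distances N S) = min_distances N n" for n
    unfolding min_distances_def by (rule LeastI_ex) (use few_distances_exist[OF N, of n] in blast)
  have upper: "min_distances N n \<le> n" for n
  proof -
    obtain S where S: "finite S" "card S = n" "card (distances N S) \<le> n" using few_distances_exist[OF N] by blast
    have "min_distances N n \<le> card (distances N S)"
      unfolding min_distances_def by (rule Least_le) (use S in blast)
    then show ?thesis using S by simp
  qed
  have "(\<lambda>n. real (min_distances N n) / real n) \<longlonglongrightarrow> 1"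
  proof (rule LIMSEQ_I)
    fix r :: real assume "r > 0"
    then obtain n0 where n0: "\<And>n S. n \<ge> n0 \<Longrightarrow> finite S \<and> card S = n \<Longrightarrow>
        (1 - r / 2) * real n \<le> real (card (distances N S))"
      using lower[of "r / 2"] by auto
    have "norm (real (min_distances N n) / real n - 1) < r" if n: "n \<ge> max n0 1" for n
    proof -
      obtain S where "finite S" "card S = n" "card (distances N S) = min_distances N n" using attained by blast
      then have "(1 - r / 2) * real n \<le> real (min_distances N n)" using n0[of n S] n by simp
      moreover have "real (min_distances N n) \<le> real n" using upper by simp
      ultimately have "1 - r / 2 \<le> real (min_distances N n) / real n" "real (min_distances N n) / real n \<le> 1"
        using n by (auto simp: pos_le_divide_eq)
      then show ?thesis using \<open>r > 0\<close> by (simp add: abs_if)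
    qed
    then show "\<exists>no. \<forall>n\<ge>no. norm (real (min_distances N n) / real n - 1) < r" by blast
  qed
  then show "(\<lambda>n. real (min_distances N n) / real n) \<longlonglongrightarrow> 1 \<and>
      (\<forall>\<epsilon>>0. \<exists>n0. \<forall>n\<ge>n0. \<forall>S. finite S \<and> card S = n \<longrightarrow>
              real (card (distances N S)) \<ge> (1 - \<epsilon>) * real n)"
    using lower by blast
qed

end
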